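(* Consider a Markov potential game with parametrized policies and potential value function $u:\mathbb{R}^M\to\mathbb{R}$, and let $\{\theta_t\}_{t\ge 0}$ be the joint parameters generated by networked policy gradient play (both as defined in the context). Assume: (A1) The graph $(\mathcal{N},\mathcal{E}_\infty)$, $\mathcal{E}_\infty=\{(i,j): (i,j)\in\mathcal{E}_t \text{ for infinitely many } t\in\mathbb{N}\}$, is connected, and there is an integer $T_{\mathcal{G}}>0$ such that for every $(i,j)\in\mathcal{E}_\infty$ and every $t\ge1$, $(i,j)\in\bigcup_{\tau=0}^{T_{\mathcal{G}}-1}\mathcal{E}_{t+\tau}$. (A2) There is $h\in(0,1)$ such that for all $i,j\in\mathcal{N}$ and $t\ge1$: (i) if $i\ne j$, then $w^i_{jl,t}\ge h$ for $l\in\mathcal{N}_{i,t}\cup\{i\}$ and $w^i_{jl,t}=0$ otherwise; (ii) $w^j_{jj,t}=1$; (iii) $\sum_{l\in\mathcal{N}}w^i_{jl,t}=1$ (all weights nonnegative). (A3) There is $\kappa\ge0$ with $\mathbb{E}[|\hat\theta^i_{j,0}(m)-\theta_{j,0}(m)|]\le\kappa$ for all $i\neq j$ and every coordinate $m$; and $\hat\theta^j_{j,0}=\theta_{j,0}$ for all $j$. (A4) The step sizes $\alpha_t>0$ satisfy $\alpha_t=\mathcal{O}(t^{-\beta})$ for some $\beta\in(1/2,1)$ and the Robbins–Monro condition $\sum_t\alpha_t=\infty$, $\sum_t\alpha_t^2<\infty$. (A5) There is $R>0$ with $|r_i(s,a)|\le R$ for all $i\in\mathcal{N}$, $(s,a)\in\mathcal{S}\times\mathcal{A}^N$.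 (A6) There are $B,V,\mathcal{L}\ge0$ such that for all $i,n\in\mathcal{N}$, $\theta\in\mathbb{R}^M$, $s\in\mathcal{S}$: $\mathbb{E}_{a_n\sim\pi_{n,\theta}(\cdot|s)}\|\nabla_i\log\pi_{n,\theta}(a_n|s)\|\le B$ and $\mathbb{E}_{a_n\sim\pi_{n,\theta}(\cdot|s)}\|\nabla_i\log\pi_{n,\theta}(a_n|s)\|^2\le V^2$; and for all $\theta^1,\theta^2\in\mathbb{R}^M$, $s$, $a_n$: $\|\nabla_i\log\pi_{n,\theta^1}(a_n|s)-\nabla_i\log\pi_{n,\theta^2}(a_n|s)\|\le\mathcal{L}\|\theta^1-\theta^2\|$. Then $\{\theta_t\}_{t\ge0}$ converges to a stationary point of the potential function almost surely, in the sense that $\lim_{t\to\infty}\nabla u(\theta_t)=0$ almost surely.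
   Context: **Game.** Agents $\mathcal{N}=\{1,\dots,N\}$, common action set $\mathcal{A}\subseteq\mathbb{R}^K$ and state space $\mathcal{S}$ (not necessarily finite), transition law $\mathcal{P}^a_{s',s}=\mathbb{P}(s'|s,a)$ for joint actions $a\in\mathcal{A}^N$, rewards $r_i:\mathcal{S}\times\mathcal{A}^N\to\mathbb{R}$, discount $\gamma\in(0,1)$, and a fixed initial state $s_0$ (suppressed from the notation). Joint parameter $\theta=(\theta_1,\dots,\theta_N)\in\mathbb{R}^M$, $\theta_i\in\mathbb{R}^{M_i}$, $\sum_iM_i=M$. Each agent $n$ has a smooth, differentiable policy (density or mass function) $\pi_{n,\theta}(a_n|s)$ which may depend on the whole vector $\theta$; the joint policy is $\Pi_\theta(a|s)=\pi_\theta(a|s)=\prod_{n}\pi_{n,\theta}(a_n|s)$. $\nabla_i$ is the gradient with respect to $\theta_i$. Utilities: $u_i(\theta)=u_i(\theta_i,\theta_{-i})=\mathbb{E}[\sum_{t\ge0}\gamma^tr_i(s_t,a_t)\mid s_0]$ with $a_t\sim\Pi_\theta(\cdot|s_t)$ and $s_{t+1}\sim\mathbb{P}(\cdot|s_t,a_t)$. The game is a *Markov potential game* if there is $u:\mathbb{R}^M\to\mathbb{R}$ with $\nabla_iu_i(\theta_i,\theta_{-i})=\nabla_iu(\theta)$ for all $i$ and all $\theta\in\mathbb{R}^M$. **Gradient estimator $\hat\nabla_iu_i(\theta)$ at $\theta$.** $\mathrm{Geom}(p)$ is the law on $\{0,1,\dots\}$ with $\mathbb{P}(x)=(1-p)^xp$.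 Draw $\mathcal{T}_1\sim\mathrm{Geom}(1-\gamma)$, run the Markov chain from $s_0$ under $\Pi_\theta$ for $\mathcal{T}_1$ steps, and record $(s_{\mathcal{T}_1},a_{\mathcal{T}_1})$. Then set $$\hat\nabla_iu_i(\theta)=\frac1{1-\gamma}\hat R_i\sum_{n\in\mathcal{N}}\nabla_i\log\pi_{n,\theta}(a_{n,\mathcal{T}_1}|s_{\mathcal{T}_1}),$$ where $\hat R_i$ is one of: (Q) $\hat Q_i=\sum_{t=\mathcal{T}_1}^{\mathcal{T}_1+\mathcal{T}_2}\gamma^{(t-\mathcal{T}_1)/2}r_i(s_t,a_t)$, continuing the chain from $(s_{\mathcal{T}_1},a_{\mathcal{T}_1})$ under $\Pi_\theta$, with $\mathcal{T}_2\sim\mathrm{Geom}(1-\gamma^{1/2})$ independent; (advantage) $\hat Q_i-\hat V_i(s_{\mathcal{T}_1})$; (temporal difference) $r_i(s_{\mathcal{T}_1},a_{\mathcal{T}_1})+\gamma\hat V_i(s_{\mathcal{T}_1+1})-\hat V_i(s_{\mathcal{T}_1})$. Here $\hat V_i(s)$ is the same kind of sum of $\gamma^{k/2}r_i$, $k=0,\dots,\mathcal{T}_2'$, along a fresh trajectory started at state $s$ under $\Pi_\theta$, with independent $\mathcal{T}_2'\sim\mathrm{Geom}(1-\gamma^{1/2})$; the estimate $\hat V_i(s_{\mathcal{T}_1})$ is conditionally independent of everything else given $s_{\mathcal{T}_1}$. **Networked policy gradient play.** $\mathcal{G}_t=(\mathcal{N},\mathcal{E}_t)$ is a given sequence of undirected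 graphs, $\mathcal{N}_{i,t}=\{j:(i,j)\in\mathcal{E}_t\}$, and $w^i_{jl,t}\ge0$ are given weights. Agent $i$ keeps a belief $\hat\theta^i_{j,t}\in\mathbb{R}^{M_j}$ about $\theta_{j,t}$ for each $j$, with $\hat\theta^j_{j,t}=\theta_{j,t}$; $x(m)$ denotes the $m$-th coordinate of $x$. Starting from (possibly random) $\theta_0$ and beliefs $\hat\theta^i_{j,0}$, at each $t=1,2,\dots$: (1) each agent $i$ produces, with fresh randomness given the past, the estimator $\hat\nabla_iu_i(\theta_{i,t-1},\hat\theta^i_{-i,t-1})$, i.e. the estimator above evaluated at the joint parameter formed from its own parameter and its beliefs; (2) $\theta_{i,t}=\theta_{i,t-1}+\alpha_t\hat\nabla_iu_i(\theta_{i,t-1},\hat\theta^i_{-i,t-1})$; (3) beliefs are updated by consensus: writing $\hat\theta_{j}(m)\in\mathbb{R}^N$ for the vector $(\hat\theta^1_j(m),\dots,\hat\theta^N_j(m))$, $W_{j,t}=(w^i_{jl,t})_{i,l}$, and $e_j$ for the $j$-th canonical basis vector of $\mathbb{R}^N$, $\hat\theta_{j,t}(m)=W_{j,t}\big(\hat\theta_{j,t-1}(m)+(\theta_{j,t}(m)-\theta_{j,t-1}(m))e_j\big)$. *)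

theory Defs
  imports "HOL-Probability.Probability" "HOL-Library.Landau_Symbols"
begin

definition grad :: "(real ^ 'm \<Rightarrow> real) \<Rightarrow> real ^ 'm \<Rightarrow> real ^ 'm" where
  "grad f x = (THE D. GDERIV f x :> D)"

text \<open>
  The coordinates of the joint parameter in \<open>real ^ 'm\<close> are distributed among the agents by a map
  \<open>own :: 'm \<Rightarrow> 'n\<close>; the parameter of agent \<open>i\<close> is the block of coordinates \<open>m\<close> with
  \<open>own m = i\<close>, so the blocks may have different dimensions. A vector belonging to a single
  block is represented by its extension by zero to all of \<open>real ^ 'm\<close>, which has the same norm.
\<close>

definition merge_block :: "('m \<Rightarrow> 'n) \<Rightarrow> 'n \<Rightarrow> real ^ 'm \<Rightarrow> real ^ 'm \<Rightarrow> real ^ 'm" where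
  "merge_block own i x y = (\<chi> m. if own m = i then x $ m else y $ m)"

text \<open>
  The function \<open>\<lambda>x. f (merge_block own i x \<theta>)\<close> depends on block \<open>i\<close> of \<open>x\<close> only, so that
  its gradient at \<open>\<theta>\<close>, if it exists, vanishes outside block \<open>i\<close>: it is the gradient of
  \<open>f\<close> at \<open>\<theta>\<close> with respect to the parameter of agent \<open>i\<close>.
\<close>

definition block_differentiable ::
    "('m \<Rightarrow> 'n) \<Rightarrow> 'n \<Rightarrow> (real ^ 'm \<Rightarrow> real) \<Rightarrow> real ^ 'm \<Rightarrow> bool" where
  "block_differentiable own i f \<theta> \<longleftrightarrow> (\<lambda>x. f (merge_block own i x \<theta>)) differentiable (at \<theta>)"

definition block_grad ::
    "('m \<Rightarrow> 'n) \<Rightarrow> 'n \<Rightarrow> (real ^ 'm \<Rightarrow> real) \<Rightarrow> real ^ 'm \<Rightarrow> real ^ 'm" where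
  "block_grad own i f \<theta> = grad (\<lambda>x. f (merge_block own i x \<theta>)) \<theta>"

text \<open>
  \<open>pol G n \<theta> s\<close> is the density of the policy of agent \<open>n\<close> with respect to the reference
  measure \<open>act_ref G\<close> on the action set. Lebesgue measure gives densities, counting measure on a
  countable action set gives mass functions.
\<close>

record ('s, 'n, 'k, 'm) game =
  states  :: "'s measure"
  actions :: "(real ^ 'k) set"
  act_ref :: "(real ^ 'k) measure"
  next_state :: "'s \<Rightarrow> ('n \<Rightarrow> real ^ 'k) \<Rightarrow> 's measure"
  rew     :: "'n \<Rightarrow> 's \<Rightarrow> ('n \<Rightarrow> real ^ 'k) \<Rightarrow> real"
  disc    :: real
  init    :: 's
  own     :: "'m \<Rightarrow> 'n"
  pol     :: "'n \<Rightarrow> real ^ 'm \<Rightarrow> 's \<Rightarrow> real ^ 'k \<Rightarrow> real"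

definition joint_ref ::
    "('s, 'n::finite, 'k::finite, 'm::finite) game \<Rightarrow> ('n \<Rightarrow> real ^ 'k) measure" where
  "joint_ref G = PiM UNIV (\<lambda>_. act_ref G)"

definition markov_game :: "('s, 'n::finite, 'k::finite, 'm::finite) game \<Rightarrow> bool" where
  "markov_game G \<longleftrightarrow>
     init G \<in> space (states G) \<and>
     0 < disc G \<and> disc G < 1 \<and>
     sigma_finite_measure (act_ref G) \<and>
     sets (act_ref G) = sets (restrict_space borel (actions G)) \<and>
     (\<lambda>(s, a). next_state G s a) \<in> states G \<Otimes>\<^sub>M joint_ref G \<rightarrow>\<^sub>M prob_algebra (states G) \<and>
     (\<forall>i. (\<lambda>(s, a). rew G i s a) \<in> borel_measurable (states G \<Otimes>\<^sub>M joint_ref G)) \<and>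
     (\<forall>n \<theta>. (\<lambda>(s, a). pol G n \<theta> s a) \<in> borel_measurable (states G \<Otimes>\<^sub>M act_ref G)) \<and>
     (\<forall>n \<theta>. \<forall>s\<in>space (states G). \<forall>a\<in>actions G.
        0 \<le> pol G n \<theta> s a \<and> (\<lambda>\<theta>'. pol G n \<theta>' s a) differentiable (at \<theta>)) \<and>
     (\<forall>n \<theta>. \<forall>s\<in>space (states G). (\<integral>\<^sup>+ a. ennreal (pol G n \<theta> s a) \<partial>act_ref G) = 1)"

definition policy ::
    "('s, 'n::finite, 'k::finite, 'm::finite) game \<Rightarrow> 'n \<Rightarrow> real ^ 'm \<Rightarrow> 's \<Rightarrow> (real ^ 'k) measure" where
  "policy G n \<theta> s = density (act_ref G) (\<lambda>a. ennreal (pol G n \<theta> s a))"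

definition joint_policy ::
    "('s, 'n::finite, 'k::finite, 'm::finite) game \<Rightarrow> real ^ 'm \<Rightarrow> 's \<Rightarrow> ('n \<Rightarrow> real ^ 'k) measure" where
  "joint_policy G \<theta> s = density (joint_ref G) (\<lambda>a. ennreal (\<Prod>n\<in>UNIV. pol G n \<theta> s (a n)))"

text \<open>
  The law of the trajectory \<open>(s\<^sub>0, a\<^sub>0), (s\<^sub>1, a\<^sub>1), \<dots>\<close> started at state \<open>s\<close> is the
  Ionescu-Tulcea measure for the kernels \<open>step_kernel\<close>, in which the history \<open>x\<close> enters through
  its last entry only.
\<close>

definition draw_action ::
    "('s, 'n::finite, 'k::finite, 'm::finite) game \<Rightarrow> real ^ 'm \<Rightarrow> 's \<Rightarrow> ('s \<times> ('n \<Rightarrow> real ^ 'k)) measure" where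
  "draw_action G \<theta> s =
     distr (joint_policy G \<theta> s) (states G \<Otimes>\<^sub>M joint_ref G) (\<lambda>a. (s, a))"

definition step_kernel ::
    "('s, 'n::finite, 'k::finite, 'm::finite) game \<Rightarrow> real ^ 'm \<Rightarrow> 's \<Rightarrow> nat \<Rightarrow>
      (nat \<Rightarrow> 's \<times> ('n \<Rightarrow> real ^ 'k)) \<Rightarrow> ('s \<times> ('n \<Rightarrow> real ^ 'k)) measure" where
  "step_kernel G \<theta> s t x = (case t of
       0 \<Rightarrow> draw_action G \<theta> s
     | Suc k \<Rightarrow> next_state G (fst (x k)) (snd (x k)) \<bind> draw_action G \<theta>)"

definition traj ::
    "('s, 'n::finite, 'k::finite, 'm::finite) game \<Rightarrow> real ^ 'm \<Rightarrow> 's \<Rightarrow>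
      (nat \<Rightarrow> 's \<times> ('n \<Rightarrow> real ^ 'k)) measure" where
  "traj G \<theta> s =
     (let X = (\<lambda>_. states G \<Otimes>\<^sub>M joint_ref G)
      in projective_family.lim UNIV (Ionescu_Tulcea.CI (step_kernel G \<theta> s) X) X)"

definition reward_at ::
    "('s, 'n::finite, 'k::finite, 'm::finite) game \<Rightarrow> 'n \<Rightarrow>
      (nat \<Rightarrow> 's \<times> ('n \<Rightarrow> real ^ 'k)) \<Rightarrow> nat \<Rightarrow> real" where
  "reward_at G i \<omega> t = rew G i (fst (\<omega> t)) (snd (\<omega> t))"

definition utility ::
    "('s, 'n::finite, 'k::finite, 'm::finite) game \<Rightarrow> 'n \<Rightarrow> real ^ 'm \<Rightarrow> real" where
  "utility G i \<theta> = (\<integral>\<omega>. (\<Sum>t. disc G ^ t * reward_at G i \<omega> t) \<partial>traj G \<theta> (init G))"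

definition potential ::
    "('s, 'n::finite, 'k::finite, 'm::finite) game \<Rightarrow> (real ^ 'm \<Rightarrow> real) \<Rightarrow> bool" where
  "potential G u \<longleftrightarrow>
     (\<forall>i \<theta>. block_differentiable (own G) i (utility G i) \<theta> \<and>
            block_differentiable (own G) i u \<theta> \<and>
            block_grad (own G) i (utility G i) \<theta> = block_grad (own G) i u \<theta>)"

text \<open>
  At a pair \<open>(s, a)\<close> where the density vanishes for every parameter, \<open>score\<close> is zero because of
  \<open>ln 0 = 0\<close>. Positivity of the densities is therefore not required separately, and supports
  depending on the state and the agent are allowed.
\<close>

definition score ::
    "('s, 'n::finite, 'k::finite, 'm::finite) game \<Rightarrow> 'n \<Rightarrow> 'n \<Rightarrow> real ^ 'm \<Rightarrow> 's \<Rightarrow> real ^ 'k \<Rightarrow> real ^ 'm" where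
  "score G i n \<theta> s a = block_grad (own G) i (\<lambda>\<theta>'. ln (pol G n \<theta>' s a)) \<theta>"

datatype reward_estimator = Q_Function | Advantage | Temporal_Difference

definition horizon_law :: "('s, 'n::finite, 'k::finite, 'm::finite) game \<Rightarrow> nat measure" where
  "horizon_law G = measure_pmf (geometric_pmf (1 - disc G powr (1 / 2)))"

definition V_hat_law ::
    "('s, 'n::finite, 'k::finite, 'm::finite) game \<Rightarrow> 'n \<Rightarrow> real ^ 'm \<Rightarrow> 's \<Rightarrow> real measure" where
  "V_hat_law G i \<theta> s = do {
     T \<leftarrow> horizon_law G;
     \<omega> \<leftarrow> traj G \<theta> s;
     return borel (\<Sum>k=0..T. disc G powr (real k / 2) * reward_at G i \<omega> k)
   }"

text \<open>
  In the next two definitions \<open>\<omega>\<close> is the main trajectory, of which only finitely many steps are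
  used, and \<open>T1\<close> is the random time at which the state-action pair is recorded;
  \<open>R_hat_law\<close> is the conditional law of the reward estimate given \<open>\<omega>\<close> and \<open>T1\<close>.
\<close>

definition Q_hat_law ::
    "('s, 'n::finite, 'k::finite, 'm::finite) game \<Rightarrow> 'n \<Rightarrow> nat \<Rightarrow>
      (nat \<Rightarrow> 's \<times> ('n \<Rightarrow> real ^ 'k)) \<Rightarrow> real measure" where
  "Q_hat_law G i T1 \<omega> = do {
     T2 \<leftarrow> horizon_law G;
     return borel (\<Sum>t=T1..T1 + T2. disc G powr (real (t - T1) / 2) * reward_at G i \<omega> t)
   }"

definition R_hat_law ::
    "('s, 'n::finite, 'k::finite, 'm::finite) game \<Rightarrow> reward_estimator \<Rightarrow> 'n \<Rightarrow> real ^ 'm \<Rightarrow> nat \<Rightarrow>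
      (nat \<Rightarrow> 's \<times> ('n \<Rightarrow> real ^ 'k)) \<Rightarrow> real measure" where
  "R_hat_law G k i \<theta> T1 \<omega> = (case k of
       Q_Function \<Rightarrow> Q_hat_law G i T1 \<omega>
     | Advantage \<Rightarrow> do {
         q \<leftarrow> Q_hat_law G i T1 \<omega>;
         v \<leftarrow> V_hat_law G i \<theta> (fst (\<omega> T1));
         return borel (q - v)
       }
     | Temporal_Difference \<Rightarrow> do {
         v' \<leftarrow> V_hat_law G i \<theta> (fst (\<omega> (T1 + 1)));
         v \<leftarrow> V_hat_law G i \<theta> (fst (\<omega> T1));
         return borel (reward_at G i \<omega> T1 + disc G * v' - v)
       })"

definition grad_estimator_law ::
    "('s, 'n::finite, 'k::finite, 'm::finite) game \<Rightarrow> reward_estimator \<Rightarrow> 'n \<Rightarrow> real ^ 'm \<Rightarrow>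
      (real ^ 'm) measure" where
  "grad_estimator_law G k i \<theta> = do {
     T1 \<leftarrow> measure_pmf (geometric_pmf (1 - disc G));
     \<omega> \<leftarrow> traj G \<theta> (init G);
     R \<leftarrow> R_hat_law G k i \<theta> T1 \<omega>;
     return borel ((1 / (1 - disc G) * R) *\<^sub>R
       (\<Sum>n\<in>UNIV. score G i n \<theta> (fst (\<omega> T1)) (snd (\<omega> T1) n)))
   }"

text \<open>
  \<open>bel i t \<omega> $ m\<close> is the belief of agent \<open>i\<close> about the coordinate \<open>\<theta> t \<omega> $ m\<close>, which belongs to
  agent \<open>own G m\<close>, and \<open>g i t\<close> is the estimate that agent \<open>i\<close> produces in round \<open>t\<close>. The
  \<open>\<sigma>\<close>-algebra \<open>F t\<close> is the past up to and including round \<open>t\<close>. Only the conditional law of each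
  single estimate given the past is prescribed; the estimates of different agents in the same round
  may be dependent. The weight \<open>w t i j l\<close> is the one used by agent \<open>i\<close>, in round \<open>t\<close>, on what
  agent \<open>l\<close> believes about agent \<open>j\<close>.
\<close>

definition networked_play ::
    "('s, 'n::finite, 'k::finite, 'm::finite) game \<Rightarrow> ('n \<Rightarrow> reward_estimator) \<Rightarrow>
      (nat \<Rightarrow> real) \<Rightarrow> (nat \<Rightarrow> 'n \<Rightarrow> 'n \<Rightarrow> 'n \<Rightarrow> real) \<Rightarrow>
      'w measure \<Rightarrow> (nat \<Rightarrow> 'w measure) \<Rightarrow>
      (nat \<Rightarrow> 'w \<Rightarrow> real ^ 'm) \<Rightarrow> ('n \<Rightarrow> nat \<Rightarrow> 'w \<Rightarrow> real ^ 'm) \<Rightarrow> ('n \<Rightarrow> nat \<Rightarrow> 'w \<Rightarrow> real ^ 'm) \<Rightarrow>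
      bool" where
  "networked_play G est \<alpha> w P F \<theta> bel g \<longleftrightarrow>
     prob_space P \<and> filtration (space P) F \<and> (\<forall>t. subalgebra P (F t)) \<and>
     \<theta> 0 \<in> borel_measurable (F 0) \<and> (\<forall>i. bel i 0 \<in> borel_measurable (F 0)) \<and>
     (\<forall>i t. g i (Suc t) \<in> borel_measurable (F (Suc t))) \<and>
     (\<forall>i t. \<forall>B\<in>sets borel. AE \<omega> in P.
        real_cond_exp P (F t) (indicator (g i (Suc t) -` B \<inter> space P)) \<omega> =
        measure (grad_estimator_law G (est i) i (merge_block (own G) i (\<theta> t \<omega>) (bel i t \<omega>))) B) \<and>
     (\<forall>t. \<forall>\<omega>\<in>space P. \<forall>m.
        \<theta> (Suc t) \<omega> $ m = \<theta> t \<omega> $ m + \<alpha> (Suc t) * g (own G m) (Suc t) \<omega> $ m) \<and>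
     (\<forall>t. \<forall>\<omega>\<in>space P. \<forall>j m. own G m = j \<longrightarrow>
        (\<chi> i. bel i (Suc t) \<omega> $ m) =
        (\<chi> i l. w (Suc t) i j l) *v
          ((\<chi> l. bel l t \<omega> $ m) + (\<theta> (Suc t) \<omega> $ m - \<theta> t \<omega> $ m) *\<^sub>R axis j 1))"

definition recurrent_edges :: "(nat \<Rightarrow> ('n \<times> 'n) set) \<Rightarrow> ('n \<times> 'n) set" where
  "recurrent_edges E = {e. infinite {t. e \<in> E t}}"

end

theory Submission
  imports Defs
begin

text \<open>
  The performance difference identity, applied with the elementary bound
  \<open>0 \<le> exp x - 1 - x \<le> x\<^sup>2 * (1 + exp x)\<close> for the likelihood ratio of the policies, gives a
  quadratic expansion \<open>utility \<theta>' - utility \<theta> = (\<theta>' - \<theta>) \<bullet> value_grad \<theta> + O(norm (\<theta>' - \<theta>)\<^sup>2)\<close>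
  that is uniform in \<open>\<theta>\<close> and uses second moments of the score only. Such an expansion yields at once
  differentiability, the policy gradient formula and the Lipschitz continuity of the gradient, and it
  passes to the potential by changing one block of coordinates at a time; the potential is bounded for
  the same reason. The estimator is unbiased with bounded second moment, so the noise of the play is a
  square-summable martingale (Kolmogorov's inequality) and almost surely the squared increments of
  \<open>\<theta>\<close> are summable. Consensus contracts the disagreement geometrically over windows in which the
  connected graph carries information from the owner of a coordinate to every agent, so on almost
  every path the disagreement is square-summable as well, and the bias it causes is absorbed
  by the step sizes. What remains is gradient ascent with a summable perturbation along a single path.
\<close>

section \<open>Markov kernels\<close>

text \<open>The scores are controlled in second moment only and may be unbounded, and states and
  actions need not be finite, so exchanging derivative and trajectory integral is not directly
  available. A two-point estimate for the utilities replaces every such exchange, with a remainder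
  that is quadratic with one constant for all parameters. Comparing two policies one step at a time
  keeps products of likelihood ratios over a whole trajectory out of the argument.

  A second obstacle: \<open>potential\<close> yields differentiability blockwise only, while
  \<open>grad\<close> is a definite description and needs the full derivative. Hence the potential
  is rebuilt from the increments of the utilities along single blocks.

  The stochastic part is scalar, one coordinate at a time, since estimates of different agents in
  one round may be dependent. The moves of the iterate are square-summable but not known to be
  summable; the same then holds for the disagreement, which is paired with the square-summable step
  sizes. Square-summability thus replaces any rate for the disagreement.\<close>

lemma integrable_integral_bind:
  fixes f :: "'b \<Rightarrow> real"
  assumes M: "M \<in> space (prob_algebra M')"
    and N: "N \<in> M' \<rightarrow>\<^sub>M prob_algebra K"
    and f: "integrable (M \<bind> N) f"
  shows "integrable M (\<lambda>x. integral\<^sup>L (N x) f)"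
    and "integral\<^sup>L (M \<bind> N) f = (\<integral>x. integral\<^sup>L (N x) f \<partial>M)"
    and "AE x in M. integrable (N x) f"
proof -
  have sM: "sets M = sets M'" and pM: "prob_space M" using M by (auto simp: space_prob_algebra)
  have N'[measurable]: "N \<in> M \<rightarrow>\<^sub>M prob_algebra K" using N sM measurable_cong_sets by blast
  have N''[measurable]: "N \<in> M \<rightarrow>\<^sub>M subprob_algebra K" using N' by (rule measurable_prob_algebraD)
  have ne: "space M \<noteq> {}" using pM by (rule prob_space.not_empty)
  have sb: "sets (M \<bind> N) = sets K" using M N by (rule sets_bind')
  have fm[measurable]: "f \<in> borel_measurable K"
    using borel_measurable_integrable[OF f] measurable_cong_sets[OF sb refl] by blast
  have snx: "sets (N x) = sets K" if "x \<in> space M" for x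
    using measurable_space[OF N' that] by (auto simp: space_prob_algebra)
  have fmx: "f \<in> borel_measurable (N x)" if "x \<in> space M" for x
    using fm measurable_cong_sets[OF snx[OF that] refl] by blast
  let ?p = "\<lambda>x. ennreal (f x)" and ?n = "\<lambda>x. ennreal (- f x)"
  have P: "(\<integral>\<^sup>+x. g x \<partial>(M \<bind> N)) = (\<integral>\<^sup>+x. \<integral>\<^sup>+y. g y \<partial>N x \<partial>M)"
    if "g \<in> borel_measurable K" for g :: "'b \<Rightarrow> ennreal"
    using that N'' by (rule nn_integral_bind)
  have b: "(\<integral>\<^sup>+x. norm (f x) \<partial>(M \<bind> N)) < \<infinity>" using f by (simp add: integrable_iff_bounded)
  hence b': "(\<integral>\<^sup>+x. \<integral>\<^sup>+y. norm (f y) \<partial>N x \<partial>M) < \<infinity>" by (subst (asm) P) simp_all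
  have bm: "(\<lambda>x. \<integral>\<^sup>+y. norm (f y) \<partial>N x) \<in> borel_measurable M"
    by (rule nn_integral_measurable_subprob_algebra2[where N=K]) auto
  from nn_integral_PInf_AE[OF bm] b' have ae: "AE x in M. (\<integral>\<^sup>+y. norm (f y) \<partial>N x) \<noteq> \<infinity>" by auto
  then show aei: "AE x in M. integrable (N x) f"
  proof (rule AE_mp[OF _ AE_I2], intro impI)
    fix x assume "x \<in> space M" and "(\<integral>\<^sup>+y. norm (f y) \<partial>N x) \<noteq> \<infinity>"
    then show "integrable (N x) f" using fmx by (auto simp: integrable_iff_bounded less_top)
  qed
  have im: "(\<lambda>x. integral\<^sup>L (N x) f) \<in> borel_measurable M"
    using measurable_compose[OF N'' integral_measurable_subprob_algebra[OF fm]] by simp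
  show int: "integrable M (\<lambda>x. integral\<^sup>L (N x) f)"
  proof (rule integrableI_bounded[OF im])
    have "(\<integral>\<^sup>+x. ennreal (norm (integral\<^sup>L (N x) f)) \<partial>M) \<le> (\<integral>\<^sup>+x. \<integral>\<^sup>+y. norm (f y) \<partial>N x \<partial>M)"
      by (intro nn_integral_mono_AE) (use aei in \<open>eventually_elim, metis integral_norm_bound_ennreal\<close>)
    then show "(\<integral>\<^sup>+x. ennreal (norm (integral\<^sup>L (N x) f)) \<partial>M) < \<infinity>" using b' by (rule le_less_trans)
  qed
  have fin: "(\<integral>\<^sup>+x. ?p x \<partial>(M \<bind> N)) < \<infinity>" "(\<integral>\<^sup>+x. ?n x \<partial>(M \<bind> N)) < \<infinity>"
    using le_less_trans[OF nn_integral_mono b, of ?p] le_less_trans[OF nn_integral_mono b, of ?n]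
    by (auto intro!: ennreal_leI simp: less_top[symmetric])
  have pm: "(\<lambda>x. \<integral>\<^sup>+y. ?p y \<partial>N x) \<in> borel_measurable M" "(\<lambda>x. \<integral>\<^sup>+y. ?n y \<partial>N x) \<in> borel_measurable M"
    by (rule nn_integral_measurable_subprob_algebra2[where N=K]; auto)+
  \<comment> \<open>The inner integrals are finite only almost everywhere. \<open>enn2real\<close>
    sends the value infinity to zero on a null set, so the iterated nonnegative integral becomes a
    real one; this is applied to the positive and to the negative part of \<open>f\<close>.\<close>
  have e: "(\<integral>\<^sup>+x. \<integral>\<^sup>+y. g y \<partial>N x \<partial>M) = ennreal (\<integral>x. enn2real (\<integral>\<^sup>+y. g y \<partial>N x) \<partial>M)
     \<and> integrable M (\<lambda>x. enn2real (\<integral>\<^sup>+y. g y \<partial>N x))"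
    if g: "g \<in> borel_measurable K" and gf: "(\<integral>\<^sup>+x. g x \<partial>(M \<bind> N)) < \<infinity>" for g :: "'b \<Rightarrow> ennreal"
  proof -
    have gm: "(\<lambda>x. \<integral>\<^sup>+y. g y \<partial>N x) \<in> borel_measurable M"
      by (rule nn_integral_measurable_subprob_algebra2[where N=K]) (use g in auto)
    have fi: "(\<integral>\<^sup>+x. \<integral>\<^sup>+y. g y \<partial>N x \<partial>M) < \<infinity>" using gf P[OF g] by simp
    from nn_integral_PInf_AE[OF gm] fi have "AE x in M. (\<integral>\<^sup>+y. g y \<partial>N x) \<noteq> \<infinity>" by auto
    hence eq: "(\<integral>\<^sup>+x. \<integral>\<^sup>+y. g y \<partial>N x \<partial>M) = (\<integral>\<^sup>+x. ennreal (enn2real (\<integral>\<^sup>+y. g y \<partial>N x)) \<partial>M)"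
      by (intro nn_integral_cong_AE) (auto simp: less_top)
    have i: "integrable M (\<lambda>x. enn2real (\<integral>\<^sup>+y. g y \<partial>N x))"
      by (rule integrableI_nonneg) (use gm fi eq in auto)
    show ?thesis using eq i nn_integral_eq_integral[OF i] by simp
  qed
  have "integral\<^sup>L (M \<bind> N) f = enn2real (\<integral>\<^sup>+x. ?p x \<partial>(M \<bind> N)) - enn2real (\<integral>\<^sup>+x. ?n x \<partial>(M \<bind> N))"
    by (rule real_lebesgue_integral_def[OF f])
  also have "\<dots> = (\<integral>x. enn2real (\<integral>\<^sup>+y. ?p y \<partial>N x) \<partial>M) - (\<integral>x. enn2real (\<integral>\<^sup>+y. ?n y \<partial>N x) \<partial>M)"
    using e[of ?p] e[of ?n] fin by (subst (1 2) P) (auto intro!: enn2real_ennreal Bochner_Integration.integral_nonneg)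
  also have "\<dots> = (\<integral>x. enn2real (\<integral>\<^sup>+y. ?p y \<partial>N x) - enn2real (\<integral>\<^sup>+y. ?n y \<partial>N x) \<partial>M)"
    using e[of ?p] e[of ?n] fin by (subst Bochner_Integration.integral_diff) auto
  also have "\<dots> = (\<integral>x. integral\<^sup>L (N x) f \<partial>M)"
  proof (rule integral_cong_AE)
    show "(\<lambda>x. enn2real (\<integral>\<^sup>+y. ?p y \<partial>N x) - enn2real (\<integral>\<^sup>+y. ?n y \<partial>N x)) \<in> borel_measurable M"
      using pm by measurable
    show "AE x in M. enn2real (\<integral>\<^sup>+y. ?p y \<partial>N x) - enn2real (\<integral>\<^sup>+y. ?n y \<partial>N x) = integral\<^sup>L (N x) f"
      using aei by eventually_elim (simp add: real_lebesgue_integral_def)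
  qed (rule im)
  finally show "integral\<^sup>L (M \<bind> N) f = (\<integral>x. integral\<^sup>L (N x) f \<partial>M)" .
qed

lemma le_one_plus_square: "x \<le> 1 + x\<^sup>2" for x :: real
  using zero_le_power2[of "x - 1 / 2"] by (simp add: power2_eq_square algebra_simps)

text \<open>Tonelli makes the mass of each fixed set measurable in the parameter, and the
  normalisation \<open>one\<close> makes the measures probabilities. This turns the joint policy
  into a Markov kernel.\<close>

lemma measurable_density_kernel:
  assumes "sigma_finite_measure M"
    and [measurable]: "(\<lambda>(x, y). p x y) \<in> borel_measurable (L \<Otimes>\<^sub>M M)"
    and one: "\<And>x. x \<in> space L \<Longrightarrow> (\<integral>\<^sup>+y. p x y \<partial>M) = 1"
  shows "(\<lambda>x. density M (p x)) \<in> L \<rightarrow>\<^sub>M prob_algebra M"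
proof -
  interpret sigma_finite_measure M by fact
  have [measurable]: "p x \<in> borel_measurable M" if "x \<in> space L" for x
    using measurable_Pair2[OF assms(2) that] by simp
  have pr: "prob_space (density M (p x))" if "x \<in> space L" for x
    by (rule prob_spaceI) (use that one in \<open>simp add: emeasure_density nn_integral_set_ennreal cong: nn_integral_cong\<close>)
  show ?thesis
  proof (rule measurable_prob_algebraI[OF pr])
    show "(\<lambda>x. density M (p x)) \<in> L \<rightarrow>\<^sub>M subprob_algebra M"
    proof (rule measurable_subprob_algebra)
      fix A assume A[measurable]: "A \<in> sets M"
      have "(\<lambda>x. \<integral>\<^sup>+y. p x y * indicator A y \<partial>M) \<in> borel_measurable L"
        by (rule borel_measurable_nn_integral) measurable
      then show "(\<lambda>x. emeasure (density M (p x)) A) \<in> borel_measurable L"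
        by (rule measurable_cong[THEN iffD1, rotated]) (simp add: emeasure_density)
    qed (auto intro: prob_space_imp_subprob_space pr)
  qed
qed

lemma borel_measurable_vecI:
  fixes f :: "'a \<Rightarrow> real ^ 'm::finite"
  assumes "\<And>m. (\<lambda>x. f x $ m) \<in> borel_measurable M"
  shows "f \<in> borel_measurable M"
proof -
  have "(\<lambda>x. \<Sum>m\<in>UNIV. (f x $ m) *\<^sub>R axis m (1::real)) \<in> borel_measurable M"
    by (intro borel_measurable_sum borel_measurable_scaleR borel_measurable_const assms)
  moreover have "(\<Sum>m\<in>UNIV. (v $ m) *\<^sub>R axis m 1) = v" for v :: "real ^ 'm"
    using basis_expansion[of v] by (simp add: scalar_mult_eq_scaleR)
  ultimately show ?thesis by simp
qed

section \<open>Gradients with respect to a block of coordinates\<close>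

text \<open>Uniqueness of the representing vector is what allows a computed gradient to replace the
  definite description behind \<open>grad\<close>.\<close>

lemma grad_eqI: "GDERIV f x :> D \<Longrightarrow> grad f x = D"
proof -
  assume D: "GDERIV f x :> D"
  have "D' = D" if "GDERIV f x :> D'" for D'
  proof -
    have "(\<lambda>h. h \<bullet> D') = (\<lambda>h. h \<bullet> D)"
      using that D unfolding gderiv_def by (rule has_derivative_unique)
    then have "(D' - D) \<bullet> D' = (D' - D) \<bullet> D" by metis
    then have "(D' - D) \<bullet> (D' - D) = 0" by (simp add: inner_diff_right)
    then show "D' = D" by simp
  qed
  with D show ?thesis unfolding grad_def by blast
qed

lemma GDERIV_grad:
  fixes f :: "real ^ 'm::finite \<Rightarrow> real"
  assumes "f differentiable (at x)"
  shows "GDERIV f x :> grad f x"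
proof -
  obtain f' where f': "(f has_derivative f') (at x)" using assms by (auto simp: differentiable_def)
  interpret bounded_linear f' using f' by (rule has_derivative_bounded_linear)
  have "f' h = h \<bullet> (\<Sum>b\<in>Basis. f' b *\<^sub>R b)" for h
  proof -
    have "f' h = f' (\<Sum>b\<in>Basis. (h \<bullet> b) *\<^sub>R b)" by (simp add: euclidean_representation)
    also have "\<dots> = (\<Sum>b\<in>Basis. (h \<bullet> b) * f' b)" by (simp add: sum scaleR)
    finally show ?thesis by (simp add: inner_sum_right mult.commute)
  qed
  then have "f' = (\<lambda>h. h \<bullet> (\<Sum>b\<in>Basis. f' b *\<^sub>R b))" by blast
  with f' have "GDERIV f x :> (\<Sum>b\<in>Basis. f' b *\<^sub>R b)" unfolding gderiv_def by metis
  with grad_eqI[OF this] show ?thesis by simp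
qed

text \<open>The projection onto the coordinates of one agent. It is self-adjoint, and the
  projections of all agents add up to the identity, so block gradients can be treated by linear
  algebra.\<close>

definition block :: "('m \<Rightarrow> 'n) \<Rightarrow> 'n \<Rightarrow> real ^ 'm \<Rightarrow> real ^ 'm" where
  "block b i v = merge_block b i v 0"

lemma block_nth: "block b i v $ m = (if b m = i then v $ m else 0)"
  by (simp add: block_def merge_block_def)

lemma merge_block_nth: "merge_block b i x y $ m = (if b m = i then x $ m else y $ m)"
  by (simp add: merge_block_def)

lemma linear_block: "linear (block b i)"
  by (rule linearI) (auto simp: vec_eq_iff block_nth)

lemma bounded_linear_block: "bounded_linear (block b i :: real ^ 'm::finite \<Rightarrow> _)"
  using linear_block by (rule linear_conv_bounded_linear[THEN iffD1])

lemma block_block [simp]: "block b i (block b i v) = block b i v"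
  by (auto simp: vec_eq_iff block_nth)

lemma inner_block: "block b i x \<bullet> y = x \<bullet> block b i (y :: real ^ 'm::finite)"
  by (auto simp: inner_vec_def block_nth intro!: sum.cong)

lemma sum_block: "(\<Sum>i\<in>UNIV. block b i v) = (v :: real ^ 'm)"
  for b :: "'m::finite \<Rightarrow> 'n::finite"
  by (simp add: vec_eq_iff block_nth)

lemma norm_block_le: "norm (block b i v) \<le> norm (v :: real ^ 'm::finite)"
  by (rule norm_le_componentwise_cart) (simp add: block_nth)

lemma merge_block_eq: "merge_block b i x y = y + block b i (x - y)"
  by (auto simp: vec_eq_iff block_nth merge_block_nth)

lemma merge_block_same [simp]: "merge_block b i x x = x"
  by (auto simp: vec_eq_iff merge_block_nth)

lemma has_derivative_merge_block:
  "((\<lambda>x :: real ^ 'm::finite. merge_block b i x y) has_derivative block b i) (at x)"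
proof -
  have "((\<lambda>x. y + block b i (x - y)) has_derivative (\<lambda>h. 0 + block b i (h - 0))) (at x)"
    by (intro has_derivative_add has_derivative_const
        bounded_linear.has_derivative[OF bounded_linear_block] has_derivative_diff has_derivative_ident)
  then show ?thesis by (simp add: merge_block_eq[abs_def])
qed

lemma GDERIV_merge_block:
  fixes f :: "real ^ 'm::finite \<Rightarrow> real"
  assumes "GDERIV f \<theta> :> D"
  shows "GDERIV (\<lambda>x. f (merge_block b i x \<theta>)) \<theta> :> block b i D"
proof -
  have "(f has_derivative (\<lambda>h. h \<bullet> D)) (at (merge_block b i \<theta> \<theta>))" using assms by (simp add: gderiv_def)
  from diff_chain_at[OF has_derivative_merge_block this] show ?thesis
    by (simp add: gderiv_def comp_def inner_block)
qed

lemma block_grad_eqI: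
  fixes f :: "real ^ 'm::finite \<Rightarrow> real"
  shows "GDERIV f \<theta> :> D \<Longrightarrow> block_grad b i f \<theta> = block b i D"
  unfolding block_grad_def by (rule grad_eqI[OF GDERIV_merge_block])

lemma GDERIV_block_grad:
  fixes f :: "real ^ 'm::finite \<Rightarrow> real"
  assumes "block_differentiable b i f \<theta>"
  shows "GDERIV (\<lambda>x. f (merge_block b i x \<theta>)) \<theta> :> block_grad b i f \<theta>"
  using GDERIV_grad[OF assms[unfolded block_differentiable_def]] by (simp add: block_grad_def)

text \<open>Differentiability in one block at every point is enough for an ordinary derivative along
  a line that moves this block only. It is the bridge from \<open>potential\<close> to one-variable
  calculus.\<close>

lemma has_real_derivative_block_line:
  fixes f :: "real ^ 'm::finite \<Rightarrow> real"
  assumes "\<And>\<theta>. block_differentiable b i f \<theta>"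
  shows "((\<lambda>\<tau>. f (\<theta> + \<tau> *\<^sub>R block b i h)) has_real_derivative
    block b i h \<bullet> block_grad b i f (\<theta> + \<tau> *\<^sub>R block b i h)) (at \<tau>)"
proof -
  define \<theta>0 where "\<theta>0 = \<theta> + \<tau> *\<^sub>R block b i h"
  \<comment> \<open>The coordinates frozen by \<open>merge_block\<close> may be read off at any
    point of the line, because the line does not move them; freezing them at
    \<open>\<theta>0\<close> brings in the block gradient at that point.\<close>
  have e: "f (\<theta> + \<sigma> *\<^sub>R block b i h) = f (merge_block b i (\<theta> + \<sigma> *\<^sub>R block b i h) \<theta>0)" for \<sigma>
    by (rule arg_cong[where f=f]) (auto simp: vec_eq_iff merge_block_nth block_nth \<theta>0_def)
  have "((\<lambda>x. f (merge_block b i x \<theta>0)) has_derivative (\<lambda>h. h \<bullet> block_grad b i f \<theta>0)) (at (\<theta> + \<tau> *\<^sub>R block b i h))"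
    using GDERIV_block_grad[OF assms, of \<theta>0] by (simp add: gderiv_def \<theta>0_def)
  moreover have "((\<lambda>\<sigma>. \<theta> + \<sigma> *\<^sub>R block b i h) has_derivative (\<lambda>\<sigma>. \<sigma> *\<^sub>R block b i h)) (at \<tau>)"
    by (auto intro!: derivative_eq_intros)
  ultimately have "((\<lambda>\<sigma>. f (merge_block b i (\<theta> + \<sigma> *\<^sub>R block b i h) \<theta>0)) has_derivative
      (\<lambda>\<sigma>. (\<sigma> *\<^sub>R block b i h) \<bullet> block_grad b i f \<theta>0)) (at \<tau>)"
    using diff_chain_at by (fastforce simp: comp_def)
  then show ?thesis
    unfolding has_field_derivative_def e \<theta>0_def[symmetric] by (simp add: mult.commute[of _ "block b i h \<bullet> _"])
qed

text \<open>A positive value cannot decay to zero in finite time when the logarithmic derivative is locally bounded.\<close>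

lemma positive_or_zero_of_Lipschitz_log_gradient:
  fixes p :: "real ^ 'm::finite \<Rightarrow> real"
  assumes nonneg: "\<And>\<theta>. 0 \<le> p \<theta>" and diff: "\<And>\<theta>. p differentiable (at \<theta>)"
    and S: "\<And>\<theta>. 0 < p \<theta> \<Longrightarrow> GDERIV (\<lambda>\<theta>. ln (p \<theta>)) \<theta> :> S \<theta>"
    and lip: "\<And>\<theta>1 \<theta>2. norm (S \<theta>1 - S \<theta>2) \<le> C * norm (\<theta>1 - \<theta>2)"
    and pos: "0 < p \<theta>1"
  shows "0 < p \<theta>0"
proof -
  define d where "d = \<theta>0 - \<theta>1"
  define q where "q \<tau> = p (\<theta>1 + \<tau> *\<^sub>R d)" for \<tau>
  \<comment> \<open>A bound for the logarithmic derivative along the whole segment: the score at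
    \<open>\<theta>1\<close>, plus its Lipschitz growth, times the length of the segment.\<close>
  define K where "K = (norm (S \<theta>1) + \<bar>C\<bar> * norm d) * norm d"
  have qd: "(q has_real_derivative d \<bullet> grad p (\<theta>1 + \<tau> *\<^sub>R d)) (at \<tau>)" for \<tau>
  proof -
    have "(p has_derivative (\<lambda>h. h \<bullet> grad p (\<theta>1 + \<tau> *\<^sub>R d))) (at (\<theta>1 + \<tau> *\<^sub>R d))"
      using GDERIV_grad[OF diff] by (simp add: gderiv_def)
    moreover have "((\<lambda>\<sigma>. \<theta>1 + \<sigma> *\<^sub>R d) has_derivative (\<lambda>\<sigma>. \<sigma> *\<^sub>R d)) (at \<tau>)"
      by (auto intro!: derivative_eq_intros)
    ultimately have "(q has_derivative (\<lambda>\<sigma>. (\<sigma> *\<^sub>R d) \<bullet> grad p (\<theta>1 + \<tau> *\<^sub>R d))) (at \<tau>)"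
      using diff_chain_at unfolding q_def by (fastforce simp: comp_def)
    then show ?thesis unfolding has_field_derivative_def by (simp add: mult.commute[of _ "d \<bullet> _"])
  qed
  \<comment> \<open>At a zero of \<open>q\<close> there is no logarithm, but a zero of a nonnegative
    function is a minimum, so the derivative vanishes there and the bound holds trivially.\<close>
  have bound: "\<bar>d \<bullet> grad p (\<theta>1 + \<tau> *\<^sub>R d)\<bar> \<le> K * q \<tau>" if "0 \<le> \<tau>" "\<tau> \<le> 1" for \<tau>
  proof (cases "q \<tau> = 0")
    case True
    have "d \<bullet> grad p (\<theta>1 + \<tau> *\<^sub>R d) = 0"
      by (rule DERIV_local_min[OF qd, of 1]) (use True nonneg in \<open>auto simp: q_def\<close>)
    with True show ?thesis by simp
  next
    case False
    let ?x = "\<theta>1 + \<tau> *\<^sub>R d"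
    have px: "0 < p ?x" using False nonneg[of ?x] by (simp add: q_def order_less_le)
    have "GDERIV (\<lambda>\<theta>. ln (p \<theta>)) ?x :> inverse (p ?x) *\<^sub>R grad p ?x"
      by (rule GDERIV_DERIV_compose[OF GDERIV_grad[OF diff] DERIV_ln[OF px]])
    with grad_eqI[OF S[OF px]] have "S ?x = inverse (p ?x) *\<^sub>R grad p ?x" using grad_eqI by metis
    then have g: "grad p ?x = p ?x *\<^sub>R S ?x" using px by simp
    have "norm (S ?x) \<le> norm (S \<theta>1) + norm (S ?x - S \<theta>1)" by (metis add.commute norm_triangle_sub)
    also have "norm (S ?x - S \<theta>1) \<le> C * norm (\<tau> *\<^sub>R d)" using lip[of ?x \<theta>1] by simp
    also have "\<dots> \<le> \<bar>C\<bar> * norm d"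
      using that by (intro mult_mono) (auto simp: mult_left_le_one_le)
    finally have s: "norm (S ?x) \<le> norm (S \<theta>1) + \<bar>C\<bar> * norm d" by simp
    have "\<bar>d \<bullet> S ?x\<bar> \<le> norm d * norm (S ?x)" by (rule Cauchy_Schwarz_ineq2)
    also have "\<dots> \<le> K" unfolding K_def using mult_left_mono[OF s, of "norm d"] by (simp add: mult.commute)
    finally show ?thesis using px by (simp add: g q_def abs_mult mult.commute)
  qed
  \<comment> \<open>Gronwall's argument: the derivative is at least \<open>- K * q\<close>, so
    multiplying by the exponential makes the function nondecreasing.\<close>
  have "q 0 * exp (K * 0) \<le> q 1 * exp (K * 1)"
  proof (rule DERIV_nonneg_imp_nondecreasing[of 0 1 "\<lambda>\<tau>. q \<tau> * exp (K * \<tau>)"])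
    fix \<tau> :: real assume t: "0 \<le> \<tau>" "\<tau> \<le> 1"
    have "((\<lambda>\<tau>. q \<tau> * exp (K * \<tau>)) has_real_derivative
        (d \<bullet> grad p (\<theta>1 + \<tau> *\<^sub>R d)) * exp (K * \<tau>) + (exp (K * \<tau>) * (K * 1)) * q \<tau>) (at \<tau>)"
      by (intro DERIV_mult qd DERIV_fun_exp DERIV_cmult DERIV_ident)
    moreover have "0 \<le> (d \<bullet> grad p (\<theta>1 + \<tau> *\<^sub>R d)) * exp (K * \<tau>) + (exp (K * \<tau>) * (K * 1)) * q \<tau>"
    proof -
      have "0 \<le> (d \<bullet> grad p (\<theta>1 + \<tau> *\<^sub>R d) + K * q \<tau>) * exp (K * \<tau>)"
        using bound[OF t] by (intro mult_nonneg_nonneg) auto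
      then show ?thesis by (simp add: algebra_simps)
    qed
    ultimately show "\<exists>y. ((\<lambda>\<tau>. q \<tau> * exp (K * \<tau>)) has_real_derivative y) (at \<tau>) \<and> 0 \<le> y" by blast
  qed simp
  moreover have "0 < q 0" using pos by (simp add: q_def)
  ultimately have "0 < q 1 * exp K" by simp
  then have "0 < q 1" by (simp add: zero_less_mult_iff)
  then show ?thesis by (simp add: q_def d_def)
qed

text \<open>Mean value theorem on the segment: the gradient at the intermediate point differs from
  \<open>S x\<close> by at most \<open>C * norm (y - x)\<close>.\<close>

lemma Lipschitz_gradient_expansion:
  fixes f :: "real ^ 'm::finite \<Rightarrow> real"
  assumes S: "\<And>\<theta>. GDERIV f \<theta> :> S \<theta>"
    and lip: "\<And>\<theta>1 \<theta>2. norm (S \<theta>1 - S \<theta>2) \<le> C * norm (\<theta>1 - \<theta>2)" and C: "0 \<le> C"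
  shows "\<bar>f y - f x - (y - x) \<bullet> S x\<bar> \<le> C * (norm (y - x))\<^sup>2"
proof -
  define q where "q \<tau> = f (x + \<tau> *\<^sub>R (y - x))" for \<tau>
  have qd: "(q has_real_derivative (y - x) \<bullet> S (x + \<tau> *\<^sub>R (y - x))) (at \<tau>)" for \<tau>
  proof -
    have "(f has_derivative (\<lambda>h. h \<bullet> S (x + \<tau> *\<^sub>R (y - x)))) (at (x + \<tau> *\<^sub>R (y - x)))"
      using S by (simp add: gderiv_def)
    moreover have "((\<lambda>\<sigma>. x + \<sigma> *\<^sub>R (y - x)) has_derivative (\<lambda>\<sigma>. \<sigma> *\<^sub>R (y - x))) (at \<tau>)"
      by (auto intro!: derivative_eq_intros)
    ultimately have "(q has_derivative (\<lambda>\<sigma>. (\<sigma> *\<^sub>R (y - x)) \<bullet> S (x + \<tau> *\<^sub>R (y - x)))) (at \<tau>)"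
      using diff_chain_at unfolding q_def by (fastforce simp: comp_def)
    then show ?thesis unfolding has_field_derivative_def by (simp add: mult.commute[of _ "(y - x) \<bullet> _"])
  qed
  obtain \<tau> where t: "0 < \<tau>" "\<tau> < 1" "q 1 - q 0 = (1 - 0) * ((y - x) \<bullet> S (x + \<tau> *\<^sub>R (y - x)))"
    using MVT2[of 0 1 q "\<lambda>\<tau>. (y - x) \<bullet> S (x + \<tau> *\<^sub>R (y - x))"] qd by auto
  have "f y - f x - (y - x) \<bullet> S x = (y - x) \<bullet> (S (x + \<tau> *\<^sub>R (y - x)) - S x)"
    using t(3) by (simp add: q_def inner_diff_right)
  also have "\<bar>\<dots>\<bar> \<le> norm (y - x) * norm (S (x + \<tau> *\<^sub>R (y - x)) - S x)" by (rule Cauchy_Schwarz_ineq2)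
  also have "\<dots> \<le> norm (y - x) * (C * norm (\<tau> *\<^sub>R (y - x)))"
    using lip[of "x + \<tau> *\<^sub>R (y - x)" x] by (intro mult_left_mono) auto
  also have "\<dots> \<le> norm (y - x) * (C * norm (y - x))"
    using t C by (intro mult_left_mono) (auto simp: mult_left_le_one_le)
  finally show ?thesis by (simp add: power2_eq_square mult_ac)
qed

text \<open>The factor \<open>1 + exp x\<close> is tailored to likelihood ratios: multiplied by the
  density at the base point it becomes the sum of the densities at both points.\<close>

lemma exp_remainder_bounds:
  fixes x :: real
  shows "0 \<le> exp x - 1 - x" "exp x - 1 - x \<le> x\<^sup>2 * (1 + exp x)"
proof -
  show "0 \<le> exp x - 1 - x" using exp_ge_add_one_self[of x] by linarith
  have "1 - x \<le> exp (- x)" using exp_ge_add_one_self[of "- x"] by simp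
  then have "(1 - x) * exp x \<le> exp (- x) * exp x" by (rule mult_right_mono) simp
  then have e: "exp x - 1 \<le> x * exp x" by (simp add: algebra_simps flip: exp_add)
  then have "exp x - 1 - x \<le> x * (exp x - 1)" by (simp add: algebra_simps)
  also have "\<dots> \<le> x\<^sup>2 * (1 + exp x)"
  proof (cases "0 \<le> x")
    case True
    have "x * (exp x - 1) \<le> x * (x * exp x)" by (rule mult_left_mono[OF e True])
    also have "\<dots> \<le> x\<^sup>2 * (1 + exp x)" by (simp add: power2_eq_square algebra_simps)
    finally show ?thesis .
  next
    case False
    have "x * (exp x - 1) \<le> x * x"
      using False exp_ge_add_one_self[of x] by (intro mult_left_mono_neg) linarith+
    also have "\<dots> \<le> x\<^sup>2 * (1 + exp x)" unfolding power2_eq_square by (simp add: mult_le_cancel_left1)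
    finally show ?thesis .
  qed
  finally show "exp x - 1 - x \<le> x\<^sup>2 * (1 + exp x)" .
qed

text \<open>Only second moments of \<open>S\<close> enter on the right-hand side: exponential moments are avoided because the
  remainder is split between \<open>p x\<close> and \<open>p y\<close>.\<close>

lemma density_expansion:
  fixes p :: "real ^ 'm::finite \<Rightarrow> real"
  assumes pos: "\<And>\<theta>. 0 < p \<theta>"
    and S: "\<And>\<theta>. GDERIV (\<lambda>\<theta>. ln (p \<theta>)) \<theta> :> S \<theta>"
    and lip: "\<And>\<theta>1 \<theta>2. norm (S \<theta>1 - S \<theta>2) \<le> C * norm (\<theta>1 - \<theta>2)" and C: "0 \<le> C"
    and small: "norm (y - x) \<le> 1"
  defines "W \<equiv> \<lambda>\<theta>. p \<theta> * (2 * (norm (S \<theta>))\<^sup>2 + 2 * C\<^sup>2 + C)"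
  shows "\<bar>p y - p x - p x * ((y - x) \<bullet> S x)\<bar> \<le> (norm (y - x))\<^sup>2 * (W x + W y)"
proof -
  define z where "z = ln (p y) - ln (p x)"
  let ?d = "norm (y - x)"
  have d4: "?d ^ 2 * ?d ^ 2 \<le> ?d ^ 2" using small power_le_one[of ?d 2] mult_left_le[of "?d ^ 2" "?d ^ 2"] by simp
  \<comment> \<open>Stated for an arbitrary \<open>v\<close>, so that the score at \<open>x\<close>
    can be used next to \<open>p x\<close> and the score at \<open>y\<close> next to
    \<open>p y\<close>. A displacement of at most one lets the fourth power of the distance be
    absorbed by the square.\<close>
  have sq: "z\<^sup>2 \<le> ?d\<^sup>2 * (2 * (norm v)\<^sup>2 + 2 * C\<^sup>2)" if "\<bar>z - (y - x) \<bullet> v\<bar> \<le> C * ?d\<^sup>2" for v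
  proof -
    have "\<bar>z\<bar> \<le> \<bar>(y - x) \<bullet> v\<bar> + C * ?d\<^sup>2" using that by linarith
    also have "\<dots> \<le> ?d * norm v + C * ?d\<^sup>2" using Cauchy_Schwarz_ineq2[of "y - x" v] by simp
    finally have "\<bar>z\<bar>\<^sup>2 \<le> (?d * norm v + C * ?d\<^sup>2)\<^sup>2" by (rule power_mono) simp
    also have "\<dots> \<le> 2 * (?d * norm v)\<^sup>2 + 2 * (C * ?d\<^sup>2)\<^sup>2"
      using zero_le_power2[of "?d * norm v - C * ?d\<^sup>2"] by (simp add: power2_eq_square algebra_simps)
    also have "\<dots> = ?d\<^sup>2 * (2 * (norm v)\<^sup>2) + (?d ^ 2 * ?d ^ 2) * (2 * C\<^sup>2)" by (simp add: power2_eq_square mult_ac)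
    also have "\<dots> \<le> ?d\<^sup>2 * (2 * (norm v)\<^sup>2) + ?d\<^sup>2 * (2 * C\<^sup>2)"
      by (intro add_left_mono mult_right_mono d4) auto
    finally show ?thesis by (simp add: algebra_simps)
  qed
  have zx: "\<bar>z - (y - x) \<bullet> S x\<bar> \<le> C * ?d\<^sup>2"
    using Lipschitz_gradient_expansion[of "\<lambda>\<theta>. ln (p \<theta>)", OF S lip C] by (simp add: z_def)
  have zy: "\<bar>z - (y - x) \<bullet> S y\<bar> \<le> C * ?d\<^sup>2"
  proof -
    have "ln (p x) - ln (p y) - (x - y) \<bullet> S y = - (z - (y - x) \<bullet> S y)" by (simp add: z_def inner_diff_left)
    then show ?thesis
      using Lipschitz_gradient_expansion[of "\<lambda>\<theta>. ln (p \<theta>)", OF S lip C, of x y] by (simp add: norm_minus_commute)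
  qed
  \<comment> \<open>Here the unbounded factor \<open>exp z\<close> disappears: against
    \<open>p x\<close> it is the density at \<open>y\<close>.\<close>
  have ez: "p x * exp z = p y" using pos[of x] pos[of y] by (simp add: z_def exp_diff)
  have "p y - p x - p x * ((y - x) \<bullet> S x) = p x * (exp z - 1 - z) + p x * (z - (y - x) \<bullet> S x)"
    by (simp add: ez[symmetric] algebra_simps)
  also have "\<bar>\<dots>\<bar> \<le> p x * (exp z - 1 - z) + p x * \<bar>z - (y - x) \<bullet> S x\<bar>"
    using pos[of x] exp_remainder_bounds(1)[of z]
    by (intro order_trans[OF abs_triangle_ineq]) (simp add: abs_mult)
  also have "\<dots> \<le> p x * (z\<^sup>2 * (1 + exp z)) + p x * (C * ?d\<^sup>2)"
    using pos[of x] exp_remainder_bounds(2)[of z] zx by (intro add_mono mult_left_mono) auto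
  also have "p x * (z\<^sup>2 * (1 + exp z)) = p x * z\<^sup>2 + p y * z\<^sup>2" by (simp add: ez[symmetric] algebra_simps)
  also have "\<dots> + p x * (C * ?d\<^sup>2) \<le> p x * (?d\<^sup>2 * (2 * (norm (S x))\<^sup>2 + 2 * C\<^sup>2))
      + p y * (?d\<^sup>2 * (2 * (norm (S y))\<^sup>2 + 2 * C\<^sup>2)) + p x * (C * ?d\<^sup>2)"
    using pos[of x] pos[of y] by (intro add_mono mult_left_mono sq zx zy order_refl) auto
  \<comment> \<open>A nonnegative term is added to make the bound symmetric in \<open>x\<close> and
    \<open>y\<close>.\<close>
  also have "\<dots> \<le> \<dots> + p y * (C * ?d\<^sup>2)" using pos[of y] C by simp
  also have "\<dots> = ?d\<^sup>2 * (W x + W y)" by (simp add: W_def algebra_simps)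
  finally show ?thesis .
qed

section \<open>Trajectories of a Markov game\<close>

locale markov_game_locale =
  fixes G :: "('s, 'n::finite, 'k::finite, 'm::finite) game"
  assumes markov_game: "markov_game G"
begin

abbreviation SA :: "('s \<times> ('n \<Rightarrow> real ^ 'k)) measure" where
  "SA \<equiv> states G \<Otimes>\<^sub>M joint_ref G"

lemma init_space [simp]: "init G \<in> space (states G)"
  and disc_pos [simp]: "0 < disc G"
  and disc_less_1 [simp]: "disc G < 1"
  and sigma_finite_act_ref: "sigma_finite_measure (act_ref G)"
  and next_state_measurable [measurable]:
    "(\<lambda>(s, a). next_state G s a) \<in> SA \<rightarrow>\<^sub>M prob_algebra (states G)"
  and rew_measurable [measurable]: "(\<lambda>(s, a). rew G i s a) \<in> borel_measurable SA"
  and pol_measurable [measurable]: "(\<lambda>(s, a). pol G n \<theta> s a) \<in> borel_measurable (states G \<Otimes>\<^sub>M act_ref G)"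
  and pol_nonneg: "s \<in> space (states G) \<Longrightarrow> a \<in> actions G \<Longrightarrow> 0 \<le> pol G n \<theta> s a"
  and pol_differentiable: "s \<in> space (states G) \<Longrightarrow> a \<in> actions G \<Longrightarrow>
    (\<lambda>\<theta>'. pol G n \<theta>' s a) differentiable (at \<theta>)"
  and pol_integral: "s \<in> space (states G) \<Longrightarrow> (\<integral>\<^sup>+ a. ennreal (pol G n \<theta> s a) \<partial>act_ref G) = 1"
  using markov_game unfolding markov_game_def by auto

lemma space_act_ref [simp]: "space (act_ref G) = actions G"
proof -
  have "sets (act_ref G) = sets (restrict_space borel (actions G))"
    using markov_game unfolding markov_game_def by auto
  from sets_eq_imp_space_eq[OF this] show ?thesis by (simp add: space_restrict_space)
qed

lemma space_joint_ref [simp]: "space (joint_ref G) = {a. \<forall>n. a n \<in> actions G}"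
  by (auto simp: joint_ref_def space_PiM PiE_iff)

lemma component_measurable [measurable]: "(\<lambda>a. a n) \<in> joint_ref G \<rightarrow>\<^sub>M act_ref G"
  unfolding joint_ref_def by simp

sublocale act: product_sigma_finite "\<lambda>_::'n. act_ref G"
  using sigma_finite_act_ref by (simp add: product_sigma_finite_def)

sublocale joint: sigma_finite_measure "joint_ref G"
  unfolding joint_ref_def by (rule act.sigma_finite) simp

definition joint_pol :: "real ^ 'm \<Rightarrow> 's \<Rightarrow> ('n \<Rightarrow> real ^ 'k) \<Rightarrow> real" where
  "joint_pol \<theta> s a = (\<Prod>n\<in>UNIV. pol G n \<theta> s (a n))"

lemma joint_pol_measurable [measurable]: "(\<lambda>(s, a). joint_pol \<theta> s a) \<in> borel_measurable SA"
  unfolding joint_pol_def by measurable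

lemma joint_pol_nonneg: "s \<in> space (states G) \<Longrightarrow> a \<in> space (joint_ref G) \<Longrightarrow> 0 \<le> joint_pol \<theta> s a"
  unfolding joint_pol_def by (auto intro!: prod_nonneg pol_nonneg)

lemma joint_policy_density: "joint_policy G \<theta> s = density (joint_ref G) (\<lambda>a. ennreal (joint_pol \<theta> s a))"
  by (simp add: joint_policy_def joint_pol_def)

text \<open>By Tonelli the joint density splits into one factor per agent, and every factor other
  than that of \<open>k\<close> integrates to one.\<close>

lemma nn_integral_joint_policy_component:
  assumes s: "s \<in> space (states G)" and [measurable]: "f \<in> borel_measurable (act_ref G)"
  shows "(\<integral>\<^sup>+a. ennreal (joint_pol \<theta> s a) * f (a k) \<partial>joint_ref G) =
    (\<integral>\<^sup>+a. ennreal (pol G k \<theta> s a) * f a \<partial>act_ref G)"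
proof -
  have [measurable]: "(\<lambda>a. pol G n \<theta> s a) \<in> borel_measurable (act_ref G)" for n
    using measurable_Pair2[OF pol_measurable s] by simp
  let ?f = "\<lambda>n a. ennreal (pol G n \<theta> s a) * (if n = k then f a else 1)"
  have "(\<integral>\<^sup>+a. ennreal (joint_pol \<theta> s a) * f (a k) \<partial>joint_ref G) = (\<integral>\<^sup>+a. (\<Prod>n\<in>UNIV. ?f n (a n)) \<partial>joint_ref G)"
  proof (rule nn_integral_cong)
    fix a assume a: "a \<in> space (joint_ref G)"
    have "(\<Prod>n\<in>UNIV. ?f n (a n)) = (\<Prod>n\<in>UNIV. ennreal (pol G n \<theta> s (a n))) * (\<Prod>n\<in>UNIV. if n = k then f (a n) else 1)"
      by (rule prod.distrib)
    also have "(\<Prod>n\<in>UNIV. if n = k then f (a n) else 1) = f (a k)" by simp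
    also have "(\<Prod>n\<in>UNIV. ennreal (pol G n \<theta> s (a n))) = ennreal (joint_pol \<theta> s a)"
      unfolding joint_pol_def by (rule prod_ennreal) (use a s pol_nonneg in auto)
    finally show "ennreal (joint_pol \<theta> s a) * f (a k) = (\<Prod>n\<in>UNIV. ?f n (a n))" ..
  qed
  also have "\<dots> = (\<Prod>n\<in>UNIV. \<integral>\<^sup>+a. ?f n a \<partial>act_ref G)"
    unfolding joint_ref_def by (rule act.product_nn_integral_prod) auto
  also have "\<dots> = (\<Prod>n\<in>UNIV. if n = k then \<integral>\<^sup>+a. ennreal (pol G k \<theta> s a) * f a \<partial>act_ref G else 1)"
    by (rule prod.cong) (use s pol_integral in auto)
  finally show ?thesis by simp
qed

lemma joint_pol_integral: "s \<in> space (states G) \<Longrightarrow> (\<integral>\<^sup>+a. ennreal (joint_pol \<theta> s a) \<partial>joint_ref G) = 1"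
  using nn_integral_joint_policy_component[of s "\<lambda>_. 1" \<theta> undefined] pol_integral by simp

lemma joint_policy_measurable [measurable]: "joint_policy G \<theta> \<in> states G \<rightarrow>\<^sub>M prob_algebra (joint_ref G)"
  unfolding joint_policy_density[abs_def]
  by (rule measurable_density_kernel[OF joint.sigma_finite_measure_axioms _ joint_pol_integral]) auto

lemma draw_action_measurable [measurable]: "draw_action G \<theta> \<in> states G \<rightarrow>\<^sub>M prob_algebra SA"
  unfolding draw_action_def[abs_def] by measurable

definition transition :: "real ^ 'm \<Rightarrow> 's \<times> ('n \<Rightarrow> real ^ 'k) \<Rightarrow> ('s \<times> ('n \<Rightarrow> real ^ 'k)) measure" where
  "transition \<theta> x = next_state G (fst x) (snd x) \<bind> draw_action G \<theta>"

lemma transition_measurable [measurable]: "transition \<theta> \<in> SA \<rightarrow>\<^sub>M prob_algebra SA"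
proof -
  have [measurable]: "(\<lambda>x. next_state G (fst x) (snd x)) \<in> SA \<rightarrow>\<^sub>M prob_algebra (states G)"
    using next_state_measurable by (simp add: case_prod_unfold)
  show ?thesis unfolding transition_def[abs_def]
    by (rule measurable_bind_prob_space[where N="states G"]) measurable
qed

lemma step_kernel_0: "step_kernel G \<theta> s 0 x = draw_action G \<theta> s"
  by (simp add: step_kernel_def)

lemma step_kernel_Suc: "step_kernel G \<theta> s (Suc k) x = transition \<theta> (x k)"
  by (simp add: step_kernel_def transition_def)

lemma step_kernel_measurable:
  "(\<lambda>(s, x). step_kernel G \<theta> s t x) \<in> states G \<Otimes>\<^sub>M PiM {0..<t} (\<lambda>_. SA) \<rightarrow>\<^sub>M prob_algebra SA"
proof (cases t)
  case 0
  then show ?thesis by (simp add: step_kernel_0)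
next
  case (Suc k)
  have [measurable]: "(\<lambda>x. x k) \<in> PiM {0..<Suc k} (\<lambda>_. SA) \<rightarrow>\<^sub>M SA" by simp
  show ?thesis by (simp add: Suc step_kernel_Suc)
qed

lemma Ionescu_Tulcea_step_kernel:
  assumes s: "s \<in> space (states G)"
  shows "Ionescu_Tulcea (step_kernel G \<theta> s) (\<lambda>_. SA)"
proof -
  have m: "step_kernel G \<theta> s t \<in> PiM {0..<t} (\<lambda>_. SA) \<rightarrow>\<^sub>M prob_algebra SA" for t
    using measurable_Pair2[OF step_kernel_measurable s] by simp
  have "prob_space (step_kernel G \<theta> s t x)" if "x \<in> space (PiM {0..<t} (\<lambda>_. SA))" for t x
    using measurable_space[OF m that] by (simp add: space_prob_algebra)
  with m[THEN measurable_prob_algebraD] show ?thesis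
    unfolding Ionescu_Tulcea_def by blast
qed

abbreviation paths :: "(nat \<Rightarrow> 's \<times> ('n \<Rightarrow> real ^ 'k)) measure" where
  "paths \<equiv> PiM UNIV (\<lambda>_. SA)"

text \<open>The law of the first \<open>n\<close> state-action pairs. Dependence on the starting
  state is easy to control at this finite stage and is then transferred to the infinite trajectory
  through cylinders.\<close>

definition segment ::
    "real ^ 'm \<Rightarrow> nat \<Rightarrow> 's \<Rightarrow> (nat \<Rightarrow> 's \<times> ('n \<Rightarrow> real ^ 'k)) measure" where
  "segment \<theta> n s = Ionescu_Tulcea.C (step_kernel G \<theta> s) (\<lambda>_. SA) 0 n (\<lambda>_. undefined)"

lemma
  assumes s: "s \<in> space (states G)"
  shows sets_traj: "sets (traj G \<theta> s) = sets paths"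
    and prob_space_traj: "prob_space (traj G \<theta> s)"
    and distr_traj_segment: "distr (traj G \<theta> s) (PiM {0..<n} (\<lambda>_. SA)) (\<lambda>x. restrict x {0..<n}) = segment \<theta> n s"
    and emeasure_traj_emb: "J \<subseteq> {0..<n} \<Longrightarrow> X \<in> sets (PiM J (\<lambda>_. SA)) \<Longrightarrow>
       emeasure (traj G \<theta> s) (prod_emb UNIV (\<lambda>_. SA) J X) = emeasure (segment \<theta> n s) (prod_emb {0..<n} (\<lambda>_. SA) J X)"
proof -
  interpret IT: Ionescu_Tulcea "step_kernel G \<theta> s" "\<lambda>_. SA"
    by (rule Ionescu_Tulcea_step_kernel[OF s])
  have t: "traj G \<theta> s = IT.PF.lim" by (simp add: traj_def Let_def)
  show "sets (traj G \<theta> s) = sets paths" by (simp add: t)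
  \<comment> \<open>As \<open>{0..<n}\<close> is already an initial segment, the projection
    contained in \<open>CI\<close> is the identity and the finite stage itself is obtained.\<close>
  have CI: "IT.CI {0..<n} = segment \<theta> n s" for n
  proof (rule measure_eqI)
    show se: "sets (IT.CI {0..<n}) = sets (segment \<theta> n s)"
      by (simp add: IT.CI_def segment_def IT.sets_C)
    fix A assume "A \<in> sets (IT.CI {0..<n})"
    then have A: "A \<in> sets (PiM {0..<n} (\<lambda>_. SA))" by (simp add: IT.CI_def)
    then show "emeasure (IT.CI {0..<n}) A = emeasure (segment \<theta> n s) A"
      unfolding segment_def
      by (subst IT.emeasure_CI[of "{0..<n}" n]) (auto simp: prod_emb_id dest: sets.sets_into_space simp: space_PiM)
  qed
  show d: "distr (traj G \<theta> s) (PiM {0..<n} (\<lambda>_. SA)) (\<lambda>x. restrict x {0..<n}) = segment \<theta> n s" for n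
    unfolding t by (simp add: IT.distr_lim CI)
  \<comment> \<open>Restricting to no coordinate at all preserves the total mass, so the trivial
    segment decides that the trajectory law is a probability.\<close>
  have "prob_space (segment \<theta> 0 s)" unfolding segment_def by (rule IT.prob_space_C) simp
  then show "prob_space (traj G \<theta> s)"
    unfolding d[symmetric]
    by (rule prob_space_distrD[rotated]) (simp add: t measurable_cong_sets[OF IT.PF.sets_lim refl] measurable_restrict_subset)
  assume "J \<subseteq> {0..<n}" "X \<in> sets (PiM J (\<lambda>_. SA))"
  then show "emeasure (traj G \<theta> s) (prod_emb UNIV (\<lambda>_. SA) J X) = emeasure (segment \<theta> n s) (prod_emb {0..<n} (\<lambda>_. SA) J X)"
    unfolding t segment_def by (subst IT.lim) (auto intro: finite_subset IT.emeasure_CI)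
qed

text \<open>One extension step of the Ionescu-Tulcea construction, with the starting state as an
  explicit argument so that joint measurability in state and history can be stated.\<close>

definition extend_kernel where
  "extend_kernel \<theta> n s \<omega> = distr (step_kernel G \<theta> s n \<omega>) (PiM {0..<Suc n} (\<lambda>_. SA)) (fun_upd \<omega> n)"

lemma extend_kernel_measurable:
  "(\<lambda>(s, \<omega>). extend_kernel \<theta> n s \<omega>) \<in> states G \<Otimes>\<^sub>M PiM {0..<n} (\<lambda>_. SA) \<rightarrow>\<^sub>M prob_algebra (PiM {0..<Suc n} (\<lambda>_. SA))"
proof -
  have 1: "(\<lambda>(y, z). fun_upd (snd y) n z) \<in> (states G \<Otimes>\<^sub>M PiM {0..<n} (\<lambda>_. SA)) \<Otimes>\<^sub>M SA \<rightarrow>\<^sub>M PiM {0..<Suc n} (\<lambda>_. SA)"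
    unfolding case_prod_unfold
    by (rule measurable_fun_upd[where J="{0..<n}"]) auto
  show ?thesis
    unfolding extend_kernel_def case_prod_unfold
    by (rule measurable_distr_prob_space2[OF _ 1])
       (use step_kernel_measurable in \<open>simp add: case_prod_unfold\<close>)
qed

lemma segment_0: "s \<in> space (states G) \<Longrightarrow> segment \<theta> 0 s = return (PiM {} (\<lambda>_. SA)) (\<lambda>_. undefined)"
  unfolding segment_def
  by (subst Ionescu_Tulcea.C.simps(1)[OF Ionescu_Tulcea_step_kernel]) auto

lemma segment_Suc: "s \<in> space (states G) \<Longrightarrow> segment \<theta> (Suc n) s = segment \<theta> n s \<bind> extend_kernel \<theta> n s"
  unfolding segment_def extend_kernel_def[abs_def]
  by (subst Ionescu_Tulcea.C.simps(2)[OF Ionescu_Tulcea_step_kernel])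
     (auto simp: Ionescu_Tulcea.eP_def[OF Ionescu_Tulcea_step_kernel] fun_eq_iff intro!: arg_cong[where f="bind _"])

lemma segment_measurable: "segment \<theta> n \<in> states G \<rightarrow>\<^sub>M prob_algebra (PiM {0..<n} (\<lambda>_. SA))"
proof (induction n)
  case 0
  have "(\<lambda>_. return (PiM {} (\<lambda>_::nat. SA)) (\<lambda>_. undefined)) \<in> states G \<rightarrow>\<^sub>M prob_algebra (PiM {0..<0} (\<lambda>_. SA))"
    by (rule measurable_const) (simp add: space_prob_algebra prob_space_return)
  then show ?case by (rule measurable_cong[THEN iffD1, rotated]) (simp add: segment_0)
next
  case (Suc n)
  have "(\<lambda>s. segment \<theta> n s \<bind> extend_kernel \<theta> n s) \<in> states G \<rightarrow>\<^sub>M prob_algebra (PiM {0..<Suc n} (\<lambda>_. SA))"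
    by (rule measurable_bind_prob_space2[OF Suc extend_kernel_measurable])
  then show ?case by (rule measurable_cong[THEN iffD1, rotated]) (simp add: segment_Suc)
qed

text \<open>Cylinders form an intersection-stable generator, and the probability of a cylinder is
  decided by a finite stage, whose law is measurable in the starting state.\<close>

lemma traj_measurable [measurable]: "traj G \<theta> \<in> states G \<rightarrow>\<^sub>M prob_algebra paths"
proof -
  \<comment> \<open>The state \<open>init G\<close> serves only to name the cylinder generator,
    which is the same for every starting state.\<close>
  interpret IT: Ionescu_Tulcea "step_kernel G \<theta> (init G)" "\<lambda>_. SA"
    by (rule Ionescu_Tulcea_step_kernel) simp
  show ?thesis
  proof (rule measurable_prob_algebra_generated[OF IT.PF.sets_PiM_generator])
    show "Int_stable IT.PF.generator"
      using IT.PF.algebra_generator by (auto simp: algebra_iff_Int Int_stable_def)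
    show "IT.PF.generator \<subseteq> Pow (space paths)"
      using IT.PF.algebra_generator by (auto simp: algebra_iff_Int)
    fix A assume "A \<in> IT.PF.generator"
    then obtain J X where A: "A = prod_emb UNIV (\<lambda>_. SA) J X" "finite J" and X: "X \<in> sets (PiM J (\<lambda>_. SA))"
      by (auto elim: IT.PF.generator.cases)
    obtain n where J: "J \<subseteq> {0..<n}" using \<open>finite J\<close> finite_nat_iff_bounded[of J] by (auto simp: atLeast0LessThan)
    have "prod_emb {0..<n} (\<lambda>_. SA) J X \<in> sets (PiM {0..<n} (\<lambda>_. SA))"
      using J X by (rule measurable_prod_emb)
    from measurable_compose[OF segment_measurable[THEN measurable_prob_algebraD] measurable_emeasure_subprob_algebra[OF this]]
    have "(\<lambda>s. emeasure (segment \<theta> n s) (prod_emb {0..<n} (\<lambda>_. SA) J X)) \<in> borel_measurable (states G)" .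
    then show "(\<lambda>s. emeasure (traj G \<theta> s) A) \<in> borel_measurable (states G)"
      by (rule measurable_cong[THEN iffD1, rotated]) (simp add: A emeasure_traj_emb[OF _ J X])
  qed (auto simp: sets_traj prob_space_traj)
qed

lemma path_component_measurable [measurable]: "(\<lambda>\<omega>. \<omega> t) \<in> paths \<rightarrow>\<^sub>M SA"
  by simp

lemma traj_in_space: "s \<in> space (states G) \<Longrightarrow> traj G \<theta> s \<in> space (prob_algebra paths)"
  by (simp add: space_prob_algebra sets_traj prob_space_traj)

lemma distr_traj_0:
  assumes s: "s \<in> space (states G)"
  shows "distr (traj G \<theta> s) SA (\<lambda>\<omega>. \<omega> 0) = draw_action G \<theta> s"
proof -
  note [measurable_cong] = sets_traj[OF s]
  have da: "sets (draw_action G \<theta> s) = sets SA"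
    by (simp add: draw_action_def)
  have 2: "extend_kernel \<theta> 0 s \<in> PiM {} (\<lambda>_. SA) \<rightarrow>\<^sub>M subprob_algebra (PiM {0..<Suc 0} (\<lambda>_. SA))"
    using measurable_Pair2[OF extend_kernel_measurable s, of \<theta> 0, THEN measurable_prob_algebraD] by simp
  have 3: "fun_upd (\<lambda>_. undefined) 0 \<in> SA \<rightarrow>\<^sub>M PiM {0..<Suc 0} (\<lambda>_. SA)"
    by (rule measurable_fun_upd[where J="{}"]) (auto simp: space_PiM)
  have "distr (traj G \<theta> s) SA (\<lambda>\<omega>. \<omega> 0) = distr (distr (traj G \<theta> s) (PiM {0..<Suc 0} (\<lambda>_. SA)) (\<lambda>x. restrict x {0..<Suc 0})) SA (\<lambda>x. x 0)"
    by (subst distr_distr) (auto intro!: distr_cong measurable_restrict_subset simp: comp_def)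
  also have "\<dots> = distr (extend_kernel \<theta> 0 s (\<lambda>_. undefined)) SA (\<lambda>x. x 0)"
    unfolding distr_traj_segment[OF s] segment_Suc[OF s] segment_0[OF s]
    by (subst bind_return[OF 2]) (auto simp: space_PiM)
  also have "\<dots> = draw_action G \<theta> s"
    unfolding extend_kernel_def step_kernel_0
    by (subst distr_distr) (use 3 da in \<open>auto simp: comp_def distr_id2 cong: measurable_cong_sets\<close>)
  finally show ?thesis .
qed

text \<open>The Markov property in the form used later. The earlier coordinate \<open>t\<close> is
  kept alongside the new pair because it will carry a score as weight.\<close>

lemma distr_traj_Suc:
  assumes s: "s \<in> space (states G)" and t: "t \<le> n"
  shows "distr (traj G \<theta> s) (SA \<Otimes>\<^sub>M SA) (\<lambda>\<omega>. (\<omega> t, \<omega> (Suc n))) =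
    traj G \<theta> s \<bind> (\<lambda>\<omega>. distr (transition \<theta> (\<omega> n)) (SA \<Otimes>\<^sub>M SA) (\<lambda>z. (\<omega> t, z)))"
proof -
  note [measurable_cong] = sets_traj[OF s]
  interpret tr: prob_space "traj G \<theta> s" by (rule prob_space_traj[OF s])
  let ?D = "\<lambda>n::nat. PiM {0..<n} (\<lambda>_. SA)"
  have ssn: "sets (segment \<theta> n s) = sets (?D n)" for n
    by (simp add: distr_traj_segment[OF s, symmetric])
  note [measurable_cong] = ssn
  have r: "(\<lambda>x. restrict x {0..<n}) \<in> traj G \<theta> s \<rightarrow>\<^sub>M ?D n" for n
    by (auto simp: measurable_cong_sets[OF sets_traj[OF s] refl] intro!: measurable_restrict_subset)
  have c: "(\<lambda>x. x i) \<in> ?D n \<rightarrow>\<^sub>M SA" if "i < n" for i n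
    by (rule measurable_component_singleton) (use that in auto)
  have p: "(\<lambda>x. (x t, x (Suc n))) \<in> ?D (Suc (Suc n)) \<rightarrow>\<^sub>M SA \<Otimes>\<^sub>M SA"
    using t by (intro measurable_Pair c) auto
  have ek: "extend_kernel \<theta> (Suc n) s \<in> ?D (Suc n) \<rightarrow>\<^sub>M prob_algebra (?D (Suc (Suc n)))"
    using measurable_Pair2[OF extend_kernel_measurable s, of \<theta> "Suc n"] by simp
  have ne: "space (segment \<theta> n s) \<noteq> {}" for n
    unfolding distr_traj_segment[OF s, symmetric] space_distr
    using tr.not_empty measurable_space[OF r[of n]] by (metis all_not_in_conv)
  let ?H = "\<lambda>\<omega>. distr (transition \<theta> (\<omega> n)) (SA \<Otimes>\<^sub>M SA) (\<lambda>z. (\<omega> t, z))"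
  have Hm: "?H \<in> ?D (Suc n) \<rightarrow>\<^sub>M prob_algebra (SA \<Otimes>\<^sub>M SA)"
  proof (rule measurable_distr_prob_space2[where M=SA])
    show "(\<lambda>x. transition \<theta> (x n)) \<in> ?D (Suc n) \<rightarrow>\<^sub>M prob_algebra SA"
      by (rule measurable_compose[OF c transition_measurable]) simp
    have [measurable]: "(\<lambda>x. x t) \<in> ?D (Suc n) \<rightarrow>\<^sub>M SA" using t by simp
    show "(\<lambda>(x, y). (x t, y)) \<in> ?D (Suc n) \<Otimes>\<^sub>M SA \<rightarrow>\<^sub>M SA \<Otimes>\<^sub>M SA"
      by measurable
  qed
  have "distr (traj G \<theta> s) (SA \<Otimes>\<^sub>M SA) (\<lambda>\<omega>. (\<omega> t, \<omega> (Suc n))) =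
     distr (distr (traj G \<theta> s) (?D (Suc (Suc n))) (\<lambda>x. restrict x {0..<Suc (Suc n)})) (SA \<Otimes>\<^sub>M SA) (\<lambda>x. (x t, x (Suc n)))"
    by (subst distr_distr[OF p r]) (use t in \<open>auto intro!: distr_cong simp: comp_def\<close>)
  also have "\<dots> = segment \<theta> (Suc n) s \<bind> (\<lambda>\<omega>. distr (extend_kernel \<theta> (Suc n) s \<omega>) (SA \<Otimes>\<^sub>M SA) (\<lambda>x. (x t, x (Suc n))))"
    unfolding distr_traj_segment[OF s] segment_Suc[OF s, of _ "Suc n"]
    using ek[THEN measurable_prob_algebraD] by (subst distr_bind[OF _ ne p]) (simp_all cong: measurable_cong_sets[OF ssn refl])
  also have "\<dots> = segment \<theta> (Suc n) s \<bind> ?H"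
  proof (rule bind_cong[OF refl])
    fix \<omega> assume "\<omega> \<in> space (segment \<theta> (Suc n) s)"
    then have w: "\<omega> \<in> space (?D (Suc n))" using sets_eq_imp_space_eq[OF ssn] by auto
    have "\<omega> n \<in> space SA" using w by (auto simp: space_PiM)
    then have st: "sets (transition \<theta> (\<omega> n)) = sets SA"
      using measurable_space[OF transition_measurable] by (auto simp: space_prob_algebra)
    have fu: "fun_upd \<omega> (Suc n) \<in> SA \<rightarrow>\<^sub>M ?D (Suc (Suc n))"
      by (rule measurable_fun_upd[where J="{0..<Suc n}"]) (use w in auto)
    have fu': "fun_upd \<omega> (Suc n) \<in> transition \<theta> (\<omega> n) \<rightarrow>\<^sub>M ?D (Suc (Suc n))"
      using fu measurable_cong_sets[OF st refl] by blast
    show "distr (extend_kernel \<theta> (Suc n) s \<omega>) (SA \<Otimes>\<^sub>M SA) (\<lambda>x. (x t, x (Suc n))) = ?H \<omega>"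
      unfolding extend_kernel_def step_kernel_Suc
      by (subst distr_distr[OF p fu']) (use t in \<open>auto intro!: distr_cong simp: comp_def\<close>)
  qed
  also have "\<dots> = traj G \<theta> s \<bind> (\<lambda>\<omega>. ?H (restrict \<omega> {0..<Suc n}))"
    unfolding distr_traj_segment[OF s, symmetric]
    by (rule bind_distr[OF r Hm[THEN measurable_prob_algebraD] tr.not_empty])
  also have "\<dots> = traj G \<theta> s \<bind> ?H" using t by (intro bind_cong[OF refl]) simp
  finally show ?thesis .
qed

end

section \<open>Bounded measurable functions under kernels, with explicit bounds\<close>

definition bounded_fun :: "'a measure \<Rightarrow> real \<Rightarrow> ('a \<Rightarrow> real) \<Rightarrow> bool" where
  "bounded_fun M C f \<longleftrightarrow> f \<in> borel_measurable M \<and> (\<forall>x\<in>space M. \<bar>f x\<bar> \<le> C)"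

lemma bounded_fun_integrable:
  assumes "bounded_fun M C f" "N \<in> space (prob_algebra M)"
  shows "integrable N f" and "\<bar>integral\<^sup>L N f\<bar> \<le> C"
proof -
  have s: "sets N = sets M" and "prob_space N" using assms(2) by (auto simp: space_prob_algebra)
  then interpret prob_space N by simp
  have f: "f \<in> borel_measurable N" and b: "\<And>x. x \<in> space N \<Longrightarrow> \<bar>f x\<bar> \<le> C"
    using assms(1) s sets_eq_imp_space_eq[OF s] measurable_cong_sets[OF s refl] by (auto simp: bounded_fun_def)
  show i: "integrable N f" by (rule integrable_const_bound[of _ C]) (use f b in auto)
  have "integral\<^sup>L N f \<le> C" by (rule integral_le_const[OF i]) (use b in fastforce)
  moreover have "- C \<le> integral\<^sup>L N f" by (rule integral_ge_const[OF i]) (use b in fastforce)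
  ultimately show "\<bar>integral\<^sup>L N f\<bar> \<le> C" by simp
qed

lemma bounded_fun_kernel:
  assumes "bounded_fun N C f" "K \<in> M \<rightarrow>\<^sub>M prob_algebra N"
  shows "bounded_fun M C (\<lambda>x. integral\<^sup>L (K x) f)"
proof -
  have "f \<in> borel_measurable N" using assms by (simp add: bounded_fun_def)
  from measurable_compose[OF measurable_prob_algebraD[OF assms(2)] integral_measurable_subprob_algebra[OF this]]
  show ?thesis
    using bounded_fun_integrable(2)[OF assms(1) measurable_space[OF assms(2)]] by (simp add: bounded_fun_def)
qed

lemma bounded_fun_compose:
  assumes "bounded_fun N C f" "h \<in> M \<rightarrow>\<^sub>M N"
  shows "bounded_fun M C (\<lambda>x. f (h x))"
  using assms measurable_space[OF assms(2)] by (auto simp: bounded_fun_def)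

text \<open>Domination by a geometric series yields the bound, the absolute convergence and the
  exchange of sum and integral at once.\<close>

lemma bounded_fun_discounted_sum:
  assumes f: "\<And>k. bounded_fun M C (f k)" and g: "0 < \<gamma>" "\<gamma> < 1"
  shows "bounded_fun M (C / (1 - \<gamma>)) (\<lambda>x. \<Sum>k. \<gamma> ^ k * f k x)"
    and "x \<in> space M \<Longrightarrow> summable (\<lambda>k. \<bar>\<gamma> ^ k * f k x\<bar>)"
    and "N \<in> space (prob_algebra M) \<Longrightarrow> (\<integral>x. (\<Sum>k. \<gamma> ^ k * f k x) \<partial>N) = (\<Sum>k. \<gamma> ^ k * integral\<^sup>L N (f k))"
proof -
  have sg: "summable (\<lambda>k. \<gamma> ^ k * C)" using g by (intro summable_mult2 summable_geometric) auto
  have b: "\<bar>\<gamma> ^ k * f k x\<bar> \<le> \<gamma> ^ k * C" if "x \<in> space M" for k x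
    using f[of k] that g by (simp add: bounded_fun_def abs_mult)
  have s: "summable (\<lambda>k. \<bar>\<gamma> ^ k * f k x\<bar>)" if "x \<in> space M" for x
    by (rule summable_comparison_test'[OF sg, of 0]) (use b[OF that] in auto)
  then show "x \<in> space M \<Longrightarrow> summable (\<lambda>k. \<bar>\<gamma> ^ k * f k x\<bar>)" .
  have [measurable]: "f k \<in> borel_measurable M" for k using f by (simp add: bounded_fun_def)
  have "\<bar>\<Sum>k. \<gamma> ^ k * f k x\<bar> \<le> C / (1 - \<gamma>)" if "x \<in> space M" for x
  proof -
    have "\<bar>\<Sum>k. \<gamma> ^ k * f k x\<bar> \<le> (\<Sum>k. \<bar>\<gamma> ^ k * f k x\<bar>)" by (rule summable_rabs[OF s[OF that]])
    also have "\<dots> \<le> (\<Sum>k. \<gamma> ^ k * C)" by (rule suminf_le[OF b[OF that] s[OF that] sg])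
    also have "\<dots> = C / (1 - \<gamma>)" using g by (simp add: suminf_mult2[symmetric] suminf_geometric summable_geometric)
    finally show ?thesis .
  qed
  then show "bounded_fun M (C / (1 - \<gamma>)) (\<lambda>x. \<Sum>k. \<gamma> ^ k * f k x)"
    by (simp add: bounded_fun_def)
  assume N: "N \<in> space (prob_algebra M)"
  have i: "integrable N (\<lambda>x. \<gamma> ^ k * f k x)" for k
    using bounded_fun_integrable[OF f N] by simp
  have sp: "space N = space M" and pN: "prob_space N"
    using N sets_eq_imp_space_eq by (auto simp: space_prob_algebra)
  have "(\<integral>x. (\<Sum>k. \<gamma> ^ k * f k x) \<partial>N) = (\<Sum>k. \<integral>x. \<gamma> ^ k * f k x \<partial>N)"
  proof (rule integral_suminf[OF i])
    show "AE x in N. summable (\<lambda>k. norm (\<gamma> ^ k * f k x))" using s sp by (auto intro!: AE_I2)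
    have "(\<integral>x. norm (\<gamma> ^ k * f k x) \<partial>N) \<le> \<gamma> ^ k * C" for k
      by (rule prob_space.integral_le_const[OF pN]) (use b sp integrable_norm[OF i] in \<open>auto intro!: AE_I2\<close>)
    then show "summable (\<lambda>k. \<integral>x. norm (\<gamma> ^ k * f k x) \<partial>N)"
      by (intro summable_comparison_test'[OF sg, of 0]) (auto simp: integral_nonneg_AE)
  qed
  then show "(\<integral>x. (\<Sum>k. \<gamma> ^ k * f k x) \<partial>N) = (\<Sum>k. \<gamma> ^ k * integral\<^sup>L N (f k))" by simp
qed

lemma bounded_fun_diff:
  assumes "bounded_fun M C f" "bounded_fun M D g"
  shows "bounded_fun M (C + D) (\<lambda>x. f x - g x)"
  unfolding bounded_fun_def
proof (intro conjI ballI)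
  show "(\<lambda>x. f x - g x) \<in> borel_measurable M" using assms by (auto simp: bounded_fun_def)
  fix x assume "x \<in> space M"
  then have "\<bar>f x\<bar> \<le> C" "\<bar>g x\<bar> \<le> D" using assms by (auto simp: bounded_fun_def)
  then show "\<bar>f x - g x\<bar> \<le> C + D" by linarith
qed

lemma bounded_fun_cmult:
  assumes "bounded_fun M C f"
  shows "bounded_fun M (\<bar>c\<bar> * C) (\<lambda>x. c * f x)"
  using assms by (auto simp: bounded_fun_def abs_mult mult_left_mono)

section \<open>Averaging operators and conditional means along trajectories\<close>

context markov_game_locale
begin

abbreviation next_law where "next_law x \<equiv> next_state G (fst x) (snd x)"

lemma next_law_measurable [measurable]: "(\<lambda>x. next_law x) \<in> SA \<rightarrow>\<^sub>M prob_algebra (states G)"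
  using next_state_measurable by (simp add: case_prod_unfold)

lemma draw_action_in_space: "s \<in> space (states G) \<Longrightarrow> draw_action G \<theta> s \<in> space (prob_algebra SA)"
  by (rule measurable_space[OF draw_action_measurable])

lemma distr_draw_action_fst:
  assumes s: "s \<in> space (states G)"
  shows "distr (draw_action G \<theta> s) (states G) fst = return (states G) s"
proof -
  have p: "prob_space (joint_policy G \<theta> s)" "sets (joint_policy G \<theta> s) = sets (joint_ref G)"
    using measurable_space[OF joint_policy_measurable s] by (auto simp: space_prob_algebra)
  interpret prob_space "joint_policy G \<theta> s" by fact
  have m: "(\<lambda>a. (s, a)) \<in> joint_policy G \<theta> s \<rightarrow>\<^sub>M SA" using s by (simp add: measurable_cong_sets[OF p(2) refl])
  have "distr (draw_action G \<theta> s) (states G) fst = distr (joint_policy G \<theta> s) (states G) (\<lambda>_. s)"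
    unfolding draw_action_def by (subst distr_distr[OF _ m]) (auto simp: comp_def)
  also have "\<dots> = return (states G) s" using s by (rule distr_const)
  finally show ?thesis .
qed

lemma distr_transition_fst:
  assumes x: "x \<in> space SA"
  shows "distr (transition \<theta> x) (states G) fst = next_law x"
proof -
  have n: "next_law x \<in> space (prob_algebra (states G))" by (rule measurable_space[OF next_law_measurable x])
  then have s: "sets (next_law x) = sets (states G)" and p: "prob_space (next_law x)" by (auto simp: space_prob_algebra)
  have da: "draw_action G \<theta> \<in> next_law x \<rightarrow>\<^sub>M subprob_algebra SA"
    using draw_action_measurable[THEN measurable_prob_algebraD] measurable_cong_sets[OF s refl] by blast
  have "distr (transition \<theta> x) (states G) fst = next_law x \<bind> (\<lambda>s. distr (draw_action G \<theta> s) (states G) fst)"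
    unfolding transition_def by (rule distr_bind[OF da prob_space.not_empty[OF p]]) simp
  also have "\<dots> = next_law x \<bind> return (states G)"
    by (rule bind_cong[OF refl]) (simp add: distr_draw_action_fst sets_eq_imp_space_eq[OF s])
  also have "\<dots> = next_law x" using s by (rule bind_return'')
  finally show ?thesis .
qed

lemma path_component_traj_measurable:
  assumes s: "s \<in> space (states G)"
  shows "(\<lambda>\<omega>. \<omega> t) \<in> traj G \<theta> s \<rightarrow>\<^sub>M SA"
  using path_component_measurable measurable_cong_sets[OF sets_traj[OF s] refl] by blast

lemma distr_traj_component_Suc:
  assumes s: "s \<in> space (states G)"
  shows "distr (traj G \<theta> s) SA (\<lambda>\<omega>. \<omega> (Suc n)) = traj G \<theta> s \<bind> (\<lambda>\<omega>. transition \<theta> (\<omega> n))"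
proof -
  note [measurable] = path_component_traj_measurable[OF s]
  interpret tr: prob_space "traj G \<theta> s" by (rule prob_space_traj[OF s])
  have k: "(\<lambda>\<omega>. distr (transition \<theta> (\<omega> n)) (SA \<Otimes>\<^sub>M SA) (\<lambda>z. (\<omega> n, z))) \<in> traj G \<theta> s \<rightarrow>\<^sub>M prob_algebra (SA \<Otimes>\<^sub>M SA)"
    by (rule measurable_distr_prob_space2[where M=SA]) measurable
  have "distr (traj G \<theta> s) SA (\<lambda>\<omega>. \<omega> (Suc n)) =
      distr (distr (traj G \<theta> s) (SA \<Otimes>\<^sub>M SA) (\<lambda>\<omega>. (\<omega> n, \<omega> (Suc n)))) SA snd"
    by (subst distr_distr) (auto simp: comp_def)
  also have "\<dots> = traj G \<theta> s \<bind> (\<lambda>\<omega>. distr (distr (transition \<theta> (\<omega> n)) (SA \<Otimes>\<^sub>M SA) (\<lambda>z. (\<omega> n, z))) SA snd)"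
    unfolding distr_traj_Suc[OF s order_refl]
    by (rule distr_bind[OF k[THEN measurable_prob_algebraD] tr.not_empty]) simp
  also have "\<dots> = traj G \<theta> s \<bind> (\<lambda>\<omega>. transition \<theta> (\<omega> n))"
  proof (rule bind_cong[OF refl])
    fix \<omega> assume "\<omega> \<in> space (traj G \<theta> s)"
    then have w: "\<omega> n \<in> space SA" by (rule measurable_space[OF path_component_traj_measurable[OF s]])
    then have st: "sets (transition \<theta> (\<omega> n)) = sets SA"
      using measurable_space[OF transition_measurable] by (auto simp: space_prob_algebra)
    have "(\<lambda>z. (\<omega> n, z)) \<in> transition \<theta> (\<omega> n) \<rightarrow>\<^sub>M SA \<Otimes>\<^sub>M SA"
      unfolding measurable_cong_sets[OF st refl] using w by (rule measurable_Pair1')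
    then show "distr (distr (transition \<theta> (\<omega> n)) (SA \<Otimes>\<^sub>M SA) (\<lambda>z. (\<omega> n, z))) SA snd = transition \<theta> (\<omega> n)"
      by (subst distr_distr) (auto simp: comp_def st intro!: distr_id2)
  qed
  finally show ?thesis .
qed

text \<open>At each time the action is drawn afresh given the state: at time zero by the start of
  the chain, later because a transition is a move of the state followed by
  \<open>draw_action\<close>. Redrawing the action therefore leaves the law at a fixed time
  unchanged.\<close>

lemma distr_traj_component:
  assumes s: "s \<in> space (states G)"
  shows "distr (traj G \<theta> s) SA (\<lambda>\<omega>. \<omega> t) = traj G \<theta> s \<bind> (\<lambda>\<omega>. draw_action G \<theta> (fst (\<omega> t)))"
proof -
  note [measurable] = path_component_traj_measurable[OF s]
  interpret tr: prob_space "traj G \<theta> s" by (rule prob_space_traj[OF s])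
  let ?D = "distr (traj G \<theta> s) (states G) (\<lambda>\<omega>. fst (\<omega> t))"
  have da: "draw_action G \<theta> \<in> states G \<rightarrow>\<^sub>M subprob_algebra SA"
    using draw_action_measurable by (rule measurable_prob_algebraD)
  have fc: "?D = distr (distr (traj G \<theta> s) SA (\<lambda>\<omega>. \<omega> t)) (states G) fst"
    by (subst distr_distr) (auto simp: comp_def)
  have "?D \<bind> draw_action G \<theta> = traj G \<theta> s \<bind> (\<lambda>\<omega>. draw_action G \<theta> (fst (\<omega> t)))"
    by (rule bind_distr[OF _ da tr.not_empty]) measurable
  moreover have "?D \<bind> draw_action G \<theta> = distr (traj G \<theta> s) SA (\<lambda>\<omega>. \<omega> t)"
  proof (cases t)
    case 0
    then show ?thesis
      unfolding fc using s da by (simp add: distr_traj_0[OF s] distr_draw_action_fst bind_return)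
  next
    case (Suc n)
    have tm: "(\<lambda>\<omega>. transition \<theta> (\<omega> n)) \<in> traj G \<theta> s \<rightarrow>\<^sub>M subprob_algebra SA"
      by (rule measurable_prob_algebraD) measurable
    have nm: "(\<lambda>\<omega>. next_law (\<omega> n)) \<in> traj G \<theta> s \<rightarrow>\<^sub>M subprob_algebra (states G)"
      using measurable_compose[OF path_component_traj_measurable[OF s] next_law_measurable]
      by (rule measurable_prob_algebraD)
    have "?D = traj G \<theta> s \<bind> (\<lambda>\<omega>. distr (transition \<theta> (\<omega> n)) (states G) fst)"
      using fc unfolding Suc distr_traj_component_Suc[OF s]
      by (rule trans) (rule distr_bind[OF tm tr.not_empty measurable_fst])
    also have "\<dots> = traj G \<theta> s \<bind> (\<lambda>\<omega>. next_law (\<omega> n))"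
      by (rule bind_cong[OF refl], rule distr_transition_fst)
         (rule measurable_space[OF path_component_traj_measurable[OF s]])
    finally have "?D \<bind> draw_action G \<theta> = traj G \<theta> s \<bind> (\<lambda>\<omega>. transition \<theta> (\<omega> n))"
      unfolding transition_def by (simp add: bind_assoc[OF nm da])
    then show ?thesis by (simp add: Suc distr_traj_component_Suc[OF s])
  qed
  ultimately show ?thesis by simp
qed

text \<open>Averages over the action at a state, over the successor state of a pair, and over the
  successor pair. They act on functions at all pairs, including pairs that the policy never
  selects.\<close>

definition act_avg :: "real ^ 'm \<Rightarrow> ('s \<times> ('n \<Rightarrow> real ^ 'k) \<Rightarrow> real) \<Rightarrow> 's \<Rightarrow> real" where
  "act_avg \<theta> f s = (\<integral>x. f x \<partial>draw_action G \<theta> s)"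
definition next_avg :: "('s \<Rightarrow> real) \<Rightarrow> 's \<times> ('n \<Rightarrow> real ^ 'k) \<Rightarrow> real" where
  "next_avg v x = (\<integral>s. v s \<partial>next_law x)"
definition trans_avg ::
    "real ^ 'm \<Rightarrow> ('s \<times> ('n \<Rightarrow> real ^ 'k) \<Rightarrow> real) \<Rightarrow> 's \<times> ('n \<Rightarrow> real ^ 'k) \<Rightarrow> real" where
  "trans_avg \<theta> f x = (\<integral>y. f y \<partial>transition \<theta> x)"

lemma bounded_fun_act_avg: "bounded_fun SA C f \<Longrightarrow> bounded_fun (states G) C (act_avg \<theta> f)"
  unfolding act_avg_def[abs_def] by (rule bounded_fun_kernel) auto

lemma bounded_fun_next_avg: "bounded_fun (states G) C f \<Longrightarrow> bounded_fun SA C (next_avg f)"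
  unfolding next_avg_def[abs_def] by (rule bounded_fun_kernel) auto

lemma bounded_fun_trans_avg: "bounded_fun SA C f \<Longrightarrow> bounded_fun SA C (trans_avg \<theta> f)"
  unfolding trans_avg_def[abs_def] by (rule bounded_fun_kernel) auto

lemma bounded_fun_trans_avg_power: "bounded_fun SA C f \<Longrightarrow> bounded_fun SA C ((trans_avg \<theta> ^^ k) f)"
  by (induction k) (auto intro: bounded_fun_trans_avg)

lemma trans_avg_eq:
  assumes f: "bounded_fun SA C f" and x: "x \<in> space SA"
  shows "trans_avg \<theta> f x = next_avg (act_avg \<theta> f) x"
proof -
  have n: "next_law x \<in> space (prob_algebra (states G))" by (rule measurable_space[OF next_law_measurable x])
  have "integrable (transition \<theta> x) f"
    by (rule bounded_fun_integrable[OF f measurable_space[OF transition_measurable x]])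
  then show ?thesis unfolding trans_avg_def transition_def next_avg_def act_avg_def
    by (intro integrable_integral_bind(2)[OF n draw_action_measurable])
qed

lemma act_avg_fst:
  assumes v: "v \<in> borel_measurable (states G)" and s: "s \<in> space (states G)"
  shows "act_avg \<theta> (\<lambda>x. v (fst x)) s = v s"
proof -
  have "sets (draw_action G \<theta> s) = sets SA" using draw_action_in_space[OF s] by (simp add: space_prob_algebra)
  then have "fst \<in> draw_action G \<theta> s \<rightarrow>\<^sub>M states G" using measurable_fst measurable_cong_sets by blast
  then have "act_avg \<theta> (\<lambda>x. v (fst x)) s = (\<integral>s. v s \<partial>distr (draw_action G \<theta> s) (states G) fst)"
    unfolding act_avg_def by (rule integral_distr[OF _ v, symmetric])
  also have "\<dots> = v s" by (simp add: distr_draw_action_fst[OF s] integral_return s v)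
  finally show ?thesis .
qed

lemma traj_integral_0:
  assumes s: "s \<in> space (states G)" and f: "f \<in> borel_measurable SA"
  shows "(\<integral>\<omega>. f (\<omega> 0) \<partial>traj G \<theta> s) = act_avg \<theta> f s"
  unfolding act_avg_def distr_traj_0[OF s, symmetric]
  by (rule integral_distr[OF path_component_traj_measurable[OF s] f, symmetric])

text \<open>The weight \<open>\<psi>\<close> is only integrable, because it will be a linear
  functional of the unbounded score; boundedness is asked of the later factor \<open>f\<close>
  alone.\<close>

lemma traj_integral_Suc:
  assumes s: "s \<in> space (states G)" and t: "t \<le> n"
    and psi: "\<psi> \<in> borel_measurable SA" "integrable (traj G \<theta> s) (\<lambda>\<omega>. \<psi> (\<omega> t))" and f: "bounded_fun SA C f"
  shows "(\<integral>\<omega>. \<psi> (\<omega> t) * f (\<omega> (Suc n)) \<partial>traj G \<theta> s) = (\<integral>\<omega>. \<psi> (\<omega> t) * trans_avg \<theta> f (\<omega> n) \<partial>traj G \<theta> s)"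
proof -
  note pm[measurable] = path_component_traj_measurable[OF s]
  note [measurable] = psi(1)
  have fm[measurable]: "f \<in> borel_measurable SA" using f by (simp add: bounded_fun_def)
  let ?F = "\<lambda>p. \<psi> (fst p) * f (snd p)"
  let ?K = "\<lambda>\<omega>. distr (transition \<theta> (\<omega> n)) (SA \<Otimes>\<^sub>M SA) (\<lambda>z. (\<omega> t, z))"
  have K: "?K \<in> paths \<rightarrow>\<^sub>M prob_algebra (SA \<Otimes>\<^sub>M SA)"
    by (rule measurable_distr_prob_space2[where M=SA]) measurable
  have Fm: "?F \<in> borel_measurable (SA \<Otimes>\<^sub>M SA)" by measurable
  have i: "integrable (traj G \<theta> s) (\<lambda>\<omega>. \<psi> (\<omega> t) * f (\<omega> (Suc n)))"
  proof (rule Bochner_Integration.integrable_bound)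
    show "integrable (traj G \<theta> s) (\<lambda>\<omega>. C * \<psi> (\<omega> t))" using psi(2) by simp
    have "\<bar>f (\<omega> (Suc n))\<bar> \<le> \<bar>C\<bar>" if "\<omega> \<in> space (traj G \<theta> s)" for \<omega>
      using f measurable_space[OF pm that, of "Suc n"] by (force simp: bounded_fun_def)
    then have "norm (\<psi> (\<omega> t) * f (\<omega> (Suc n))) \<le> norm (C * \<psi> (\<omega> t))" if "\<omega> \<in> space (traj G \<theta> s)" for \<omega>
      using mult_right_mono[OF _ abs_ge_zero[of "\<psi> (\<omega> t)"], of "\<bar>f (\<omega> (Suc n))\<bar>" "\<bar>C\<bar>"] that
      by (simp add: abs_mult mult.commute)
    then show "AE \<omega> in traj G \<theta> s. norm (\<psi> (\<omega> t) * f (\<omega> (Suc n))) \<le> norm (C * \<psi> (\<omega> t))"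
      by (rule AE_I2)
  qed measurable
  have "(\<integral>\<omega>. \<psi> (\<omega> t) * f (\<omega> (Suc n)) \<partial>traj G \<theta> s) = (\<integral>p. ?F p \<partial>distr (traj G \<theta> s) (SA \<Otimes>\<^sub>M SA) (\<lambda>\<omega>. (\<omega> t, \<omega> (Suc n))))"
    by (subst integral_distr[OF _ Fm]) simp_all
  also have "\<dots> = (\<integral>\<omega>. (\<integral>p. ?F p \<partial>?K \<omega>) \<partial>traj G \<theta> s)"
    unfolding distr_traj_Suc[OF s t]
  proof (rule integrable_integral_bind(2)[OF traj_in_space[OF s] K])
    show "integrable (traj G \<theta> s \<bind> ?K) ?F"
      unfolding distr_traj_Suc[OF s t, symmetric] using i by (subst integrable_distr_eq[OF _ Fm]) simp_all
  qed
  also have "\<dots> = (\<integral>\<omega>. \<psi> (\<omega> t) * trans_avg \<theta> f (\<omega> n) \<partial>traj G \<theta> s)"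
  proof (rule Bochner_Integration.integral_cong[OF refl])
    fix \<omega> assume w: "\<omega> \<in> space (traj G \<theta> s)"
    have wt: "\<omega> t \<in> space SA" and wn: "\<omega> n \<in> space SA" using measurable_space[OF pm w] by auto
    have st: "sets (transition \<theta> (\<omega> n)) = sets SA"
      using measurable_space[OF transition_measurable wn] by (auto simp: space_prob_algebra)
    have "(\<lambda>z. (\<omega> t, z)) \<in> transition \<theta> (\<omega> n) \<rightarrow>\<^sub>M SA \<Otimes>\<^sub>M SA"
      unfolding measurable_cong_sets[OF st refl] using wt by (rule measurable_Pair1')
    then show "(\<integral>p. ?F p \<partial>?K \<omega>) = \<psi> (\<omega> t) * trans_avg \<theta> f (\<omega> n)"
      by (simp only: integral_distr[OF _ Fm] trans_avg_def fst_conv snd_conv integral_mult_right_zero)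
  qed
  finally show ?thesis .
qed

lemma traj_integral_add:
  assumes s: "s \<in> space (states G)"
    and psi: "\<psi> \<in> borel_measurable SA" "integrable (traj G \<theta> s) (\<lambda>\<omega>. \<psi> (\<omega> t))" and f: "bounded_fun SA C f"
  shows "(\<integral>\<omega>. \<psi> (\<omega> t) * f (\<omega> (t + k)) \<partial>traj G \<theta> s) = (\<integral>\<omega>. \<psi> (\<omega> t) * (trans_avg \<theta> ^^ k) f (\<omega> t) \<partial>traj G \<theta> s)"
  using f
proof (induction k arbitrary: f)
  case (Suc k)
  show ?case
    using traj_integral_Suc[OF s _ psi Suc.prems, of "t + k"] Suc.IH[OF bounded_fun_trans_avg[OF Suc.prems]]
    by (simp add: funpow_swap1)
qed simp

lemma traj_integral_next_state:
  assumes s: "s \<in> space (states G)"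
    and psi: "\<psi> \<in> borel_measurable SA" "integrable (traj G \<theta> s) (\<lambda>\<omega>. \<psi> (\<omega> t))" and v: "bounded_fun (states G) C v"
  shows "(\<integral>\<omega>. \<psi> (\<omega> t) * v (fst (\<omega> (Suc t))) \<partial>traj G \<theta> s) = (\<integral>\<omega>. \<psi> (\<omega> t) * next_avg v (\<omega> t) \<partial>traj G \<theta> s)"
proof -
  have b: "bounded_fun SA C (\<lambda>x. v (fst x))" using v by (rule bounded_fun_compose) simp
  have vm: "v \<in> borel_measurable (states G)" using v by (simp add: bounded_fun_def)
  show ?thesis
    unfolding traj_integral_Suc[OF s order_refl psi b]
  proof (rule Bochner_Integration.integral_cong[OF refl])
    fix \<omega> assume "\<omega> \<in> space (traj G \<theta> s)"
    then have w: "\<omega> t \<in> space SA" by (rule measurable_space[OF path_component_traj_measurable[OF s]])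
    have sn: "space (next_law (\<omega> t)) = space (states G)"
      using measurable_space[OF next_law_measurable w] sets_eq_imp_space_eq by (auto simp: space_prob_algebra)
    have "trans_avg \<theta> (\<lambda>x. v (fst x)) (\<omega> t) = next_avg v (\<omega> t)"
      unfolding trans_avg_eq[OF b w] unfolding next_avg_def
      by (rule Bochner_Integration.integral_cong) (auto simp: sn act_avg_fst[OF vm])
    then show "\<psi> (\<omega> t) * trans_avg \<theta> (\<lambda>x. v (fst x)) (\<omega> t) = \<psi> (\<omega> t) * next_avg v (\<omega> t)" by simp
  qed
qed

text \<open>Conditioning on the state at time \<open>t\<close>. For an integrand that contains a
  score, the inner average is bounded uniformly in the state, which the integrand itself is
  not.\<close>

lemma traj_integral_act_avg:
  assumes s: "s \<in> space (states G)"
    and f: "f \<in> borel_measurable SA" "integrable (traj G \<theta> s) (\<lambda>\<omega>. f (\<omega> t))"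
  shows "(\<integral>\<omega>. f (\<omega> t) \<partial>traj G \<theta> s) = (\<integral>\<omega>. act_avg \<theta> f (fst (\<omega> t)) \<partial>traj G \<theta> s)"
proof -
  note pm[measurable] = path_component_traj_measurable[OF s]
  have K: "(\<lambda>\<omega>. draw_action G \<theta> (fst (\<omega> t))) \<in> paths \<rightarrow>\<^sub>M prob_algebra SA"
    by (rule measurable_compose[OF _ draw_action_measurable]) simp
  have "(\<integral>\<omega>. f (\<omega> t) \<partial>traj G \<theta> s) = (\<integral>x. f x \<partial>distr (traj G \<theta> s) SA (\<lambda>\<omega>. \<omega> t))"
    by (rule integral_distr[OF pm f(1), symmetric])
  also have "\<dots> = (\<integral>\<omega>. act_avg \<theta> f (fst (\<omega> t)) \<partial>traj G \<theta> s)"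
    unfolding distr_traj_component[OF s] act_avg_def
    by (rule integrable_integral_bind(2)[OF traj_in_space[OF s] K])
       (use f in \<open>simp add: distr_traj_component[OF s, symmetric] integrable_distr_eq\<close>)
  finally show ?thesis .
qed

lemma traj_nn_integral_act_avg:
  assumes s: "s \<in> space (states G)" and f: "f \<in> borel_measurable SA"
  shows "(\<integral>\<^sup>+\<omega>. f (\<omega> t) \<partial>traj G \<theta> s) = (\<integral>\<^sup>+\<omega>. (\<integral>\<^sup>+x. f x \<partial>draw_action G \<theta> (fst (\<omega> t))) \<partial>traj G \<theta> s)"
proof -
  note pm[measurable] = path_component_traj_measurable[OF s]
  have K: "(\<lambda>\<omega>. draw_action G \<theta> (fst (\<omega> t))) \<in> traj G \<theta> s \<rightarrow>\<^sub>M subprob_algebra SA"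
    by (rule measurable_prob_algebraD) measurable
  have "(\<integral>\<^sup>+\<omega>. f (\<omega> t) \<partial>traj G \<theta> s) = (\<integral>\<^sup>+x. f x \<partial>distr (traj G \<theta> s) SA (\<lambda>\<omega>. \<omega> t))"
    using f by (subst nn_integral_distr[OF pm]) simp_all
  also have "\<dots> = (\<integral>\<^sup>+\<omega>. (\<integral>\<^sup>+x. f x \<partial>draw_action G \<theta> (fst (\<omega> t))) \<partial>traj G \<theta> s)"
    unfolding distr_traj_component[OF s] by (rule nn_integral_bind[OF f K])
  finally show ?thesis .
qed

end

section \<open>Value functions, the Bellman equation and the performance difference\<close>

locale bounded_markov_game = markov_game_locale G
  for G :: "('s, 'n::finite, 'k::finite, 'm::finite) game" +
  fixes R :: real
  assumes R_pos: "0 < R"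
    and rew_bounded: "s \<in> space (states G) \<Longrightarrow> (\<forall>n. a n \<in> actions G) \<Longrightarrow> \<bar>rew G i s a\<bar> \<le> R"
begin

abbreviation \<gamma> where "\<gamma> \<equiv> disc G"

definition reward where "reward i x = rew G i (fst x) (snd x)"

lemma bounded_fun_reward: "bounded_fun SA R (reward i)"
  using rew_measurable[of i] rew_bounded
  by (auto simp: bounded_fun_def reward_def[abs_def] case_prod_unfold space_pair_measure)

text \<open>The Neumann series of the Bellman equation. Being defined at all pairs, it can be
  averaged over actions of a different policy, as the performance difference requires.\<close>

definition Qval where "Qval \<theta> i x = (\<Sum>k. \<gamma> ^ k * (trans_avg \<theta> ^^ k) (reward i) x)"
definition Vval where "Vval \<theta> i = act_avg \<theta> (Qval \<theta> i)"

lemma bounded_fun_Qval: "bounded_fun SA (R / (1 - \<gamma>)) (Qval \<theta> i)"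
  unfolding Qval_def[abs_def]
  by (intro bounded_fun_discounted_sum bounded_fun_trans_avg_power bounded_fun_reward) auto

lemma bounded_fun_Vval: "bounded_fun (states G) (R / (1 - \<gamma>)) (Vval \<theta> i)"
  unfolding Vval_def by (rule bounded_fun_act_avg[OF bounded_fun_Qval])

text \<open>The term \<open>k = 0\<close> is the reward; one application of \<open>trans_avg\<close>
  and one factor \<open>\<gamma>\<close> are pulled out of the rest of the series.\<close>

lemma Qval_Bellman:
  assumes x: "x \<in> space SA"
  shows "Qval \<theta> i x = reward i x + \<gamma> * next_avg (Vval \<theta> i) x"
proof -
  let ?f = "\<lambda>k. (trans_avg \<theta> ^^ k) (reward i)"
  have b: "bounded_fun SA R (?f k)" for k by (intro bounded_fun_trans_avg_power bounded_fun_reward)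
  have sm: "summable (\<lambda>k. \<gamma> ^ k * ?f k x)"
    by (rule summable_rabs_cancel, rule bounded_fun_discounted_sum(2)[where f="?f", OF b disc_pos disc_less_1 x])
  have b': "bounded_fun SA R (trans_avg \<theta> (?f k))" for k by (rule bounded_fun_trans_avg[OF b])
  have sm': "summable (\<lambda>k. \<gamma> ^ k * trans_avg \<theta> (?f k) x)"
    by (rule summable_rabs_cancel, rule bounded_fun_discounted_sum(2)[where f="\<lambda>k. trans_avg \<theta> (?f k)", OF b' disc_pos disc_less_1 x])
  have "Qval \<theta> i x = reward i x + (\<Sum>k. \<gamma> ^ Suc k * ?f (Suc k) x)"
    unfolding Qval_def using suminf_split_head[OF sm] by simp
  also have "(\<Sum>k. \<gamma> ^ Suc k * ?f (Suc k) x) = \<gamma> * (\<Sum>k. \<gamma> ^ k * trans_avg \<theta> (?f k) x)"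
    by (subst suminf_mult[OF sm', symmetric]) (simp add: mult.assoc)
  also have "(\<Sum>k. \<gamma> ^ k * trans_avg \<theta> (?f k) x) = trans_avg \<theta> (Qval \<theta> i) x"
    unfolding trans_avg_def[of \<theta> _ x] Qval_def[abs_def]
    by (rule bounded_fun_discounted_sum(3)[OF b disc_pos disc_less_1 measurable_space[OF transition_measurable x], symmetric])
  also have "\<dots> = next_avg (Vval \<theta> i) x" unfolding Vval_def by (rule trans_avg_eq[OF bounded_fun_Qval x])
  finally show ?thesis .
qed

lemma Vval_eq_traj:
  assumes s: "s \<in> space (states G)"
  shows "Vval \<theta> i s = (\<Sum>t. \<gamma> ^ t * (\<integral>\<omega>. reward i (\<omega> t) \<partial>traj G \<theta> s))"
proof -
  interpret tr: prob_space "traj G \<theta> s" by (rule prob_space_traj[OF s])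
  let ?f = "\<lambda>k. (trans_avg \<theta> ^^ k) (reward i)"
  have bf: "bounded_fun SA R (?f k)" for k by (intro bounded_fun_trans_avg_power bounded_fun_reward)
  have "(\<integral>\<omega>. reward i (\<omega> t) \<partial>traj G \<theta> s) = act_avg \<theta> (?f t) s" for t
  proof -
    have "(\<integral>\<omega>. 1 * reward i (\<omega> (0 + t)) \<partial>traj G \<theta> s) = (\<integral>\<omega>. 1 * ?f t (\<omega> 0) \<partial>traj G \<theta> s)"
      by (rule traj_integral_add[OF s _ _ bounded_fun_reward]) (rule measurable_const, simp, rule tr.integrable_const)
    also have "\<dots> = act_avg \<theta> (?f t) s"
      unfolding mult_1 using bf[of t] by (intro traj_integral_0[OF s]) (auto simp only: bounded_fun_def)
    finally show ?thesis by (simp only: mult_1 add_0)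
  qed
  moreover have "Vval \<theta> i s = (\<Sum>t. \<gamma> ^ t * act_avg \<theta> (?f t) s)"
    unfolding Vval_def Qval_def[abs_def] act_avg_def
    by (rule bounded_fun_discounted_sum(3)[OF bf disc_pos disc_less_1 draw_action_in_space[OF s]])
  ultimately show ?thesis by simp
qed

lemma utility_eq_Vval: "utility G i \<theta> = Vval \<theta> i (init G)"
proof -
  have b: "bounded_fun paths R (\<lambda>\<omega>. reward i (\<omega> t))" for t
    by (rule bounded_fun_compose[OF bounded_fun_reward]) simp
  show ?thesis
    unfolding Vval_eq_traj[OF init_space] utility_def reward_at_def reward_def[symmetric]
    by (rule bounded_fun_discounted_sum(3)[OF b disc_pos disc_less_1 traj_in_space[OF init_space]])
qed

text \<open>The difference of the two value functions satisfies a discounted recursion along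
  trajectories of \<open>\<theta>\<close>, with source term \<open>\<delta>\<close>; unrolling it
  telescopes, and the discounted remainder vanishes by boundedness. Note the mixture: trajectories
  of \<open>\<theta>\<close>, Q-function of \<open>\<theta>'\<close>.\<close>

lemma performance_difference:
  fixes \<theta> \<theta>' i
  defines "\<delta> \<equiv> \<lambda>s. act_avg \<theta>' (Qval \<theta>' i) s - act_avg \<theta> (Qval \<theta>' i) s"
  assumes s: "s \<in> space (states G)"
  shows "(\<lambda>t. \<gamma> ^ t * (\<integral>\<omega>. \<delta> (fst (\<omega> t)) \<partial>traj G \<theta> s)) sums (Vval \<theta>' i s - Vval \<theta> i s)"
proof -
  note pm[measurable] = path_component_traj_measurable[OF s, of _ \<theta>]
  let ?C = "R / (1 - \<gamma>)"
  define v where "v s = Vval \<theta>' i s - Vval \<theta> i s" for s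
  have bv: "bounded_fun (states G) (2 * ?C) v"
    unfolding v_def using bounded_fun_diff[OF bounded_fun_Vval bounded_fun_Vval] by simp
  have bvn: "bounded_fun SA (2 * ?C) (next_avg v)" by (rule bounded_fun_next_avg[OF bv])
  have ba: "bounded_fun (states G) ?C (act_avg \<theta> (Qval \<theta>' i))"
    by (rule bounded_fun_act_avg[OF bounded_fun_Qval])
  have bd: "bounded_fun (states G) (2 * ?C) \<delta>"
    unfolding \<delta>_def using bounded_fun_diff[OF bounded_fun_Vval[of \<theta>' i] ba] by (simp add: Vval_def)
  have na: "next_avg v x = next_avg (Vval \<theta>' i) x - next_avg (Vval \<theta> i) x" if x: "x \<in> space SA" for x
    unfolding next_avg_def v_def
    by (intro Bochner_Integration.integral_diff bounded_fun_integrable[OF bounded_fun_Vval] measurable_space[OF next_law_measurable x])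
  \<comment> \<open>Insert the average of the new Q-function over old actions. The source
    \<open>\<delta>\<close> collects the change of the actions; in what is left the rewards cancel
    by the Bellman equation.\<close>
  have vd: "v s = \<delta> s + act_avg \<theta> (\<lambda>x. \<gamma> * next_avg v x) s" if s: "s \<in> space (states G)" for s
  proof -
    have dA: "draw_action G \<theta> s \<in> space (prob_algebra SA)" by (rule draw_action_in_space[OF s])
    have "v s - \<delta> s = act_avg \<theta> (Qval \<theta>' i) s - act_avg \<theta> (Qval \<theta> i) s"
      unfolding v_def \<delta>_def Vval_def by simp
    also have "\<dots> = (\<integral>x. Qval \<theta>' i x - Qval \<theta> i x \<partial>draw_action G \<theta> s)"
      unfolding act_avg_def
      by (intro Bochner_Integration.integral_diff[symmetric] bounded_fun_integrable[OF bounded_fun_Qval dA])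
    also have "\<dots> = act_avg \<theta> (\<lambda>x. \<gamma> * next_avg v x) s"
      unfolding act_avg_def
    proof (rule Bochner_Integration.integral_cong[OF refl])
      fix x assume "x \<in> space (draw_action G \<theta> s)"
      then have "x \<in> space SA" using dA sets_eq_imp_space_eq by (auto simp: space_prob_algebra)
      then show "Qval \<theta>' i x - Qval \<theta> i x = \<gamma> * next_avg v x"
        by (simp add: Qval_Bellman na algebra_simps)
    qed
    finally show ?thesis by simp
  qed
  define a where "a t = (\<integral>\<omega>. v (fst (\<omega> t)) \<partial>traj G \<theta> s)" for t
  define d where "d t = (\<integral>\<omega>. \<delta> (fst (\<omega> t)) \<partial>traj G \<theta> s)" for t
  have fm: "(\<lambda>\<omega>. fst (\<omega> t)) \<in> paths \<rightarrow>\<^sub>M states G" for t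
    by (rule measurable_compose[OF path_component_measurable measurable_fst])
  note tin = traj_in_space[OF s, of \<theta>]
  have ab: "\<bar>a t\<bar> \<le> 2 * ?C" for t
    unfolding a_def by (rule bounded_fun_integrable(2)[OF bounded_fun_compose[OF bv fm] tin])
  \<comment> \<open>Taking expectations of the pointwise identity at time \<open>t\<close>: the
    average over action and next state merges with the law of the state at time
    \<open>t + 1\<close>.\<close>
  have rec: "a t = d t + \<gamma> * a (Suc t)" for t
  proof -
    have bg: "bounded_fun SA (\<bar>\<gamma>\<bar> * (2 * ?C)) (\<lambda>x. \<gamma> * next_avg v x)"
      by (rule bounded_fun_cmult[OF bvn])
    have gm: "(\<lambda>x. \<gamma> * next_avg v x) \<in> borel_measurable SA" using bg by (simp add: bounded_fun_def)
    have gi: "integrable (traj G \<theta> s) (\<lambda>\<omega>. \<gamma> * next_avg v (\<omega> t))"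
      by (rule bounded_fun_integrable(1)[OF bounded_fun_compose[OF bg path_component_measurable] tin])
    have "a t = (\<integral>\<omega>. \<delta> (fst (\<omega> t)) + act_avg \<theta> (\<lambda>x. \<gamma> * next_avg v x) (fst (\<omega> t)) \<partial>traj G \<theta> s)"
      unfolding a_def
    proof (rule Bochner_Integration.integral_cong[OF refl])
      fix \<omega> assume "\<omega> \<in> space (traj G \<theta> s)"
      then have "\<omega> t \<in> space SA" by (rule measurable_space[OF pm])
      then show "v (fst (\<omega> t)) = \<delta> (fst (\<omega> t)) + act_avg \<theta> (\<lambda>x. \<gamma> * next_avg v x) (fst (\<omega> t))"
        by (intro vd) (auto simp: space_pair_measure)
    qed
    also have "\<dots> = d t + (\<integral>\<omega>. act_avg \<theta> (\<lambda>x. \<gamma> * next_avg v x) (fst (\<omega> t)) \<partial>traj G \<theta> s)"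
      unfolding d_def
      by (intro Bochner_Integration.integral_add bounded_fun_integrable(1)[OF bounded_fun_compose[OF bd fm] tin]
          bounded_fun_integrable(1)[OF bounded_fun_compose[OF bounded_fun_act_avg[OF bg] fm] tin])
    also have "(\<integral>\<omega>. act_avg \<theta> (\<lambda>x. \<gamma> * next_avg v x) (fst (\<omega> t)) \<partial>traj G \<theta> s) = (\<integral>\<omega>. \<gamma> * next_avg v (\<omega> t) \<partial>traj G \<theta> s)"
      by (rule traj_integral_act_avg[OF s gm gi, symmetric])
    also have "\<dots> = \<gamma> * a (Suc t)"
    proof -
      interpret tr: prob_space "traj G \<theta> s" by (rule prob_space_traj[OF s])
      have "(\<integral>\<omega>. 1 * v (fst (\<omega> (Suc t))) \<partial>traj G \<theta> s) = (\<integral>\<omega>. 1 * next_avg v (\<omega> t) \<partial>traj G \<theta> s)"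
        by (rule traj_integral_next_state[OF s _ _ bv]) (rule measurable_const, simp, rule tr.integrable_const)
      then show ?thesis by (simp only: a_def mult_1 integral_mult_right_zero)
    qed
    finally show ?thesis .
  qed
  have "(\<Sum>t<n. \<gamma> ^ t * d t) = a 0 - \<gamma> ^ n * a n" for n
  proof (induction n)
    case (Suc n) then show ?case using rec[of n] by (simp add: algebra_simps)
  qed simp
  moreover have "(\<lambda>n. a 0 - \<gamma> ^ n * a n) \<longlonglongrightarrow> a 0 - 0"
  proof (intro tendsto_diff tendsto_const)
    have "(\<lambda>n. \<gamma> ^ n) \<longlonglongrightarrow> 0" by (rule LIMSEQ_power_zero) (simp add: abs_of_pos)
    moreover have "Bseq a" by (rule BseqI'[of _ "2 * ?C"]) (use ab in simp)
    ultimately show "(\<lambda>n. \<gamma> ^ n * a n) \<longlonglongrightarrow> 0"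
      unfolding tendsto_Zfun_iff diff_0_right by (rule bounded_bilinear.Zfun_prod_Bfun[OF bounded_bilinear_mult])
  qed
  ultimately have "(\<lambda>t. \<gamma> ^ t * d t) sums a 0" by (simp add: sums_def)
  moreover have "a 0 = v s"
    unfolding a_def using bv s
    by (subst traj_integral_0[OF s, of "\<lambda>x. v (fst x)"]) (auto simp: bounded_fun_def act_avg_fst)
  ultimately show ?thesis by (simp add: d_def v_def)
qed

end

section \<open>Smooth dependence of the values on the parameter\<close>

locale smooth_markov_game = bounded_markov_game G R
  for G :: "('s, 'n::finite, 'k::finite, 'm::finite) game" and R :: real +
  fixes V L :: real
  assumes L_nonneg: "0 \<le> L"
    and score_second_moment: "s \<in> space (states G) \<Longrightarrow>
      (\<integral>\<^sup>+ a. ennreal ((norm (score G i n \<theta> s a))\<^sup>2) \<partial>policy G n \<theta> s) \<le> ennreal (V\<^sup>2)"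
    and score_Lipschitz: "s \<in> space (states G) \<Longrightarrow> a \<in> actions G \<Longrightarrow>
      norm (score G i n \<theta>1 s a - score G i n \<theta>2 s a) \<le> L * norm (\<theta>1 - \<theta>2)"
begin

text \<open>The full gradient of the logarithm of one density, assembled from its blocks, since the
  assumptions speak about one block at a time.\<close>

definition policy_score :: "'n \<Rightarrow> real ^ 'm \<Rightarrow> 's \<Rightarrow> real ^ 'k \<Rightarrow> real ^ 'm" where
  "policy_score n \<theta> s a = (\<Sum>i\<in>UNIV. score G i n \<theta> s a)"

definition joint_score :: "real ^ 'm \<Rightarrow> 's \<Rightarrow> ('n \<Rightarrow> real ^ 'k) \<Rightarrow> real ^ 'm" where
  "joint_score \<theta> s a = (\<Sum>n\<in>UNIV. policy_score n \<theta> s (a n))"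

lemma policy_score_Lipschitz:
  assumes "s \<in> space (states G)" "a \<in> actions G"
  shows "norm (policy_score n \<theta>1 s a - policy_score n \<theta>2 s a) \<le> (real CARD('n) * L) * norm (\<theta>1 - \<theta>2)"
proof -
  have "norm (policy_score n \<theta>1 s a - policy_score n \<theta>2 s a) \<le> (\<Sum>i\<in>(UNIV::'n set). L * norm (\<theta>1 - \<theta>2))"
    unfolding policy_score_def sum_subtractf[symmetric] by (rule sum_norm_le) (rule score_Lipschitz[OF assms])
  then show ?thesis by simp
qed

lemma score_eq_block:
  assumes s: "s \<in> space (states G)" and a: "a \<in> actions G" and p: "0 < pol G n \<theta> s a"
  shows "score G i n \<theta> s a = block (own G) i (inverse (pol G n \<theta> s a) *\<^sub>R grad (\<lambda>\<theta>. pol G n \<theta> s a) \<theta>)"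
    and "GDERIV (\<lambda>\<theta>. ln (pol G n \<theta> s a)) \<theta> :> policy_score n \<theta> s a"
proof -
  let ?D = "inverse (pol G n \<theta> s a) *\<^sub>R grad (\<lambda>\<theta>. pol G n \<theta> s a) \<theta>"
  have D: "GDERIV (\<lambda>\<theta>. ln (pol G n \<theta> s a)) \<theta> :> ?D"
    by (rule GDERIV_DERIV_compose[OF GDERIV_grad[OF pol_differentiable[OF s a]] DERIV_ln[OF p]])
  show e: "score G i n \<theta> s a = block (own G) i ?D" for i
    unfolding score_def by (rule block_grad_eqI[OF D])
  show "GDERIV (\<lambda>\<theta>. ln (pol G n \<theta> s a)) \<theta> :> policy_score n \<theta> s a"
    using D by (simp add: policy_score_def e sum_block)
qed

text \<open>Positivity propagates from one parameter to every other, so the support of a policy does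
  not move with the parameter and no boundary terms arise when the parameter varies.\<close>

lemma pol_positive_or_zero:
  assumes s: "s \<in> space (states G)" and a: "a \<in> actions G"
  shows "(\<forall>\<theta>. 0 < pol G n \<theta> s a) \<or> (\<forall>\<theta>. pol G n \<theta> s a = 0)"
proof -
  have "0 < pol G n \<theta>0 s a" if "0 < pol G n \<theta>1 s a" for \<theta>0 \<theta>1
    by (rule positive_or_zero_of_Lipschitz_log_gradient[of "\<lambda>\<theta>. pol G n \<theta> s a" "\<lambda>\<theta>. policy_score n \<theta> s a",
          OF pol_nonneg[OF s a] pol_differentiable[OF s a] score_eq_block(2)[OF s a] policy_score_Lipschitz[OF s a] that])
  then show ?thesis using pol_nonneg[OF s a] by (metis order_less_le)
qed

lemma score_zero:
  assumes "\<forall>\<theta>. pol G n \<theta> s a = 0"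
  shows "score G i n \<theta> s a = 0"
proof -
  have "GDERIV (\<lambda>\<theta>. ln (pol G n \<theta> s a)) \<theta> :> 0" using assms by (simp add: GDERIV_const)
  from block_grad_eqI[OF this, of "own G" i] show ?thesis
    unfolding score_def by (simp add: linear_0[OF linear_block])
qed

lemma block_score:
  assumes s: "s \<in> space (states G)" and a: "a \<in> actions G"
  shows "block (own G) i (score G i n \<theta> s a) = score G i n \<theta> s a"
    and "block (own G) i (policy_score n \<theta> s a) = score G i n \<theta> s a"
proof -
  have b: "block (own G) j (score G j n \<theta> s a) = score G j n \<theta> s a" for j
    using pol_positive_or_zero[OF s a, of n]
  proof
    assume "\<forall>\<theta>. 0 < pol G n \<theta> s a"
    then show ?thesis using score_eq_block(1)[OF s a, of n \<theta> j] by simp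
  next
    assume "\<forall>\<theta>. pol G n \<theta> s a = 0"
    then show ?thesis by (simp add: score_zero linear_0[OF linear_block])
  qed
  then show "block (own G) i (score G i n \<theta> s a) = score G i n \<theta> s a" .
  have "block (own G) i (score G j n \<theta> s a) = (if j = i then score G i n \<theta> s a else 0)" for j
  proof (cases "j = i")
    case False
    have "block (own G) i (block (own G) j v) = 0" for v using False by (auto simp: vec_eq_iff block_nth)
    from this[of "score G j n \<theta> s a"] False show ?thesis by (simp add: b)
  qed (simp add: b)
  then show "block (own G) i (policy_score n \<theta> s a) = score G i n \<theta> s a"
    unfolding policy_score_def by (simp add: linear_sum[OF linear_block])
qed

text \<open>A gradient given by a description carries no measurability. It is recovered in each
  coordinate as the limit of difference quotients of measurable functions; where the density
  vanishes for all parameters, these quotients and the score are zero.\<close>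

lemma score_measurable [measurable]:
  "(\<lambda>(s, a). score G i n \<theta> s a) \<in> borel_measurable (states G \<Otimes>\<^sub>M act_ref G)"
proof -
  let ?M = "states G \<Otimes>\<^sub>M act_ref G"
  let ?h = "\<lambda>j::nat. 1 / real (Suc j)"
  let ?q = "\<lambda>m j p. (ln (pol G n (\<theta> + ?h j *\<^sub>R axis m 1) (fst p) (snd p)) - ln (pol G n \<theta> (fst p) (snd p))) / ?h j"
  have c: "(\<lambda>p. score G i n \<theta> (fst p) (snd p) $ m) \<in> borel_measurable ?M" for m
  proof (cases "own G m = i")
    case True
    show ?thesis
    proof (rule borel_measurable_LIMSEQ_real)
      show "?q m j \<in> borel_measurable ?M" for j
        using pol_measurable[of n] by (simp add: case_prod_unfold)
      fix p assume "p \<in> space ?M"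
      then have s: "fst p \<in> space (states G)" and a: "snd p \<in> actions G" by (auto simp: space_pair_measure)
      show "(\<lambda>j. ?q m j p) \<longlonglongrightarrow> score G i n \<theta> (fst p) (snd p) $ m"
        using pol_positive_or_zero[OF s a, of n]
      proof
        assume "\<forall>\<theta>. pol G n \<theta> (fst p) (snd p) = 0"
        then show ?thesis by (simp add: score_zero)
      next
        assume pos: "\<forall>\<theta>. 0 < pol G n \<theta> (fst p) (snd p)"
        let ?f = "\<lambda>\<theta>. ln (pol G n \<theta> (fst p) (snd p))" and ?S = "policy_score n \<theta> (fst p) (snd p)"
        have "GDERIV ?f \<theta> :> ?S" using score_eq_block(2)[OF s a] pos by blast
        then have "(?f has_derivative (\<lambda>h. h \<bullet> ?S)) (at (\<theta> + 0 *\<^sub>R axis m 1))" by (simp add: gderiv_def)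
        moreover have "((\<lambda>\<sigma>. \<theta> + \<sigma> *\<^sub>R axis m 1) has_derivative (\<lambda>\<sigma>. \<sigma> *\<^sub>R axis m 1)) (at 0)"
          by (auto intro!: derivative_eq_intros)
        ultimately have "((\<lambda>\<sigma>. ?f (\<theta> + \<sigma> *\<^sub>R axis m 1)) has_derivative (\<lambda>\<sigma>. (\<sigma> *\<^sub>R axis m 1) \<bullet> ?S)) (at 0)"
          using diff_chain_at by (fastforce simp: comp_def)
        then have "((\<lambda>\<sigma>. ?f (\<theta> + \<sigma> *\<^sub>R axis m 1)) has_real_derivative ?S $ m) (at 0)"
          unfolding has_field_derivative_def by (simp add: inner_axis' mult.commute[of _ "?S $ m"])
        then have "((\<lambda>h. (?f (\<theta> + h *\<^sub>R axis m 1) - ?f \<theta>) / h) \<longlongrightarrow> ?S $ m) (at 0)"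
          by (simp add: DERIV_def)
        moreover have "filterlim ?h (at 0) sequentially"
          by (rule filterlim_atI[OF LIMSEQ_Suc[OF lim_1_over_n]]) auto
        ultimately have "(\<lambda>j. ?q m j p) \<longlonglongrightarrow> ?S $ m" by (rule filterlim_compose)
        moreover have "?S $ m = score G i n \<theta> (fst p) (snd p) $ m"
          unfolding block_score(2)[OF s a, of i, symmetric] using True by (simp add: block_nth)
        ultimately show ?thesis by simp
      qed
    qed
  next
    case False
    have "score G i n \<theta> (fst p) (snd p) $ m = 0" if "p \<in> space ?M" for p
    proof -
      have "block (own G) i (score G i n \<theta> (fst p) (snd p)) = score G i n \<theta> (fst p) (snd p)"
        by (rule block_score(1)) (use that in \<open>auto simp: space_pair_measure\<close>)
      then show ?thesis using False by (metis block_nth)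
    qed
    then show ?thesis by (subst measurable_cong[where g="\<lambda>_. 0"]) auto
  qed
  then have "(\<lambda>p. score G i n \<theta> (fst p) (snd p)) \<in> borel_measurable ?M" by (rule borel_measurable_vecI)
  then show ?thesis by (simp add: case_prod_unfold)
qed

lemma joint_score_measurable [measurable]: "(\<lambda>(s, a). joint_score \<theta> s a) \<in> borel_measurable SA"
  unfolding joint_score_def policy_score_def by measurable

text \<open>One factor \<open>CARD('n)\<close> for the blocks of a single policy, a second one for
  the agents.\<close>

definition score_lip :: real where "score_lip = (real CARD('n))\<^sup>2 * L"

lemma score_lip_nonneg: "0 \<le> score_lip" by (simp add: score_lip_def L_nonneg)

lemma joint_score_Lipschitz:
  assumes "s \<in> space (states G)" "a \<in> space (joint_ref G)"
  shows "norm (joint_score \<theta>1 s a - joint_score \<theta>2 s a) \<le> score_lip * norm (\<theta>1 - \<theta>2)"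
proof -
  have "norm (joint_score \<theta>1 s a - joint_score \<theta>2 s a) \<le> (\<Sum>n\<in>(UNIV::'n set). (real CARD('n) * L) * norm (\<theta>1 - \<theta>2))"
    unfolding joint_score_def sum_subtractf[symmetric]
    by (rule sum_norm_le) (use assms in \<open>auto intro: policy_score_Lipschitz\<close>)
  then show ?thesis by (simp add: score_lip_def power2_eq_square)
qed

text \<open>By the dichotomy for each agent, a joint action is either impossible under all
  parameters or has positive density under all of them, so no likelihood ratio is ever taken against
  zero.\<close>

lemma joint_pol_cases:
  assumes s: "s \<in> space (states G)" and a: "a \<in> space (joint_ref G)"
  obtains (zero) "\<And>\<theta>. joint_pol \<theta> s a = 0"
  | (pos) "\<And>\<theta>. 0 < joint_pol \<theta> s a" "\<And>\<theta>. GDERIV (\<lambda>\<theta>. ln (joint_pol \<theta> s a)) \<theta> :> joint_score \<theta> s a"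
proof (cases "\<exists>n. \<forall>\<theta>. pol G n \<theta> s (a n) = 0")
  case True
  then have "joint_pol \<theta> s a = 0" for \<theta> unfolding joint_pol_def by (metis UNIV_I finite prod_zero)
  with zero show thesis by blast
next
  case False
  then have p: "0 < pol G n \<theta> s (a n)" for n \<theta>
    using pol_positive_or_zero[OF s, of "a n" n] a by auto
  then have jp: "0 < joint_pol \<theta> s a" for \<theta> by (simp add: joint_pol_def prod_pos)
  have e: "(\<lambda>\<theta>. ln (joint_pol \<theta> s a)) = (\<lambda>\<theta>. \<Sum>n\<in>UNIV. ln (pol G n \<theta> s (a n)))"
    unfolding joint_pol_def using p by (subst ln_prod) (auto simp: less_imp_neq[symmetric])
  have "GDERIV (\<lambda>\<theta>. ln (joint_pol \<theta> s a)) \<theta> :> joint_score \<theta> s a" for \<theta>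
    unfolding e joint_score_def gderiv_def inner_sum_right
    by (intro has_derivative_sum) (use score_eq_block(2)[OF s _ p] a in \<open>auto simp: gderiv_def\<close>)
  with jp pos show thesis by blast
qed

text \<open>The dominating function supplied by \<open>density_expansion\<close>. The additional
  summand 1 makes it dominate the density times the norm of the score as well, since a norm is at
  most one plus its square.\<close>

definition score_weight :: "real ^ 'm \<Rightarrow> 's \<Rightarrow> ('n \<Rightarrow> real ^ 'k) \<Rightarrow> real" where
  "score_weight \<theta> s a = joint_pol \<theta> s a * (2 * (norm (joint_score \<theta> s a))\<^sup>2 + (2 * score_lip\<^sup>2 + score_lip + 1))"

definition score_weight_mass :: real where "score_weight_mass = 2 * ((real CARD('n)) ^ 4 * V\<^sup>2) + (2 * score_lip\<^sup>2 + score_lip + 1)"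

lemma score_weight_mass_ge_1: "1 \<le> score_weight_mass" using score_lip_nonneg by (simp add: score_weight_mass_def)

lemma joint_pol_expansion:
  assumes s: "s \<in> space (states G)" and a: "a \<in> space (joint_ref G)" and d: "norm (\<theta>' - \<theta>) \<le> 1"
  shows "\<bar>joint_pol \<theta>' s a - joint_pol \<theta> s a - joint_pol \<theta> s a * ((\<theta>' - \<theta>) \<bullet> joint_score \<theta> s a)\<bar>
    \<le> (norm (\<theta>' - \<theta>))\<^sup>2 * (score_weight \<theta> s a + score_weight \<theta>' s a)"
  using s a
proof (cases rule: joint_pol_cases)
  case zero
  then show ?thesis by (simp add: score_weight_def)
next
  case pos
  have "\<bar>joint_pol \<theta>' s a - joint_pol \<theta> s a - joint_pol \<theta> s a * ((\<theta>' - \<theta>) \<bullet> joint_score \<theta> s a)\<bar>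
    \<le> (norm (\<theta>' - \<theta>))\<^sup>2 * (joint_pol \<theta> s a * (2 * (norm (joint_score \<theta> s a))\<^sup>2 + 2 * score_lip\<^sup>2 + score_lip)
       + joint_pol \<theta>' s a * (2 * (norm (joint_score \<theta>' s a))\<^sup>2 + 2 * score_lip\<^sup>2 + score_lip))"
    by (rule density_expansion[of "\<lambda>\<theta>. joint_pol \<theta> s a" "\<lambda>\<theta>. joint_score \<theta> s a", OF pos joint_score_Lipschitz[OF s a] score_lip_nonneg d])
  also have "\<dots> \<le> (norm (\<theta>' - \<theta>))\<^sup>2 * (score_weight \<theta> s a + score_weight \<theta>' s a)"
    unfolding score_weight_def using pos(1)[of \<theta>] pos(1)[of \<theta>']
    by (intro mult_left_mono add_mono[OF mult_left_mono mult_left_mono]) auto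
  finally show ?thesis .
qed

lemma score_weight_bounds:
  assumes s: "s \<in> space (states G)" and a: "a \<in> space (joint_ref G)"
  shows "0 \<le> score_weight \<theta> s a" and "joint_pol \<theta> s a * norm (joint_score \<theta> s a) \<le> score_weight \<theta> s a"
proof -
  note p = joint_pol_nonneg[OF s a, of \<theta>]
  show "0 \<le> score_weight \<theta> s a" unfolding score_weight_def using p score_lip_nonneg by (intro mult_nonneg_nonneg) auto
  have "norm (joint_score \<theta> s a) \<le> (norm (joint_score \<theta> s a))\<^sup>2 + 1"
    using le_one_plus_square[of "norm (joint_score \<theta> s a)"] by simp
  also have "\<dots> \<le> 2 * (norm (joint_score \<theta> s a))\<^sup>2 + (2 * score_lip\<^sup>2 + score_lip + 1)" using score_lip_nonneg by simp
  finally show "joint_pol \<theta> s a * norm (joint_score \<theta> s a) \<le> score_weight \<theta> s a"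
    unfolding score_weight_def by (rule mult_left_mono[OF _ p])
qed

text \<open>Cauchy-Schwarz over the pairs of an agent and a block, whose number is the square of
  \<open>CARD('n)\<close>, then marginalisation. This square enters once through Cauchy-Schwarz and
  once through the number of summands, hence the fourth power.\<close>

lemma nn_integral_joint_score_sq:
  assumes s: "s \<in> space (states G)"
  shows "(\<integral>\<^sup>+a. ennreal (joint_pol \<theta> s a) * ennreal ((norm (joint_score \<theta> s a))\<^sup>2) \<partial>joint_ref G) \<le> ennreal ((real CARD('n)) ^ 4 * V\<^sup>2)"
proof -
  let ?N = "real CARD('n)"
  have pm: "(\<lambda>a. pol G n \<theta> s a) \<in> borel_measurable (act_ref G)" for n
    using measurable_Pair2[OF pol_measurable s] by simp
  have sm: "(\<lambda>a. score G i n \<theta> s a) \<in> borel_measurable (act_ref G)" for i n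
    using measurable_Pair2[OF score_measurable s] by simp
  have jm: "(\<lambda>a. joint_pol \<theta> s a) \<in> borel_measurable (joint_ref G)"
    using measurable_Pair2[OF joint_pol_measurable s] by simp
  have fm: "(\<lambda>a. ennreal ((norm (score G i n \<theta> s a))\<^sup>2)) \<in> borel_measurable (act_ref G)" for i n
    using sm by measurable
  have fm': "(\<lambda>a. ennreal ((norm (score G i n \<theta> s (a n)))\<^sup>2)) \<in> borel_measurable (joint_ref G)" for i n
    by (rule measurable_compose[OF component_measurable fm])
  have sq: "(norm (joint_score \<theta> s a))\<^sup>2 \<le> (\<Sum>(n, i)\<in>UNIV. ?N\<^sup>2 * (norm (score G i n \<theta> s (a n)))\<^sup>2)" for a
  proof -
    have "norm (joint_score \<theta> s a) \<le> (\<Sum>(n, i)\<in>UNIV. norm (score G i n \<theta> s (a n)))"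
      unfolding joint_score_def policy_score_def sum.cartesian_product UNIV_Times_UNIV
      by (rule order_trans[OF norm_sum]) (simp add: case_prod_unfold)
    then have "(norm (joint_score \<theta> s a))\<^sup>2 \<le> (\<Sum>p\<in>(UNIV::('n\<times>'n) set). norm (score G (snd p) (fst p) \<theta> s (a (fst p))))\<^sup>2"
      by (intro power_mono) (auto simp: case_prod_unfold)
    also have "\<dots> \<le> (\<Sum>p\<in>(UNIV::('n\<times>'n) set). (norm (score G (snd p) (fst p) \<theta> s (a (fst p))))\<^sup>2) * real (card (UNIV::('n\<times>'n) set))"
      by (rule sum_squared_le_sum_of_squares)
    finally show ?thesis
      by (simp add: case_prod_unfold sum_distrib_left[symmetric] mult.commute power2_eq_square card_prod)
  qed
  have "(\<integral>\<^sup>+a. ennreal (joint_pol \<theta> s a) * ennreal ((norm (joint_score \<theta> s a))\<^sup>2) \<partial>joint_ref G)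
    \<le> (\<integral>\<^sup>+a. (\<Sum>p\<in>UNIV. ennreal (?N\<^sup>2) * (ennreal (joint_pol \<theta> s a) * ennreal ((norm (score G (snd p) (fst p) \<theta> s (a (fst p))))\<^sup>2))) \<partial>joint_ref G)"
  proof (rule nn_integral_mono)
    fix a
    have "ennreal ((norm (joint_score \<theta> s a))\<^sup>2) \<le> (\<Sum>p\<in>UNIV. ennreal (?N\<^sup>2) * ennreal ((norm (score G (snd p) (fst p) \<theta> s (a (fst p))))\<^sup>2))"
      using ennreal_leI[OF sq[of a]] by (simp add: case_prod_unfold ennreal_mult[symmetric] sum_ennreal)
    from mult_left_mono[OF this, of "ennreal (joint_pol \<theta> s a)"]
    show "ennreal (joint_pol \<theta> s a) * ennreal ((norm (joint_score \<theta> s a))\<^sup>2) \<le>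
      (\<Sum>p\<in>UNIV. ennreal (?N\<^sup>2) * (ennreal (joint_pol \<theta> s a) * ennreal ((norm (score G (snd p) (fst p) \<theta> s (a (fst p))))\<^sup>2)))"
      by (simp add: sum_distrib_left mult_ac)
  qed
  also have "\<dots> = (\<Sum>p\<in>UNIV. ennreal (?N\<^sup>2) * (\<integral>\<^sup>+a. ennreal (joint_pol \<theta> s a) * ennreal ((norm (score G (snd p) (fst p) \<theta> s (a (fst p))))\<^sup>2) \<partial>joint_ref G))"
    using jm fm' by (subst nn_integral_sum) (auto intro!: sum.cong nn_integral_cmult)
  also have "\<dots> = (\<Sum>p\<in>UNIV. ennreal (?N\<^sup>2) * (\<integral>\<^sup>+a. ennreal ((norm (score G (snd p) (fst p) \<theta> s a))\<^sup>2) \<partial>policy G (fst p) \<theta> s))"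
    unfolding policy_def using pm fm
    by (intro sum.cong refl arg_cong2[where f=times])
       (simp add: nn_integral_density nn_integral_joint_policy_component[OF s fm])
  also have "\<dots> \<le> (\<Sum>p\<in>(UNIV::('n\<times>'n) set). ennreal (?N\<^sup>2) * ennreal (V\<^sup>2))"
    by (intro sum_mono mult_left_mono score_second_moment[OF s]) auto
  also have "\<dots> = ennreal (\<Sum>p\<in>(UNIV::('n\<times>'n) set). ?N\<^sup>2 * V\<^sup>2)"
    by (subst sum_ennreal[symmetric]) (simp_all only: ennreal_mult zero_le_power2 mult_nonneg_nonneg)
  also have "(\<Sum>p\<in>(UNIV::('n\<times>'n) set). ?N\<^sup>2 * V\<^sup>2) = ?N ^ 4 * V\<^sup>2"
    by (simp add: eval_nat_numeral)
  finally show ?thesis .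
qed

lemma
  assumes s: "s \<in> space (states G)"
  shows integrable_joint_pol: "integrable (joint_ref G) (joint_pol \<theta> s)"
    and integrable_score_weight: "integrable (joint_ref G) (score_weight \<theta> s)"
    and integral_score_weight: "integral\<^sup>L (joint_ref G) (score_weight \<theta> s) \<le> score_weight_mass"
proof -
  have jm[measurable]: "joint_pol \<theta> s \<in> borel_measurable (joint_ref G)"
    using measurable_Pair2[OF joint_pol_measurable s] by simp
  have sm[measurable]: "joint_score \<theta> s \<in> borel_measurable (joint_ref G)"
    using measurable_Pair2[OF joint_score_measurable s] by simp
  have um: "score_weight \<theta> s \<in> borel_measurable (joint_ref G)" unfolding score_weight_def[abs_def] by measurable
  have pn: "AE a in joint_ref G. 0 \<le> joint_pol \<theta> s a" using joint_pol_nonneg[OF s] by (rule AE_I2)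
  show i: "integrable (joint_ref G) (joint_pol \<theta> s)"
    by (rule integrableI_nonneg[OF jm pn]) (simp add: joint_pol_integral[OF s])
  let ?c = "2 * score_lip\<^sup>2 + score_lip + 1"
  have c: "0 \<le> ?c" using score_lip_nonneg by simp
  have un: "AE a in joint_ref G. 0 \<le> score_weight \<theta> s a" using score_weight_bounds(1)[OF s] by (rule AE_I2)
  have "(\<integral>\<^sup>+a. ennreal (score_weight \<theta> s a) \<partial>joint_ref G) =
      (\<integral>\<^sup>+a. 2 * (ennreal (joint_pol \<theta> s a) * ennreal ((norm (joint_score \<theta> s a))\<^sup>2)) + ennreal ?c * ennreal (joint_pol \<theta> s a) \<partial>joint_ref G)"
  proof (rule nn_integral_cong)
    fix a assume "a \<in> space (joint_ref G)"
    then have p: "0 \<le> joint_pol \<theta> s a" by (rule joint_pol_nonneg[OF s])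
    have "score_weight \<theta> s a = 2 * (joint_pol \<theta> s a * (norm (joint_score \<theta> s a))\<^sup>2) + ?c * joint_pol \<theta> s a"
      by (simp add: score_weight_def algebra_simps)
    then show "ennreal (score_weight \<theta> s a) = 2 * (ennreal (joint_pol \<theta> s a) * ennreal ((norm (joint_score \<theta> s a))\<^sup>2)) + ennreal ?c * ennreal (joint_pol \<theta> s a)"
      using p c by (simp only: ennreal_plus ennreal_mult' ennreal_mult ennreal_numeral mult_nonneg_nonneg zero_le_power2 zero_le_numeral)
  qed
  also have "\<dots> = 2 * (\<integral>\<^sup>+a. ennreal (joint_pol \<theta> s a) * ennreal ((norm (joint_score \<theta> s a))\<^sup>2) \<partial>joint_ref G) + ennreal ?c * (\<integral>\<^sup>+a. ennreal (joint_pol \<theta> s a) \<partial>joint_ref G)"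
    by (subst nn_integral_add) (simp_all add: nn_integral_cmult)
  also have "\<dots> \<le> 2 * ennreal ((real CARD('n)) ^ 4 * V\<^sup>2) + ennreal ?c * 1"
    unfolding joint_pol_integral[OF s]
    by (intro add_mono mult_left_mono nn_integral_joint_score_sq[OF s]) auto
  also have "\<dots> = ennreal score_weight_mass"
    unfolding score_weight_mass_def using c by (simp only: ennreal_plus ennreal_mult ennreal_numeral mult_nonneg_nonneg zero_le_power2 zero_le_power zero_le_numeral of_nat_0_le_iff mult_1_right)
  finally have b: "(\<integral>\<^sup>+a. ennreal (score_weight \<theta> s a) \<partial>joint_ref G) \<le> ennreal score_weight_mass" .
  show iu: "integrable (joint_ref G) (score_weight \<theta> s)"
    by (rule integrableI_nonneg[OF um un]) (rule le_less_trans[OF b], simp)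
  show "integral\<^sup>L (joint_ref G) (score_weight \<theta> s) \<le> score_weight_mass"
    by (subst integral_eq_nn_integral[OF um un], rule enn2real_leI) (use b score_weight_mass_ge_1 in auto)
qed

end

lemma sums_abs_le_geometric:
  fixes a :: "nat \<Rightarrow> real"
  assumes "a sums l" and "\<And>t. \<bar>a t\<bar> \<le> \<gamma> ^ t * c" and "0 < \<gamma>" "\<gamma> < 1"
  shows "\<bar>l\<bar> \<le> c / (1 - \<gamma>)"
proof -
  have sg: "(\<lambda>t. \<gamma> ^ t * c) sums (1 / (1 - \<gamma>) * c)"
    using assms by (intro sums_mult2 geometric_sums) auto
  have sa: "summable (\<lambda>t. \<bar>a t\<bar>)"
    by (rule summable_comparison_test'[OF sums_summable[OF sg], of 0]) (use assms(2) in auto)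
  have "\<bar>l\<bar> = \<bar>suminf a\<bar>" using assms(1) by (simp add: sums_iff)
  also have "\<dots> \<le> (\<Sum>t. \<bar>a t\<bar>)" by (rule summable_rabs[OF sa])
  also have "\<dots> \<le> (\<Sum>t. \<gamma> ^ t * c)" by (rule suminf_le[OF assms(2) sa sums_summable[OF sg]])
  also have "\<dots> = c / (1 - \<gamma>)" using sg by (simp add: sums_iff)
  finally show ?thesis .
qed

section \<open>First-order expansion of action averages and of the utilities\<close>

context smooth_markov_game
begin

definition jscore :: "real ^ 'm \<Rightarrow> 's \<times> ('n \<Rightarrow> real ^ 'k) \<Rightarrow> real ^ 'm" where
  "jscore \<theta> x = joint_score \<theta> (fst x) (snd x)"

lemma jscore_measurable [measurable]: "jscore \<theta> \<in> borel_measurable SA"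
  using joint_score_measurable by (simp add: jscore_def[abs_def] case_prod_unfold)

lemma Pair_measurable: "s \<in> space (states G) \<Longrightarrow> (\<lambda>a. (s, a)) \<in> joint_ref G \<rightarrow>\<^sub>M SA"
  by (rule measurable_Pair1')

lemma joint_pol_measurable': "s \<in> space (states G) \<Longrightarrow> joint_pol \<theta> s \<in> borel_measurable (joint_ref G)"
  using measurable_Pair2[OF joint_pol_measurable] by simp

lemma act_avg_density:
  assumes s: "s \<in> space (states G)" and f: "f \<in> borel_measurable SA"
  shows "act_avg \<theta> f s = (\<integral>a. joint_pol \<theta> s a * f (s, a) \<partial>joint_ref G)"
proof -
  have p: "(\<lambda>a. (s, a)) \<in> joint_policy G \<theta> s \<rightarrow>\<^sub>M SA"
    using Pair_measurable[OF s] by (simp add: joint_policy_density)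
  have fm: "(\<lambda>a. f (s, a)) \<in> borel_measurable (joint_ref G)"
    by (rule measurable_compose[OF Pair_measurable[OF s] f])
  have "act_avg \<theta> f s = (\<integral>a. f (s, a) \<partial>joint_policy G \<theta> s)"
    unfolding act_avg_def draw_action_def by (rule integral_distr[OF p f])
  also have "\<dots> = (\<integral>a. joint_pol \<theta> s a *\<^sub>R f (s, a) \<partial>joint_ref G)"
    unfolding joint_policy_density
    by (rule integral_density[OF fm joint_pol_measurable'[OF s]]) (rule AE_I2[OF joint_pol_nonneg[OF s]])
  finally show ?thesis by simp
qed

lemma draw_action_nn_integral:
  assumes s: "s \<in> space (states G)" and f: "f \<in> borel_measurable SA"
  shows "(\<integral>\<^sup>+x. f x \<partial>draw_action G \<theta> s) = (\<integral>\<^sup>+a. ennreal (joint_pol \<theta> s a) * f (s, a) \<partial>joint_ref G)"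
proof -
  have p: "(\<lambda>a. (s, a)) \<in> joint_policy G \<theta> s \<rightarrow>\<^sub>M SA"
    using Pair_measurable[OF s] by (simp add: joint_policy_density)
  have fm: "(\<lambda>a. f (s, a)) \<in> borel_measurable (joint_ref G)"
    by (rule measurable_compose[OF Pair_measurable[OF s] f])
  have "(\<integral>\<^sup>+x. f x \<partial>draw_action G \<theta> s) = (\<integral>\<^sup>+a. f (s, a) \<partial>joint_policy G \<theta> s)"
    unfolding draw_action_def by (rule nn_integral_distr[OF p]) (use f in simp)
  also have "\<dots> = (\<integral>\<^sup>+a. ennreal (joint_pol \<theta> s a) * f (s, a) \<partial>joint_ref G)"
    unfolding joint_policy_density
    by (rule nn_integral_density[OF _ fm]) (rule measurable_compose[OF joint_pol_measurable'[OF s] measurable_ennreal])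
  finally show ?thesis .
qed

lemma bounded_fun_section:
  assumes s: "s \<in> space (states G)" and f: "bounded_fun SA C f"
  shows "bounded_fun (joint_ref G) C (\<lambda>a. f (s, a))"
  by (rule bounded_fun_compose[OF f Pair_measurable[OF s]])

text \<open>Two parameters appear because the expansion remainder is split between the density at
  the base point and the density at the displaced point.\<close>

lemma integrable_dominated_by_score_weight:
  assumes s: "s \<in> space (states G)" and f: "f \<in> borel_measurable (joint_ref G)"
    and b: "\<And>a. a \<in> space (joint_ref G) \<Longrightarrow> \<bar>f a\<bar> \<le> c * (score_weight \<theta> s a + score_weight \<theta>' s a)"
  shows "integrable (joint_ref G) f" and "0 \<le> c \<Longrightarrow> \<bar>\<integral>a. f a \<partial>joint_ref G\<bar> \<le> 2 * c * score_weight_mass"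
proof -
  have iu: "integrable (joint_ref G) (\<lambda>a. c * (score_weight \<theta> s a + score_weight \<theta>' s a))"
    by (intro integrable_mult_right Bochner_Integration.integrable_add integrable_score_weight[OF s])
  show i: "integrable (joint_ref G) f"
  proof (rule Bochner_Integration.integrable_bound[OF iu f], rule AE_I2)
    fix a assume "a \<in> space (joint_ref G)"
    from b[OF this] show "norm (f a) \<le> norm (c * (score_weight \<theta> s a + score_weight \<theta>' s a))" unfolding real_norm_def by linarith
  qed
  assume c: "0 \<le> c"
  have "\<bar>\<integral>a. f a \<partial>joint_ref G\<bar> \<le> (\<integral>a. \<bar>f a\<bar> \<partial>joint_ref G)" by (rule integral_abs_bound)
  also have "\<dots> \<le> (\<integral>a. c * (score_weight \<theta> s a + score_weight \<theta>' s a) \<partial>joint_ref G)"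
    by (rule integral_mono[OF integrable_abs[OF i] iu b])
  also have "\<dots> = c * (integral\<^sup>L (joint_ref G) (score_weight \<theta> s) + integral\<^sup>L (joint_ref G) (score_weight \<theta>' s))"
    by (simp only: integral_mult_right_zero Bochner_Integration.integral_add[OF integrable_score_weight[OF s] integrable_score_weight[OF s]])
  also have "\<dots> \<le> c * (score_weight_mass + score_weight_mass)" using c integral_score_weight[OF s] by (intro mult_left_mono add_mono) auto
  finally show "\<bar>\<integral>a. f a \<partial>joint_ref G\<bar> \<le> 2 * c * score_weight_mass" by simp
qed

lemma section_measurable:
  assumes s: "s \<in> space (states G)" and f: "bounded_fun SA C f"
  shows "(\<lambda>a. f (s, a)) \<in> borel_measurable (joint_ref G)" "joint_score \<theta> s \<in> borel_measurable (joint_ref G)"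
  using bounded_fun_section[OF assms] measurable_Pair2[OF joint_score_measurable s, of \<theta>]
  by (auto simp: bounded_fun_def)

lemma score_weighted:
  assumes s: "s \<in> space (states G)" and f: "bounded_fun SA C f" and C: "0 \<le> C"
  shows "act_avg \<theta> (\<lambda>x. (d \<bullet> jscore \<theta> x) * f x) s
      = (\<integral>a. joint_pol \<theta> s a * ((d \<bullet> joint_score \<theta> s a) * f (s, a)) \<partial>joint_ref G)"
    and "integrable (joint_ref G) (\<lambda>a. joint_pol \<theta> s a * ((d \<bullet> joint_score \<theta> s a) * f (s, a)))"
    and "\<bar>act_avg \<theta> (\<lambda>x. (d \<bullet> jscore \<theta> x) * f x) s\<bar> \<le> norm d * C * score_weight_mass"
proof -
  note [measurable] = section_measurable[OF s f] joint_pol_measurable'[OF s]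
  have fm[measurable]: "f \<in> borel_measurable SA" using f by (simp add: bounded_fun_def)
  show e: "act_avg \<theta> (\<lambda>x. (d \<bullet> jscore \<theta> x) * f x) s
      = (\<integral>a. joint_pol \<theta> s a * ((d \<bullet> joint_score \<theta> s a) * f (s, a)) \<partial>joint_ref G)"
    by (subst act_avg_density[OF s]) (simp_all add: jscore_def)
  have m: "(\<lambda>a. joint_pol \<theta> s a * ((d \<bullet> joint_score \<theta> s a) * f (s, a))) \<in> borel_measurable (joint_ref G)"
    by measurable
  \<comment> \<open>Half of the constant, because the domination lemma carries two copies of the
    weight.\<close>
  have b: "\<bar>joint_pol \<theta> s a * ((d \<bullet> joint_score \<theta> s a) * f (s, a))\<bar> \<le> (norm d * C / 2) * (score_weight \<theta> s a + score_weight \<theta> s a)"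
    if a: "a \<in> space (joint_ref G)" for a
  proof -
    note p = joint_pol_nonneg[OF s a, of \<theta>]
    have "\<bar>f (s, a)\<bar> \<le> C" using bounded_fun_section[OF s f] a unfolding bounded_fun_def by blast
    then have "\<bar>joint_pol \<theta> s a * ((d \<bullet> joint_score \<theta> s a) * f (s, a))\<bar> \<le> joint_pol \<theta> s a * ((norm d * norm (joint_score \<theta> s a)) * C)"
      unfolding abs_mult abs_of_nonneg[OF p] using p Cauchy_Schwarz_ineq2
      by (intro mult_left_mono mult_mono) auto
    also have "\<dots> = (norm d * C) * (joint_pol \<theta> s a * norm (joint_score \<theta> s a))" by simp
    also have "\<dots> \<le> (norm d * C) * score_weight \<theta> s a" using C by (intro mult_left_mono score_weight_bounds(2)[OF s a]) auto
    finally show ?thesis by simp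
  qed
  show "integrable (joint_ref G) (\<lambda>a. joint_pol \<theta> s a * ((d \<bullet> joint_score \<theta> s a) * f (s, a)))"
    by (rule integrable_dominated_by_score_weight(1)[OF s m b])
  show "\<bar>act_avg \<theta> (\<lambda>x. (d \<bullet> jscore \<theta> x) * f x) s\<bar> \<le> norm d * C * score_weight_mass"
    unfolding e using integrable_dominated_by_score_weight(2)[OF s m b] C by simp
qed

text \<open>The pointwise expansion of the density is multiplied by the bounded \<open>f\<close> and
  integrated; nothing is differentiated under the integral.\<close>

lemma act_avg_expansion:
  assumes s: "s \<in> space (states G)" and f: "bounded_fun SA C f" and C: "0 \<le> C" and d: "norm (\<theta>' - \<theta>) \<le> 1"
  shows "\<bar>act_avg \<theta>' f s - act_avg \<theta> f s - act_avg \<theta> (\<lambda>x. ((\<theta>' - \<theta>) \<bullet> jscore \<theta> x) * f x) s\<bar>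
    \<le> 2 * ((norm (\<theta>' - \<theta>))\<^sup>2 * C) * score_weight_mass"
proof -
  note [measurable] = section_measurable[OF s f] joint_pol_measurable'[OF s]
  have fm: "f \<in> borel_measurable SA" using f by (simp add: bounded_fun_def)
  have fb: "\<bar>f (s, a)\<bar> \<le> C" if "a \<in> space (joint_ref G)" for a
    using bounded_fun_section[OF s f] that unfolding bounded_fun_def by blast
  have ip: "integrable (joint_ref G) (\<lambda>a. joint_pol \<theta> s a * f (s, a))" for \<theta>
  proof (rule Bochner_Integration.integrable_bound[OF integrable_mult_left[OF integrable_joint_pol[OF s]]])
    show "AE a in joint_ref G. norm (joint_pol \<theta> s a * f (s, a)) \<le> norm (joint_pol \<theta> s a * C)"
      using fb C by (intro AE_I2) (auto simp: abs_mult intro!: mult_left_mono)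
  qed measurable
  let ?d = "\<theta>' - \<theta>"
  let ?g = "\<lambda>a. (joint_pol \<theta>' s a - joint_pol \<theta> s a - joint_pol \<theta> s a * (?d \<bullet> joint_score \<theta> s a)) * f (s, a)"
  have "act_avg \<theta>' f s - act_avg \<theta> f s - act_avg \<theta> (\<lambda>x. (?d \<bullet> jscore \<theta> x) * f x) s =
     (\<integral>a. joint_pol \<theta>' s a * f (s, a) - joint_pol \<theta> s a * f (s, a) - joint_pol \<theta> s a * ((?d \<bullet> joint_score \<theta> s a) * f (s, a)) \<partial>joint_ref G)"
    unfolding act_avg_density[OF s fm] score_weighted(1)[OF s f C]
    by (simp only: Bochner_Integration.integral_diff[OF Bochner_Integration.integrable_diff[OF ip ip] score_weighted(2)[OF s f C]]
        Bochner_Integration.integral_diff[OF ip ip])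
  also have "\<dots> = (\<integral>a. ?g a \<partial>joint_ref G)"
    by (rule Bochner_Integration.integral_cong[OF refl]) (simp add: algebra_simps)
  also have "\<bar>\<dots>\<bar> \<le> 2 * ((norm ?d)\<^sup>2 * C) * score_weight_mass"
  proof (rule integrable_dominated_by_score_weight(2)[OF s])
    show "?g \<in> borel_measurable (joint_ref G)" by measurable
    fix a assume a: "a \<in> space (joint_ref G)"
    have "\<bar>?g a\<bar> \<le> ((norm ?d)\<^sup>2 * (score_weight \<theta> s a + score_weight \<theta>' s a)) * C"
      unfolding abs_mult using score_weight_bounds(1)[OF s a]
      by (intro mult_mono joint_pol_expansion[OF s a d] fb[OF a]) auto
    then show "\<bar>?g a\<bar> \<le> (norm ?d)\<^sup>2 * C * (score_weight \<theta> s a + score_weight \<theta>' s a)" by (simp add: mult_ac)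
  qed (use C in simp)
  finally show ?thesis .
qed

text \<open>For displacements of at most one the quadratic remainder is also linearly bounded; it
  contributes two of the three units, the first-order term the third.\<close>

lemma act_avg_Lipschitz:
  assumes s: "s \<in> space (states G)" and f: "bounded_fun SA C f" and C: "0 \<le> C" and d: "norm (\<theta>' - \<theta>) \<le> 1"
  shows "\<bar>act_avg \<theta>' f s - act_avg \<theta> f s\<bar> \<le> 3 * score_weight_mass * C * norm (\<theta>' - \<theta>)"
proof -
  let ?n = "norm (\<theta>' - \<theta>)"
  have "?n\<^sup>2 \<le> ?n" using d by (simp add: power2_eq_square mult_left_le)
  then have "2 * (?n\<^sup>2 * C) * score_weight_mass \<le> 2 * (?n * C) * score_weight_mass" using C score_weight_mass_ge_1 by (intro mult_right_mono mult_left_mono) auto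
  moreover have "\<bar>act_avg \<theta> (\<lambda>x. ((\<theta>' - \<theta>) \<bullet> jscore \<theta> x) * f x) s\<bar> \<le> ?n * C * score_weight_mass"
    by (rule score_weighted(3)[OF s f C])
  moreover note act_avg_expansion[OF s f C d]
  moreover have "3 * score_weight_mass * C * ?n = 2 * (?n * C) * score_weight_mass + ?n * C * score_weight_mass" by (simp add: algebra_simps)
  ultimately show ?thesis by linarith
qed

text \<open>The mean of the score vanishes because total mass is constant, so its first-order variation is zero.\<close>

lemma act_avg_score_zero:
  assumes s: "s \<in> space (states G)"
  shows "act_avg \<theta> (\<lambda>x. d \<bullet> jscore \<theta> x) s = 0"
proof -
  have one: "bounded_fun SA 1 (\<lambda>_. 1)" by (simp add: bounded_fun_def)
  have a1: "act_avg \<theta> (\<lambda>_. 1) s = 1" for \<theta>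
    using prob_space.prob_space[of "draw_action G \<theta> s"] draw_action_in_space[OF s] by (simp add: act_avg_def space_prob_algebra)
  let ?c = "act_avg \<theta> (\<lambda>x. d \<bullet> jscore \<theta> x) s"
  have "\<bar>?c\<bar> \<le> e" if e: "0 < e" for e
  proof -
    define M where "M = 2 * score_weight_mass * (norm d)\<^sup>2 + norm d + 1"
    have M: "0 < M" using score_weight_mass_ge_1 by (simp add: M_def add_nonneg_pos)
    \<comment> \<open>\<open>M\<close> dominates both \<open>norm d\<close> and the coefficient of
      the quadratic remainder, so this single choice makes the displacement admissible and the
      remainder at most \<open>h * e\<close>.\<close>
    define h where "h = min (1 / M) (e / M)"
    have h: "0 < h" using e M by (simp add: h_def)
    have "norm d \<le> M" using score_weight_mass_ge_1 by (simp add: M_def)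
    then have "h * norm d \<le> (1 / M) * M" using h M by (intro mult_mono) (auto simp: h_def)
    then have hd: "norm ((\<theta> + h *\<^sub>R d) - \<theta>) \<le> 1" using M h by simp
    have hs: "act_avg \<theta> (\<lambda>x. (h *\<^sub>R d) \<bullet> jscore \<theta> x * 1) s = h * ?c"
      by (simp add: act_avg_def)
    have "\<bar>h * ?c\<bar> \<le> 2 * ((norm (h *\<^sub>R d))\<^sup>2 * 1) * score_weight_mass"
      using act_avg_expansion[OF s one _ hd] hs by (simp add: a1)
    also have "\<dots> = h * (h * (2 * score_weight_mass * (norm d)\<^sup>2))" by (simp add: power_mult_distrib power2_eq_square)
    also have "\<dots> \<le> h * (h * M)" using h by (intro mult_left_mono) (auto simp: M_def)
    also have "\<dots> \<le> h * e" using h M by (intro mult_left_mono) (auto simp: h_def min_def field_simps)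
    finally show ?thesis using h by (simp add: abs_mult)
  qed
  then have "\<bar>?c\<bar> \<le> 0" by (rule field_le_epsilon) simp_all
  then show ?thesis by simp
qed

definition "score_bound = (real CARD('n)) ^ 4 * V\<^sup>2"

lemma score_bound_nonneg: "0 \<le> score_bound" by (simp add: score_bound_def)

lemma traj_score_second_moment:
  assumes s: "s \<in> space (states G)"
  shows "(\<integral>\<^sup>+\<omega>. ennreal ((norm (jscore \<theta> (\<omega> t)))\<^sup>2) \<partial>traj G \<theta> s) \<le> ennreal score_bound"
proof -
  interpret tr: prob_space "traj G \<theta> s" by (rule prob_space_traj[OF s])
  have m: "(\<lambda>x. ennreal ((norm (jscore \<theta> x))\<^sup>2)) \<in> borel_measurable SA" by measurable
  have "(\<integral>\<^sup>+\<omega>. ennreal ((norm (jscore \<theta> (\<omega> t)))\<^sup>2) \<partial>traj G \<theta> s) =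
     (\<integral>\<^sup>+\<omega>. (\<integral>\<^sup>+x. ennreal ((norm (jscore \<theta> x))\<^sup>2) \<partial>draw_action G \<theta> (fst (\<omega> t))) \<partial>traj G \<theta> s)"
    by (rule traj_nn_integral_act_avg[OF s m])
  also have "\<dots> \<le> (\<integral>\<^sup>+\<omega>. ennreal score_bound \<partial>traj G \<theta> s)"
  proof (rule nn_integral_mono)
    fix \<omega> assume "\<omega> \<in> space (traj G \<theta> s)"
    then have "\<omega> t \<in> space SA" by (rule measurable_space[OF path_component_traj_measurable[OF s]])
    then have w: "fst (\<omega> t) \<in> space (states G)" by (auto simp: space_pair_measure)
    show "(\<integral>\<^sup>+x. ennreal ((norm (jscore \<theta> x))\<^sup>2) \<partial>draw_action G \<theta> (fst (\<omega> t))) \<le> ennreal score_bound"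
      unfolding draw_action_nn_integral[OF w m] score_bound_def
      using nn_integral_joint_score_sq[OF w] by (simp add: jscore_def)
  qed
  also have "\<dots> = ennreal score_bound" by (simp add: tr.emeasure_space_1)
  finally show ?thesis .
qed

lemma integrable_traj_score:
  assumes s: "s \<in> space (states G)"
  shows "integrable (traj G \<theta> s) (\<lambda>\<omega>. (norm (jscore \<theta> (\<omega> t)))\<^sup>2)"
    and "integrable (traj G \<theta> s) (\<lambda>\<omega>. d \<bullet> jscore \<theta> (\<omega> t))"
    and "bounded_fun paths C f \<Longrightarrow> integrable (traj G \<theta> s) (\<lambda>\<omega>. (d \<bullet> jscore \<theta> (\<omega> t)) * f \<omega>)"
proof -
  interpret tr: prob_space "traj G \<theta> s" by (rule prob_space_traj[OF s])
  have jm[measurable]: "(\<lambda>\<omega>. jscore \<theta> (\<omega> t)) \<in> borel_measurable (traj G \<theta> s)"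
    by (rule measurable_compose[OF path_component_traj_measurable[OF s] jscore_measurable])
  show sq: "integrable (traj G \<theta> s) (\<lambda>\<omega>. (norm (jscore \<theta> (\<omega> t)))\<^sup>2)"
    by (rule integrableI_nonneg) (use le_less_trans[OF traj_score_second_moment[OF s]] in auto)
  then have dom: "integrable (traj G \<theta> s) (\<lambda>\<omega>. norm d * (1 + (norm (jscore \<theta> (\<omega> t)))\<^sup>2))"
    by (intro integrable_mult_right Bochner_Integration.integrable_add) simp_all
  have b: "\<bar>d \<bullet> v\<bar> \<le> norm d * (1 + (norm v)\<^sup>2)" for v :: "real ^ 'm"
  proof -
    show ?thesis
      using Cauchy_Schwarz_ineq2[of d v] mult_left_mono[OF le_one_plus_square[of "norm v"], of "norm d"] by simp
  qed
  show i: "integrable (traj G \<theta> s) (\<lambda>\<omega>. d \<bullet> jscore \<theta> (\<omega> t))"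
  proof (rule Bochner_Integration.integrable_bound[OF dom])
    show "AE \<omega> in traj G \<theta> s. norm (d \<bullet> jscore \<theta> (\<omega> t)) \<le> norm (norm d * (1 + (norm (jscore \<theta> (\<omega> t)))\<^sup>2))"
      using b by (intro AE_I2) (simp add: abs_mult)
  qed measurable
  assume f: "bounded_fun paths C f"
  then have fm[measurable]: "f \<in> borel_measurable (traj G \<theta> s)"
    using measurable_cong_sets[OF sets_traj[OF s] refl] by (auto simp: bounded_fun_def)
  show "integrable (traj G \<theta> s) (\<lambda>\<omega>. (d \<bullet> jscore \<theta> (\<omega> t)) * f \<omega>)"
  proof (rule Bochner_Integration.integrable_bound[OF integrable_mult_left[OF i, of C]])
    have "\<bar>f \<omega>\<bar> \<le> \<bar>C\<bar>" if "\<omega> \<in> space (traj G \<theta> s)" for \<omega>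
    proof -
      have "\<bar>f \<omega>\<bar> \<le> C" using f that sets_eq_imp_space_eq[OF sets_traj[OF s]] by (simp add: bounded_fun_def)
      then show ?thesis by linarith
    qed
    then show "AE \<omega> in traj G \<theta> s. norm ((d \<bullet> jscore \<theta> (\<omega> t)) * f \<omega>) \<le> norm ((d \<bullet> jscore \<theta> (\<omega> t)) * C)"
      by (intro AE_I2) (simp add: abs_mult mult_left_mono)
  qed measurable
qed

definition value_bound :: real where "value_bound = R / (1 - \<gamma>)"

lemma one_minus_disc_pos: "0 < 1 - \<gamma>" by simp

lemma value_bound_nonneg: "0 \<le> value_bound"
  unfolding value_bound_def by (rule divide_nonneg_pos[OF less_imp_le[OF R_pos] one_minus_disc_pos])

lemmas bounded_fun_Qval' = bounded_fun_Qval[folded value_bound_def]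

text \<open>The policy gradient formula, taken as a definition coordinate by coordinate. That it is
  the derivative of the utility comes out of the quadratic expansion afterwards.\<close>

definition value_grad :: "'n \<Rightarrow> real ^ 'm \<Rightarrow> real ^ 'm" where
  "value_grad i \<theta> = (\<chi> m. \<Sum>t. \<gamma> ^ t * (\<integral>\<omega>. jscore \<theta> (\<omega> t) $ m * Qval \<theta> i (\<omega> t) \<partial>traj G \<theta> (init G)))"

text \<open>The contribution of time \<open>t\<close> to the derivative in direction
  \<open>d\<close>; being linear in \<open>d\<close>, it is determined by the axis vectors that
  enter \<open>value_grad\<close>.\<close>

definition score_Q where
  "score_Q i \<theta> t d = (\<integral>\<omega>. (d \<bullet> jscore \<theta> (\<omega> t)) * Qval \<theta> i (\<omega> t) \<partial>traj G \<theta> (init G))"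

lemma score_Q_act_avg:
  "score_Q i \<theta> t d = (\<integral>\<omega>. act_avg \<theta> (\<lambda>x. (d \<bullet> jscore \<theta> x) * Qval \<theta> i x) (fst (\<omega> t)) \<partial>traj G \<theta> (init G))"
  unfolding score_Q_def
proof (rule traj_integral_act_avg[OF init_space])
  have [measurable]: "Qval \<theta> i \<in> borel_measurable SA" using bounded_fun_Qval by (simp add: bounded_fun_def)
  show "(\<lambda>x. (d \<bullet> jscore \<theta> x) * Qval \<theta> i x) \<in> borel_measurable SA" by measurable
  show "integrable (traj G \<theta> (init G)) (\<lambda>\<omega>. (d \<bullet> jscore \<theta> (\<omega> t)) * Qval \<theta> i (\<omega> t))"
    by (rule integrable_traj_score(3)[OF init_space bounded_fun_compose[OF bounded_fun_Qval path_component_measurable]])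
qed

lemma bounded_fun_act_avg_score:
  assumes f: "bounded_fun SA C f" and C: "0 \<le> C"
  shows "bounded_fun (states G) (norm d * C * score_weight_mass) (act_avg \<theta> (\<lambda>x. (d \<bullet> jscore \<theta> x) * f x))"
proof -
  have [measurable]: "f \<in> borel_measurable SA" using f by (simp add: bounded_fun_def)
  have "(\<lambda>x. (d \<bullet> jscore \<theta> x) * f x) \<in> borel_measurable SA" by measurable
  from measurable_compose[OF draw_action_measurable[THEN measurable_prob_algebraD] integral_measurable_subprob_algebra[OF this]]
  show ?thesis
    using score_weighted(3)[OF _ f C] by (simp add: bounded_fun_def act_avg_def[abs_def])
qed

lemma fst_path_measurable: "(\<lambda>\<omega>. fst (\<omega> t)) \<in> paths \<rightarrow>\<^sub>M states G"
  by (rule measurable_compose[OF path_component_measurable measurable_fst])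

lemma score_Q_bound: "\<bar>score_Q i \<theta> t d\<bar> \<le> norm d * value_bound * score_weight_mass"
  unfolding score_Q_act_avg
  by (rule bounded_fun_integrable(2)[OF bounded_fun_compose[OF bounded_fun_act_avg_score[OF bounded_fun_Qval' value_bound_nonneg] fst_path_measurable]
      traj_in_space[OF init_space]])

lemma score_Q_summable: "summable (\<lambda>t. \<gamma> ^ t * score_Q i \<theta> t d)"
proof (rule summable_comparison_test'[of "\<lambda>t. \<gamma> ^ t * (norm d * value_bound * score_weight_mass)" 0])
  show "summable (\<lambda>t. \<gamma> ^ t * (norm d * value_bound * score_weight_mass))"
    by (intro summable_mult2 summable_geometric) (simp add: abs_of_pos)
  show "norm (\<gamma> ^ t * score_Q i \<theta> t d) \<le> \<gamma> ^ t * (norm d * value_bound * score_weight_mass)" for t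
    unfolding real_norm_def abs_mult power_abs abs_of_pos[OF disc_pos]
    by (rule mult_left_mono[OF score_Q_bound]) (simp add: less_imp_le)
qed

lemma score_Q_axis: "score_Q i \<theta> t (axis m 1) = (\<integral>\<omega>. jscore \<theta> (\<omega> t) $ m * Qval \<theta> i (\<omega> t) \<partial>traj G \<theta> (init G))"
  by (simp add: score_Q_def inner_axis')

lemma score_Q_sum: "score_Q i \<theta> t d = (\<Sum>m\<in>UNIV. d $ m * score_Q i \<theta> t (axis m 1))"
proof -
  have "score_Q i \<theta> t d = (\<integral>\<omega>. (\<Sum>m\<in>UNIV. d $ m * ((axis m 1 \<bullet> jscore \<theta> (\<omega> t)) * Qval \<theta> i (\<omega> t))) \<partial>traj G \<theta> (init G))"
    unfolding score_Q_def
    by (intro Bochner_Integration.integral_cong refl)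
       (simp add: inner_vec_def[of d] inner_axis' sum_distrib_right mult.assoc)
  also have "\<dots> = (\<Sum>m\<in>UNIV. d $ m * score_Q i \<theta> t (axis m 1))"
    unfolding score_Q_def
    by (subst Bochner_Integration.integral_sum)
       (simp_all only: integral_mult_right_zero integrable_mult_right
         integrable_traj_score(3)[OF init_space bounded_fun_compose[OF bounded_fun_Qval path_component_measurable]])
  finally show ?thesis .
qed

lemma value_grad_sums: "(\<lambda>t. \<gamma> ^ t * score_Q i \<theta> t d) sums (d \<bullet> value_grad i \<theta>)"
proof -
  have "(\<lambda>t. \<Sum>m\<in>UNIV. d $ m * (\<gamma> ^ t * score_Q i \<theta> t (axis m 1))) sums (\<Sum>m\<in>UNIV. d $ m * (\<Sum>t. \<gamma> ^ t * score_Q i \<theta> t (axis m 1)))"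
    by (intro sums_sum sums_mult summable_sums score_Q_summable)
  moreover have "(\<Sum>m\<in>UNIV. d $ m * (\<Sum>t. \<gamma> ^ t * score_Q i \<theta> t (axis m 1))) = d \<bullet> value_grad i \<theta>"
    by (simp add: inner_vec_def value_grad_def score_Q_axis)
  moreover have "(\<Sum>m\<in>UNIV. d $ m * (\<gamma> ^ t * score_Q i \<theta> t (axis m 1))) = \<gamma> ^ t * score_Q i \<theta> t d" for t
    by (subst score_Q_sum[of i \<theta> t d]) (simp add: sum_distrib_left mult_ac)
  ultimately show ?thesis by simp
qed

text \<open>The vector is tested against itself, which turns the uniform bound on directional terms
  into a bound on its norm.\<close>

lemma value_grad_bound: "norm (value_grad i \<theta>) \<le> value_bound * score_weight_mass / (1 - \<gamma>)"
proof -
  let ?v = "value_grad i \<theta>"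
  have "\<bar>?v \<bullet> ?v\<bar> \<le> norm ?v * value_bound * score_weight_mass / (1 - \<gamma>)"
  proof (rule sums_abs_le_geometric[OF value_grad_sums _ disc_pos disc_less_1])
    show "\<bar>\<gamma> ^ t * score_Q i \<theta> t ?v\<bar> \<le> \<gamma> ^ t * (norm ?v * value_bound * score_weight_mass)" for t
      unfolding abs_mult power_abs abs_of_pos[OF disc_pos]
      by (rule mult_left_mono[OF score_Q_bound]) (simp add: less_imp_le)
  qed
  then have "norm ?v * norm ?v \<le> norm ?v * (value_bound * score_weight_mass / (1 - \<gamma>))" by (simp add: power2_norm_eq_inner[symmetric] power2_eq_square mult.assoc)
  moreover have "0 \<le> value_bound * score_weight_mass / (1 - \<gamma>)" using value_bound_nonneg score_weight_mass_ge_1 one_minus_disc_pos by (intro divide_nonneg_pos mult_nonneg_nonneg) auto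
  ultimately show ?thesis
    by (cases "norm ?v = 0") (simp, metis mult_le_cancel_left_pos norm_ge_zero order_less_le)
qed

definition value_lip :: real where "value_lip = 3 * score_weight_mass * value_bound / (1 - \<gamma>)"

lemma value_lip_nonneg: "0 \<le> value_lip" unfolding value_lip_def using value_bound_nonneg score_weight_mass_ge_1 one_minus_disc_pos by (intro divide_nonneg_pos mult_nonneg_nonneg) auto

lemma bounded_fun_delta:
  assumes d: "norm (\<theta>' - \<theta>) \<le> 1"
  shows "bounded_fun (states G) (3 * score_weight_mass * value_bound * norm (\<theta>' - \<theta>)) (\<lambda>s. act_avg \<theta>' (Qval \<theta>' i) s - act_avg \<theta> (Qval \<theta>' i) s)"
  using bounded_fun_diff[OF bounded_fun_act_avg[OF bounded_fun_Qval'] bounded_fun_act_avg[OF bounded_fun_Qval']]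
    act_avg_Lipschitz[OF _ bounded_fun_Qval' value_bound_nonneg d]
  unfolding bounded_fun_def by blast

text \<open>Each term of the performance difference averages one and the same Q-function under two
  policies, so only the sensitivity of a single action draw enters.\<close>

lemma Vval_Lipschitz:
  assumes s: "s \<in> space (states G)" and d: "norm (\<theta>' - \<theta>) \<le> 1"
  shows "\<bar>Vval \<theta>' i s - Vval \<theta> i s\<bar> \<le> value_lip * norm (\<theta>' - \<theta>)"
proof -
  have "\<bar>Vval \<theta>' i s - Vval \<theta> i s\<bar> \<le> 3 * score_weight_mass * value_bound * norm (\<theta>' - \<theta>) / (1 - \<gamma>)"
  proof (rule sums_abs_le_geometric[OF performance_difference[OF s] _ disc_pos disc_less_1])
    fix t
    have "\<bar>\<integral>\<omega>. act_avg \<theta>' (Qval \<theta>' i) (fst (\<omega> t)) - act_avg \<theta> (Qval \<theta>' i) (fst (\<omega> t)) \<partial>traj G \<theta> s\<bar> \<le> 3 * score_weight_mass * value_bound * norm (\<theta>' - \<theta>)"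
      by (rule bounded_fun_integrable(2)[OF bounded_fun_compose[OF bounded_fun_delta[OF d] fst_path_measurable] traj_in_space[OF s]])
    then show "\<bar>\<gamma> ^ t * (\<integral>\<omega>. act_avg \<theta>' (Qval \<theta>' i) (fst (\<omega> t)) - act_avg \<theta> (Qval \<theta>' i) (fst (\<omega> t)) \<partial>traj G \<theta> s)\<bar>
       \<le> \<gamma> ^ t * (3 * score_weight_mass * value_bound * norm (\<theta>' - \<theta>))"
      unfolding abs_mult power_abs abs_of_pos[OF disc_pos] by (rule mult_left_mono) (simp add: less_imp_le)
  qed
  then show ?thesis by (simp add: value_lip_def mult_ac)
qed

text \<open>By the Bellman equation the rewards cancel, and the Q-functions differ by a discounted
  average of the difference of values.\<close>

lemma Qval_Lipschitz:
  assumes d: "norm (\<theta>' - \<theta>) \<le> 1"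
  shows "bounded_fun SA (value_lip * norm (\<theta>' - \<theta>)) (\<lambda>x. Qval \<theta>' i x - Qval \<theta> i x)"
proof -
  have v: "bounded_fun (states G) (value_lip * norm (\<theta>' - \<theta>)) (\<lambda>s. Vval \<theta>' i s - Vval \<theta> i s)"
    using bounded_fun_diff[OF bounded_fun_Vval bounded_fun_Vval] Vval_Lipschitz[OF _ d] unfolding bounded_fun_def by blast
  have b: "bounded_fun SA (\<gamma> * (value_lip * norm (\<theta>' - \<theta>))) (\<lambda>x. \<gamma> * next_avg (\<lambda>s. Vval \<theta>' i s - Vval \<theta> i s) x)"
    using bounded_fun_cmult[OF bounded_fun_next_avg[OF v], of \<gamma>] by (simp only: abs_of_pos[OF disc_pos])
  have e: "Qval \<theta>' i x - Qval \<theta> i x = \<gamma> * next_avg (\<lambda>s. Vval \<theta>' i s - Vval \<theta> i s) x" if x: "x \<in> space SA" for x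
  proof -
    have "next_avg (\<lambda>s. Vval \<theta>' i s - Vval \<theta> i s) x = next_avg (Vval \<theta>' i) x - next_avg (Vval \<theta> i) x"
      unfolding next_avg_def
      by (intro Bochner_Integration.integral_diff bounded_fun_integrable[OF bounded_fun_Vval] measurable_space[OF next_law_measurable x])
    then show ?thesis by (simp add: Qval_Bellman[OF x] right_diff_distrib)
  qed
  have "\<gamma> * (value_lip * norm (\<theta>' - \<theta>)) \<le> value_lip * norm (\<theta>' - \<theta>)"
    by (rule mult_left_le_one_le) (use value_lip_nonneg disc_pos disc_less_1 in \<open>auto simp: less_imp_le\<close>)
  moreover have "(\<lambda>x. Qval \<theta>' i x - Qval \<theta> i x) \<in> borel_measurable SA"
    using bounded_fun_diff[OF bounded_fun_Qval bounded_fun_Qval] by (simp add: bounded_fun_def)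
  ultimately show ?thesis using b e unfolding bounded_fun_def by (auto intro: order_trans)
qed

definition expansion_const :: real where "expansion_const = (2 * value_bound * score_weight_mass + value_lip * score_weight_mass) / (1 - \<gamma>)"

text \<open>The performance difference is exact but contains the Q-function at
  \<open>\<theta>'\<close>. Exchanging it for the one at \<open>\<theta>\<close> inside the
  first-order term multiplies a displacement by a Lipschitz change, which is again of second
  order.\<close>

lemma utility_expansion_local:
  assumes d: "norm (\<theta>' - \<theta>) \<le> 1"
  shows "\<bar>utility G i \<theta>' - utility G i \<theta> - (\<theta>' - \<theta>) \<bullet> value_grad i \<theta>\<bar> \<le> expansion_const * (norm (\<theta>' - \<theta>))\<^sup>2"
proof -
  let ?d = "\<theta>' - \<theta>"
  let ?\<delta> = "\<lambda>s. act_avg \<theta>' (Qval \<theta>' i) s - act_avg \<theta> (Qval \<theta>' i) s"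
  let ?a = "act_avg \<theta> (\<lambda>x. (?d \<bullet> jscore \<theta> x) * Qval \<theta> i x)"
  let ?c = "(2 * value_bound * score_weight_mass + value_lip * score_weight_mass) * (norm ?d)\<^sup>2"
  have b: "\<bar>?\<delta> s - ?a s\<bar> \<le> ?c" if s: "s \<in> space (states G)" for s
  proof -
    \<comment> \<open>The intermediate quantity: old policy and old score, new Q-function. The
      expansion of the action average leads from \<open>?\<delta>\<close> to it, the Lipschitz bound
      for the Q-function leads on to \<open>?a\<close>.\<close>
    let ?a' = "act_avg \<theta> (\<lambda>x. (?d \<bullet> jscore \<theta> x) * Qval \<theta>' i x)"
    let ?D = "\<lambda>x. Qval \<theta>' i x - Qval \<theta> i x"
    have n: "0 \<le> value_lip * norm ?d" using value_lip_nonneg by simp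
    have "?a' s - ?a s = act_avg \<theta> (\<lambda>x. (?d \<bullet> jscore \<theta> x) * ?D x) s"
      unfolding score_weighted(1)[OF s bounded_fun_Qval' value_bound_nonneg] score_weighted(1)[OF s Qval_Lipschitz[OF d] n]
      by (subst Bochner_Integration.integral_diff[OF score_weighted(2)[OF s bounded_fun_Qval' value_bound_nonneg] score_weighted(2)[OF s bounded_fun_Qval' value_bound_nonneg], symmetric])
         (simp add: algebra_simps)
    then have "\<bar>?a' s - ?a s\<bar> \<le> norm ?d * (value_lip * norm ?d) * score_weight_mass"
      using score_weighted(3)[OF s Qval_Lipschitz[OF d] n] by simp
    moreover have "\<bar>?\<delta> s - ?a' s\<bar> \<le> 2 * ((norm ?d)\<^sup>2 * value_bound) * score_weight_mass"
      by (rule act_avg_expansion[OF s bounded_fun_Qval' value_bound_nonneg d])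
    moreover have "?c = 2 * ((norm ?d)\<^sup>2 * value_bound) * score_weight_mass + norm ?d * (value_lip * norm ?d) * score_weight_mass"
      by (simp add: algebra_simps power2_eq_square)
    ultimately show ?thesis by linarith
  qed
  have bd: "bounded_fun (states G) (3 * score_weight_mass * value_bound * norm ?d) ?\<delta>" by (rule bounded_fun_delta[OF d])
  have ba: "bounded_fun (states G) (norm ?d * value_bound * score_weight_mass) ?a" by (rule bounded_fun_act_avg_score[OF bounded_fun_Qval' value_bound_nonneg])
  have bb: "bounded_fun (states G) ?c (\<lambda>s. ?\<delta> s - ?a s)"
    using bounded_fun_diff[OF bd ba] b unfolding bounded_fun_def by blast
  let ?I = "\<lambda>f t. \<integral>\<omega>. f (fst (\<omega> t)) \<partial>traj G \<theta> (init G)"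
  note tin = traj_in_space[OF init_space, of \<theta>]
  have I: "?I (\<lambda>s. ?\<delta> s - ?a s) t = ?I ?\<delta> t - score_Q i \<theta> t ?d" for t
    unfolding score_Q_act_avg
    by (intro Bochner_Integration.integral_diff bounded_fun_integrable(1)[OF bounded_fun_compose[OF bd fst_path_measurable] tin]
        bounded_fun_integrable(1)[OF bounded_fun_compose[OF ba fst_path_measurable] tin])
  have "(\<lambda>t. \<gamma> ^ t * ?I ?\<delta> t - \<gamma> ^ t * score_Q i \<theta> t ?d) sums (Vval \<theta>' i (init G) - Vval \<theta> i (init G) - ?d \<bullet> value_grad i \<theta>)"
    by (intro sums_diff performance_difference[OF init_space] value_grad_sums)
  then have "(\<lambda>t. \<gamma> ^ t * ?I (\<lambda>s. ?\<delta> s - ?a s) t) sums (Vval \<theta>' i (init G) - Vval \<theta> i (init G) - ?d \<bullet> value_grad i \<theta>)"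
    by (simp only: I right_diff_distrib)
  then have "\<bar>Vval \<theta>' i (init G) - Vval \<theta> i (init G) - ?d \<bullet> value_grad i \<theta>\<bar> \<le> ?c / (1 - \<gamma>)"
  proof (rule sums_abs_le_geometric[OF _ _ disc_pos disc_less_1])
    fix t
    have "\<bar>?I (\<lambda>s. ?\<delta> s - ?a s) t\<bar> \<le> ?c"
      by (rule bounded_fun_integrable(2)[OF bounded_fun_compose[OF bb fst_path_measurable] tin])
    then show "\<bar>\<gamma> ^ t * ?I (\<lambda>s. ?\<delta> s - ?a s) t\<bar> \<le> \<gamma> ^ t * ?c"
      unfolding abs_mult[of "\<gamma> ^ t"] power_abs abs_of_pos[OF disc_pos] by (rule mult_left_mono) (simp add: less_imp_le)
  qed
  then show ?thesis by (simp add: utility_eq_Vval expansion_const_def)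
qed

lemma utility_bound: "\<bar>utility G i \<theta>\<bar> \<le> value_bound"
  using bounded_fun_Vval[of \<theta> i] by (simp add: utility_eq_Vval bounded_fun_def value_bound_def)

text \<open>Beyond distance one the square of the displacement exceeds both one and its norm, so
  boundedness of the utility and of \<open>value_grad\<close> extends the local estimate to all
  displacements.\<close>

lemma utility_expansion:
  "\<exists>K\<ge>0. \<forall>i \<theta> \<theta>'. \<bar>utility G i \<theta>' - utility G i \<theta> - (\<theta>' - \<theta>) \<bullet> value_grad i \<theta>\<bar> \<le> K * (norm (\<theta>' - \<theta>))\<^sup>2"
proof (intro exI conjI allI)
  let ?B = "value_bound * score_weight_mass / (1 - \<gamma>)"
  have nn: "0 \<le> expansion_const" "0 \<le> ?B" unfolding expansion_const_def using value_bound_nonneg score_weight_mass_ge_1 value_lip_nonneg one_minus_disc_pos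
    by (auto intro!: divide_nonneg_pos mult_nonneg_nonneg add_nonneg_nonneg)
  show "0 \<le> expansion_const + 2 * value_bound + ?B" using nn value_bound_nonneg by simp
  fix i and \<theta> \<theta>' :: "real ^ 'm"
  let ?d = "\<theta>' - \<theta>"
  show "\<bar>utility G i \<theta>' - utility G i \<theta> - ?d \<bullet> value_grad i \<theta>\<bar> \<le> (expansion_const + 2 * value_bound + ?B) * (norm ?d)\<^sup>2"
  proof (cases "norm ?d \<le> 1")
    case True
    have "expansion_const * (norm ?d)\<^sup>2 \<le> (expansion_const + 2 * value_bound + ?B) * (norm ?d)\<^sup>2" using nn value_bound_nonneg by (intro mult_right_mono) auto
    with utility_expansion_local[OF True, of i] show ?thesis by linarith
  next
    case False
    then have n: "norm ?d \<le> (norm ?d)\<^sup>2" "1 \<le> (norm ?d)\<^sup>2" by (auto simp: power2_eq_square mult_le_cancel_left1 one_le_mult_iff intro: order_trans[of _ "1 * norm ?d"])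
    have "\<bar>?d \<bullet> value_grad i \<theta>\<bar> \<le> norm ?d * ?B"
      using Cauchy_Schwarz_ineq2[of ?d "value_grad i \<theta>"] mult_left_mono[OF value_grad_bound, of "norm ?d" i \<theta>] by simp
    also have "\<dots> \<le> (norm ?d)\<^sup>2 * ?B" using n nn by (intro mult_right_mono) auto
    finally have 1: "\<bar>?d \<bullet> value_grad i \<theta>\<bar> \<le> (norm ?d)\<^sup>2 * ?B" .
    have 2: "2 * value_bound \<le> 2 * value_bound * (norm ?d)\<^sup>2" using n value_bound_nonneg mult_left_mono[of 1 "(norm ?d)\<^sup>2" "2 * value_bound"] by simp
    have 3: "0 \<le> expansion_const * (norm ?d)\<^sup>2" using nn by simp
    have "(expansion_const + 2 * value_bound + ?B) * (norm ?d)\<^sup>2 = expansion_const * (norm ?d)\<^sup>2 + 2 * value_bound * (norm ?d)\<^sup>2 + (norm ?d)\<^sup>2 * ?B" by (simp add: distrib_right)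
    then show ?thesis using 1 2 3 utility_bound[of i \<theta>] utility_bound[of i \<theta>'] by linarith
  qed
qed

end

section \<open>The gradient estimator\<close>

text \<open>The sampled time takes countably many values, so measurability is checked for each fixed
  time.\<close>

lemma measurable_bind_pmf:
  fixes p :: "nat pmf"
  assumes "\<And>T. (\<lambda>x. f T x) \<in> M \<rightarrow>\<^sub>M prob_algebra N"
  shows "(\<lambda>x. measure_pmf p \<bind> (\<lambda>T. f T x)) \<in> M \<rightarrow>\<^sub>M prob_algebra N"
proof (rule measurable_bind_prob_space2)
  show "(\<lambda>x. measure_pmf p) \<in> M \<rightarrow>\<^sub>M prob_algebra (count_space UNIV)"
    by (rule measurable_const) (simp add: space_prob_algebra prob_space_measure_pmf)
  show "(\<lambda>(x, T). f T x) \<in> M \<Otimes>\<^sub>M count_space UNIV \<rightarrow>\<^sub>M prob_algebra N"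
    unfolding case_prod_unfold
    by (rule measurable_compose_countable[where f="\<lambda>T y. f T (fst y)"])
       (auto intro: measurable_compose[OF measurable_fst assms])
qed

text \<open>Exactly the information that must pass through nested sampling: an almost sure bound and
  the mean \<open>m\<close>.\<close>

definition bounded_law :: "real \<Rightarrow> real \<Rightarrow> real measure \<Rightarrow> bool" where
  "bounded_law B m N \<longleftrightarrow> N \<in> space (prob_algebra borel) \<and> (AE r in N. \<bar>r\<bar> \<le> B) \<and> integral\<^sup>L N (\<lambda>r. r) = m"

lemma bounded_law_integrable:
  assumes "bounded_law B m N"
  shows "integrable N (\<lambda>r. r)"
proof -
  have N: "N \<in> space (prob_algebra borel)" and b: "AE r in N. \<bar>r\<bar> \<le> B" using assms by (auto simp: bounded_law_def)
  interpret prob_space N using N by (simp add: space_prob_algebra)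
  have "sets N = sets borel" using N by (simp add: space_prob_algebra)
  then have "(\<lambda>r. r) \<in> borel_measurable N" by (rule measurable_ident_sets)
  then show ?thesis by (intro integrable_const_bound[of _ B]) (use b in auto)
qed

lemma bounded_law_return: "\<bar>x\<bar> \<le> B \<Longrightarrow> bounded_law B x (return borel x)"
  by (auto simp: bounded_law_def space_prob_algebra prob_space_return AE_return integral_return)

text \<open>The tower property; the common almost sure bound provides the integrability that it
  needs.\<close>

lemma bounded_law_bind:
  assumes M: "M \<in> space (prob_algebra M')" and K: "K \<in> M' \<rightarrow>\<^sub>M prob_algebra borel"
    and m: "m \<in> borel_measurable M'" and b: "AE x in M. bounded_law B (m x) (K x)"
  shows "bounded_law B (\<integral>x. m x \<partial>M) (M \<bind> K)"
proof -
  have sM: "sets M = sets M'" using M by (simp add: space_prob_algebra)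
  have K': "K \<in> M \<rightarrow>\<^sub>M subprob_algebra borel"
    using measurable_prob_algebraD[OF K] measurable_cong_sets[OF sM refl] by blast
  have in_space: "M \<bind> K \<in> space (prob_algebra borel)"
    using prob_space_bind'[OF M K] sets_bind'[OF M K] by (simp add: space_prob_algebra)
  have pr: "Measurable.pred borel (\<lambda>r::real. \<bar>r\<bar> \<le> B)" by measurable
  have ae: "AE r in M \<bind> K. \<bar>r\<bar> \<le> B"
    unfolding AE_bind[OF K' pr] using b by eventually_elim (simp add: bounded_law_def)
  have i: "integrable (M \<bind> K) (\<lambda>r. r)"
    by (rule bounded_law_integrable[of B "integral\<^sup>L (M \<bind> K) (\<lambda>r. r)"]) (use in_space ae in \<open>simp add: bounded_law_def\<close>)
  have mM: "m \<in> borel_measurable M" using m measurable_cong_sets[OF sM refl] by blast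
  have "integral\<^sup>L (M \<bind> K) (\<lambda>r. r) = (\<integral>x. m x \<partial>M)"
    unfolding integrable_integral_bind(2)[OF M K i]
    by (rule integral_cong_AE[OF borel_measurable_integrable[OF integrable_integral_bind(1)[OF M K i]] mM])
       (use b in eventually_elim, simp add: bounded_law_def)
  with in_space ae show ?thesis by (simp add: bounded_law_def)
qed

lemma bounded_law_affine:
  assumes N: "bounded_law a m N" and B: "\<bar>c\<bar> + \<bar>d\<bar> * a \<le> B"
  shows "bounded_law B (c + d * m) (N \<bind> (\<lambda>x. return borel (c + d * x)))"
proof -
  have n: "N \<in> space (prob_algebra borel)" "AE r in N. \<bar>r\<bar> \<le> a" "integral\<^sup>L N (\<lambda>r. r) = m"
    using N by (auto simp: bounded_law_def)
  interpret prob_space N using n(1) by (simp add: space_prob_algebra)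
  have "bounded_law B (\<integral>x. c + d * x \<partial>N) (N \<bind> (\<lambda>x. return borel (c + d * x)))"
  proof (rule bounded_law_bind[OF n(1)])
    have "(\<lambda>x. c + d * x) \<in> borel_measurable borel" by measurable
    from measurable_compose[OF this measurable_return_prob_space]
    show "(\<lambda>x. return borel (c + d * x)) \<in> borel \<rightarrow>\<^sub>M prob_algebra borel" .
    show "AE x in N. bounded_law B (c + d * x) (return borel (c + d * x))"
      using n(2)
    proof eventually_elim
      case (elim x)
      have "\<bar>c + d * x\<bar> \<le> \<bar>c\<bar> + \<bar>d\<bar> * \<bar>x\<bar>" using abs_triangle_ineq[of c "d * x"] by (simp add: abs_mult)
      also have "\<dots> \<le> \<bar>c\<bar> + \<bar>d\<bar> * a" using elim by (intro add_left_mono mult_left_mono) auto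
      finally show ?case using B by (intro bounded_law_return) simp
    qed
  qed measurable
  moreover have "(\<integral>x. c + d * x \<partial>N) = c + d * m"
    using bounded_law_integrable[OF N] n(3) prob_space by simp
  ultimately show ?thesis by simp
qed

lemma measure_pmf_in_prob_algebra: "measure_pmf p \<in> space (prob_algebra (count_space UNIV))"
  by (simp add: space_prob_algebra prob_space_measure_pmf)

lemma geometric_expectation:
  fixes f :: "nat \<Rightarrow> real"
  assumes r: "0 < r" "r < 1" and f: "\<And>n. \<bar>f n\<bar> \<le> B"
  shows "(\<lambda>n. r ^ n * (1 - r) * f n) sums (\<integral>n. f n \<partial>measure_pmf (geometric_pmf (1 - r)))"
proof -
  let ?p = "geometric_pmf (1 - r)"
  have p: "pmf ?p n = r ^ n * (1 - r)" for n using r by simp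
  have "integrable (measure_pmf ?p) f"
    by (rule measure_pmf.integrable_const_bound[of _ B]) (use f in auto)
  then have i: "integrable (count_space UNIV) (\<lambda>n. pmf ?p n *\<^sub>R f n)"
    unfolding measure_pmf_eq_density by (subst (asm) integrable_density) auto
  have "(\<integral>n. f n \<partial>measure_pmf ?p) = (\<integral>n. pmf ?p n *\<^sub>R f n \<partial>count_space UNIV)"
    unfolding measure_pmf_eq_density by (rule integral_density) auto
  with sums_integral_count_space_nat[OF i] show ?thesis by (simp add: p)
qed

text \<open>A geometric horizon reaches at least \<open>k\<close> with probability
  \<open>r ^ k\<close>, so random truncation has the mean effect of discounting.\<close>

lemma geometric_partial_sums:
  fixes a :: "nat \<Rightarrow> real"
  assumes r: "0 < r" "r < 1" and S: "\<And>n. \<bar>\<Sum>k\<le>n. a k\<bar> \<le> B"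
  shows "(\<integral>n. (\<Sum>k\<le>n. a k) \<partial>measure_pmf (geometric_pmf (1 - r))) = (\<Sum>k. r ^ k * a k)"
proof -
  let ?S = "\<lambda>n. \<Sum>k\<le>n. a k" and ?I = "\<integral>n. (\<Sum>k\<le>n. a k) \<partial>measure_pmf (geometric_pmf (1 - r))"
  have 1: "(\<lambda>n. r ^ n * (1 - r) * ?S n) sums ?I" by (rule geometric_expectation[OF r S])
  have lim: "(\<lambda>n. r ^ n * ?S n) \<longlonglongrightarrow> 0"
    by (rule lim_null_mult_right_bounded[where B=B]) (use r S in \<open>auto intro!: LIMSEQ_power_zero\<close>)
  \<comment> \<open>Summation by parts: subtracting this telescoping series from the expectation
    leaves \<open>r ^ Suc n * a (Suc n)\<close> in each term.\<close>
  have "(\<lambda>n. r ^ n * ?S n - r ^ Suc n * ?S (Suc n)) sums (r ^ 0 * ?S 0 - 0)"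
    by (rule telescope_sums'[OF lim])
  from sums_diff[OF 1 this] have "(\<lambda>n. r ^ Suc n * a (Suc n)) sums (?I - a 0)"
    by (simp add: algebra_simps)
  then have "(\<lambda>k. r ^ k * a k) sums ?I"
    using sums_Suc_iff[of "\<lambda>k. r ^ k * a k" "?I - a 0"] by simp
  then show ?thesis by (simp add: sums_iff)
qed

text \<open>The weight is merely integrable, so the dominating functions are
  \<open>\<gamma> ^ k * (\<bar>\<psi> x\<bar> * C)\<close> instead of constants.\<close>

lemma integral_weighted_discounted_sum:
  assumes f: "\<And>k. bounded_fun M C (f k)" and g: "0 < \<gamma>" "\<gamma> < 1"
    and N: "N \<in> space (prob_algebra M)" and psi: "integrable N \<psi>"
  shows "(\<integral>x. \<psi> x * (\<Sum>k. \<gamma> ^ k * f k x) \<partial>N) = (\<Sum>k. \<gamma> ^ k * (\<integral>x. \<psi> x * f k x \<partial>N))"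
proof -
  have sp: "space N = space M" "sets N = sets M" and pN: "prob_space N"
    using N sets_eq_imp_space_eq by (auto simp: space_prob_algebra)
  have [measurable]: "f k \<in> borel_measurable N" for k
    using f[of k] measurable_cong_sets[OF sp(2) refl] by (auto simp: bounded_fun_def)
  have [measurable]: "\<psi> \<in> borel_measurable N" using psi by simp
  have fb: "\<bar>f k x\<bar> \<le> C" if "x \<in> space N" for k x using f that sp by (simp add: bounded_fun_def)
  have b: "\<bar>\<gamma> ^ k * (\<psi> x * f k x)\<bar> \<le> \<gamma> ^ k * (\<bar>\<psi> x\<bar> * C)" if "x \<in> space N" for k x
    using fb[OF that, of k] g by (simp add: abs_mult mult_left_mono)
  have i: "integrable N (\<lambda>x. \<psi> x * f k x)" for k
  proof (rule Bochner_Integration.integrable_bound[OF integrable_mult_left[OF psi, of C]])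
    have "\<bar>\<psi> x * f k x\<bar> \<le> \<bar>\<psi> x * C\<bar>" if "x \<in> space N" for x
      unfolding abs_mult using fb[OF that, of k] by (intro mult_left_mono) auto
    then show "AE x in N. norm (\<psi> x * f k x) \<le> norm (\<psi> x * C)" by (intro AE_I2) simp
  qed measurable
  have sm: "summable (\<lambda>k. \<gamma> ^ k * c)" for c :: real using g by (intro summable_mult2 summable_geometric) auto
  have e: "\<psi> x * (\<Sum>k. \<gamma> ^ k * f k x) = (\<Sum>k. \<gamma> ^ k * (\<psi> x * f k x))" if "x \<in> space N" for x
  proof -
    have "summable (\<lambda>k. \<gamma> ^ k * f k x)"
      by (rule summable_rabs_cancel, rule bounded_fun_discounted_sum(2)[OF f g]) (use that sp in simp)
    from suminf_mult[OF this, of "\<psi> x"] show ?thesis by (simp add: mult_ac)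
  qed
  have "(\<integral>x. \<psi> x * (\<Sum>k. \<gamma> ^ k * f k x) \<partial>N) = (\<integral>x. (\<Sum>k. \<gamma> ^ k * (\<psi> x * f k x)) \<partial>N)"
    by (rule Bochner_Integration.integral_cong[OF refl e])
  also have "\<dots> = (\<Sum>k. \<integral>x. \<gamma> ^ k * (\<psi> x * f k x) \<partial>N)"
  proof (rule integral_suminf)
    show "integrable N (\<lambda>x. \<gamma> ^ k * (\<psi> x * f k x))" for k using i by simp
    show "AE x in N. summable (\<lambda>k. norm (\<gamma> ^ k * (\<psi> x * f k x)))"
      by (rule AE_I2, rule summable_comparison_test'[OF sm, of 0]) (use b in auto)
    have "(\<integral>x. norm (\<gamma> ^ k * (\<psi> x * f k x)) \<partial>N) \<le> (\<integral>x. \<gamma> ^ k * (\<bar>\<psi> x\<bar> * C) \<partial>N)" for k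
      by (rule integral_mono) (use b i psi in auto)
    then show "summable (\<lambda>k. \<integral>x. norm (\<gamma> ^ k * (\<psi> x * f k x)) \<partial>N)"
      by (intro summable_comparison_test'[OF sm[of "\<integral>x. \<bar>\<psi> x\<bar> * C \<partial>N"], of 0]) (auto simp: integral_nonneg_AE)
  qed
  finally show ?thesis by simp
qed

section \<open>Laws of the reward estimates and of the gradient estimator\<close>

context smooth_markov_game
begin

definition \<rho> :: real where "\<rho> = \<gamma> powr (1 / 2)"

lemma rho: "0 < \<rho>" "\<rho> < 1" "\<rho> * \<rho> = \<gamma>"
proof -
  have "\<rho> = sqrt \<gamma>" unfolding \<rho>_def by (simp add: powr_half_sqrt less_imp_le)
  then show "0 < \<rho>" "\<rho> < 1" "\<rho> * \<rho> = \<gamma>" by (simp_all add: less_imp_le)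
qed

lemma disc_powr_half: "\<gamma> powr (real k / 2) = \<rho> ^ k"
  unfolding \<rho>_def powr_power[OF less_imp_neq[OF disc_pos, symmetric]] by simp

definition estimate_bound :: real where "estimate_bound = R / (1 - \<rho>)"

lemma estimate_bound_nonneg: "0 \<le> estimate_bound" and R_le_estimate_bound: "R \<le> estimate_bound"
proof -
  have p: "0 < 1 - \<rho>" using rho by simp
  show "0 \<le> estimate_bound" unfolding estimate_bound_def using R_pos p by simp
  have "R * (1 - \<rho>) \<le> R * 1" using R_pos rho by (intro mult_left_mono) auto
  then show "R \<le> estimate_bound" unfolding estimate_bound_def using p by (simp add: pos_le_divide_eq)
qed

lemma paths_space: "\<omega> \<in> space paths \<Longrightarrow> \<omega> t \<in> space SA"
  by (rule measurable_space[OF path_component_measurable])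

lemma reward_bound: "\<omega> \<in> space paths \<Longrightarrow> \<bar>reward i (\<omega> t)\<bar> \<le> R"
  using bounded_fun_reward paths_space unfolding bounded_fun_def by blast

lemma reward_measurable [measurable]: "reward i \<in> borel_measurable SA"
  using bounded_fun_reward by (simp add: bounded_fun_def)

lemma discounted_rewards_bound:
  assumes "\<omega> \<in> space paths"
  shows "\<bar>\<Sum>k\<le>n. \<rho> ^ k * reward i (\<omega> (t + k))\<bar> \<le> estimate_bound"
proof -
  have "\<bar>\<Sum>k\<le>n. \<rho> ^ k * reward i (\<omega> (t + k))\<bar> \<le> (\<Sum>k\<le>n. \<rho> ^ k * R)"
    using rho reward_bound[OF assms] by (intro order_trans[OF sum_abs sum_mono]) (auto simp: abs_mult intro!: mult_left_mono)
  also have "\<dots> = (\<Sum>k\<le>n. \<rho> ^ k) * R" by (simp add: sum_distrib_right)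
  also have "\<dots> \<le> (1 / (1 - \<rho>)) * R"
  proof (rule mult_right_mono)
    have "(\<Sum>k\<in>{..n}. \<rho> ^ k) \<le> (\<Sum>k. \<rho> ^ k)" by (rule sum_le_suminf) (use rho in \<open>auto intro: summable_geometric\<close>)
    then show "(\<Sum>k\<le>n. \<rho> ^ k) \<le> 1 / (1 - \<rho>)" using rho by (simp add: suminf_geometric)
  qed (use R_pos in simp)
  finally show ?thesis by (simp add: estimate_bound_def)
qed

lemma horizon_law_eq: "horizon_law G = measure_pmf (geometric_pmf (1 - \<rho>))"
  by (simp add: horizon_law_def \<rho>_def)

lemma V_hat_law_eq: "V_hat_law G i \<theta> s = measure_pmf (geometric_pmf (1 - \<rho>)) \<bind>
    (\<lambda>T. traj G \<theta> s \<bind> (\<lambda>\<omega>. return borel (\<Sum>k\<le>T. \<rho> ^ k * reward i (\<omega> (0 + k)))))"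
  unfolding V_hat_law_def horizon_law_eq disc_powr_half reward_at_def reward_def by (simp add: atMost_atLeast0)

lemma Q_hat_law_eq: "Q_hat_law G i T1 \<omega> = measure_pmf (geometric_pmf (1 - \<rho>)) \<bind>
    (\<lambda>T. return borel (\<Sum>k\<le>T. \<rho> ^ k * reward i (\<omega> (T1 + k))))"
proof -
  have "(\<Sum>t=T1..T1 + T. disc G powr (real (t - T1) / 2) * reward_at G i \<omega> t) = (\<Sum>k\<le>T. \<rho> ^ k * reward i (\<omega> (T1 + k)))" for T
    unfolding disc_powr_half reward_at_def reward_def
    using sum.shift_bounds_cl_nat_ivl[of "\<lambda>t. \<rho> ^ (t - T1) * rew G i (fst (\<omega> t)) (snd (\<omega> t))" 0 T1 T]
    by (simp add: atMost_atLeast0 add.commute)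
  then show ?thesis unfolding Q_hat_law_def horizon_law_eq by simp
qed

lemma partial_sum_measurable: "(\<lambda>\<omega>. \<Sum>k\<le>T. \<rho> ^ k * reward i (\<omega> (t + k))) \<in> borel_measurable paths"
  by measurable

lemma return_borel_measurable: "f \<in> borel_measurable M \<Longrightarrow> (\<lambda>x. return borel (f x)) \<in> M \<rightarrow>\<^sub>M prob_algebra borel"
  by (rule measurable_compose[OF _ measurable_return_prob_space])

lemma Q_hat_law_measurable: "Q_hat_law G i T1 \<in> paths \<rightarrow>\<^sub>M prob_algebra borel"
  unfolding Q_hat_law_eq[abs_def]
  by (rule measurable_bind_pmf) (rule return_borel_measurable[OF partial_sum_measurable])

lemma V_hat_law_measurable [measurable]: "V_hat_law G i \<theta> \<in> states G \<rightarrow>\<^sub>M prob_algebra borel"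
  unfolding V_hat_law_eq[abs_def]
  by (rule measurable_bind_pmf)
     (rule measurable_bind_prob_space[OF traj_measurable return_borel_measurable[OF partial_sum_measurable]])

text \<open>The survival probability of the horizon and the explicit weight are both
  \<open>\<rho> ^ k\<close>, with product \<open>\<gamma> ^ k\<close>: this explains the square
  root. Unbiasedness thus comes together with a bound that is independent of the horizon, because
  the weights alone are summable.\<close>

lemma Q_hat_law_bounded:
  assumes w: "\<omega> \<in> space paths"
  shows "bounded_law estimate_bound (\<Sum>k. \<gamma> ^ k * reward i (\<omega> (T1 + k))) (Q_hat_law G i T1 \<omega>)"
proof -
  have "bounded_law estimate_bound (\<integral>T. (\<Sum>k\<le>T. \<rho> ^ k * reward i (\<omega> (T1 + k))) \<partial>measure_pmf (geometric_pmf (1 - \<rho>))) (Q_hat_law G i T1 \<omega>)"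
    unfolding Q_hat_law_eq
    by (rule bounded_law_bind[OF measure_pmf_in_prob_algebra])
       (auto intro!: bounded_law_return discounted_rewards_bound[OF w] simp: space_prob_algebra prob_space_return)
  also have "(\<integral>T. (\<Sum>k\<le>T. \<rho> ^ k * reward i (\<omega> (T1 + k))) \<partial>measure_pmf (geometric_pmf (1 - \<rho>))) =
      (\<Sum>k. \<rho> ^ k * (\<rho> ^ k * reward i (\<omega> (T1 + k))))"
    by (rule geometric_partial_sums[OF rho(1,2) discounted_rewards_bound[OF w]])
  also have "\<dots> = (\<Sum>k. \<gamma> ^ k * reward i (\<omega> (T1 + k)))"
    by (simp add: rho(3)[symmetric] power_mult_distrib mult.assoc)
  finally show ?thesis .
qed

lemma bounded_fun_path_reward: "bounded_fun paths R (\<lambda>\<omega>. reward i (\<omega> t))"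
  by (rule bounded_fun_compose[OF bounded_fun_reward path_component_measurable])

lemma V_hat_law_bounded:
  assumes s: "s \<in> space (states G)"
  shows "bounded_law estimate_bound (Vval \<theta> i s) (V_hat_law G i \<theta> s)"
proof -
  let ?S = "\<lambda>T \<omega>. \<Sum>k\<le>T. \<rho> ^ k * reward i (\<omega> (0 + k))"
  let ?e = "\<lambda>k. \<integral>\<omega>. reward i (\<omega> k) \<partial>traj G \<theta> s"
  have bS: "bounded_fun paths estimate_bound (?S T)" for T
    unfolding bounded_fun_def by (intro conjI ballI partial_sum_measurable discounted_rewards_bound)
  have IS: "(\<integral>\<omega>. ?S T \<omega> \<partial>traj G \<theta> s) = (\<Sum>k\<le>T. \<rho> ^ k * ?e k)" for T
    by (subst Bochner_Integration.integral_sum)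
       (auto intro!: integrable_mult_right bounded_fun_integrable(1)[OF bounded_fun_path_reward traj_in_space[OF s]])
  have in1: "bounded_law estimate_bound (\<Sum>k\<le>T. \<rho> ^ k * ?e k) (traj G \<theta> s \<bind> (\<lambda>\<omega>. return borel (?S T \<omega>)))" for T
    unfolding IS[symmetric]
  proof (rule bounded_law_bind[OF traj_in_space[OF s] return_borel_measurable[OF partial_sum_measurable] partial_sum_measurable])
    show "AE \<omega> in traj G \<theta> s. bounded_law estimate_bound (?S T \<omega>) (return borel (?S T \<omega>))"
      using sets_eq_imp_space_eq[OF sets_traj[OF s]]
      by (intro AE_I2 bounded_law_return discounted_rewards_bound) blast
  qed
  have "bounded_law estimate_bound (\<integral>T. (\<Sum>k\<le>T. \<rho> ^ k * ?e k) \<partial>measure_pmf (geometric_pmf (1 - \<rho>))) (V_hat_law G i \<theta> s)"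
    unfolding V_hat_law_eq
  proof (rule bounded_law_bind[OF measure_pmf_in_prob_algebra])
    show "(\<lambda>T. traj G \<theta> s \<bind> (\<lambda>\<omega>. return borel (?S T \<omega>))) \<in> count_space UNIV \<rightarrow>\<^sub>M prob_algebra borel"
      using in1 by (auto simp: bounded_law_def)
  qed (simp, rule AE_I2, rule in1)
  also have "(\<integral>T. (\<Sum>k\<le>T. \<rho> ^ k * ?e k) \<partial>measure_pmf (geometric_pmf (1 - \<rho>))) = (\<Sum>k. \<rho> ^ k * (\<rho> ^ k * ?e k))"
    by (rule geometric_partial_sums[OF rho(1,2), of _ estimate_bound])
       (use bounded_fun_integrable(2)[OF bS traj_in_space[OF s, of \<theta>]] IS in simp)
  also have "\<dots> = Vval \<theta> i s"
    unfolding Vval_eq_traj[OF s] by (simp add: rho(3)[symmetric] power_mult_distrib mult.assoc)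
  finally show ?thesis .
qed

text \<open>The conditional mean of the reward estimate given the main path and the recording time.
  The freshly sampled values are already averaged out, while the main path is not.\<close>

definition mean_reward_estimate where
  "mean_reward_estimate k i \<theta> T \<omega> = (case k of
       Q_Function \<Rightarrow> (\<Sum>j. \<gamma> ^ j * reward i (\<omega> (T + j)))
     | Advantage \<Rightarrow> (\<Sum>j. \<gamma> ^ j * reward i (\<omega> (T + j))) - Vval \<theta> i (fst (\<omega> T))
     | Temporal_Difference \<Rightarrow> reward i (\<omega> T) + \<gamma> * Vval \<theta> i (fst (\<omega> (T + 1))) - Vval \<theta> i (fst (\<omega> T)))"

lemma Vval_measurable [measurable]: "Vval \<theta> i \<in> borel_measurable (states G)"
  using bounded_fun_Vval by (simp add: bounded_fun_def)

lemma fst_path_space: "\<omega> \<in> space paths \<Longrightarrow> fst (\<omega> t) \<in> space (states G)"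
  using paths_space[of \<omega> t] by (auto simp: space_pair_measure)

lemma R_hat_law_measurable: "R_hat_law G k i \<theta> T \<in> paths \<rightarrow>\<^sub>M prob_algebra borel"
proof -
  have Vt: "(\<lambda>\<omega>. V_hat_law G i \<theta> (fst (\<omega> t))) \<in> paths \<rightarrow>\<^sub>M prob_algebra borel" for t
    by (rule measurable_compose[OF fst_path_measurable V_hat_law_measurable])
  show ?thesis
  proof (cases k)
    case Q_Function
    then show ?thesis using Q_hat_law_measurable by (simp add: R_hat_law_def[abs_def])
  next
    case Advantage
    have "(\<lambda>\<omega>. Q_hat_law G i T \<omega> \<bind> (\<lambda>q. V_hat_law G i \<theta> (fst (\<omega> T)) \<bind> (\<lambda>v. return borel (q - v)))) \<in> paths \<rightarrow>\<^sub>M prob_algebra borel"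
      unfolding case_prod_unfold
      by (rule measurable_bind_prob_space2[OF Q_hat_law_measurable], unfold case_prod_unfold,
          rule measurable_bind_prob_space2[OF measurable_compose[OF measurable_fst Vt]], unfold case_prod_unfold,
          rule return_borel_measurable) measurable
    then show ?thesis by (simp add: R_hat_law_def[abs_def] Advantage)
  next
    case Temporal_Difference
    have [measurable]: "(\<lambda>\<omega>. reward i (\<omega> T)) \<in> borel_measurable paths"
      using bounded_fun_path_reward by (simp add: bounded_fun_def)
    have "(\<lambda>\<omega>. V_hat_law G i \<theta> (fst (\<omega> (T + 1))) \<bind> (\<lambda>v'. V_hat_law G i \<theta> (fst (\<omega> T)) \<bind>
        (\<lambda>v. return borel (reward i (\<omega> T) + \<gamma> * v' - v)))) \<in> paths \<rightarrow>\<^sub>M prob_algebra borel"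
      by (rule measurable_bind_prob_space2[OF Vt], unfold case_prod_unfold,
          rule measurable_bind_prob_space2[OF measurable_compose[OF measurable_fst Vt]], unfold case_prod_unfold,
          rule return_borel_measurable) measurable
    then show ?thesis by (simp add: R_hat_law_def[abs_def] Temporal_Difference reward_at_def reward_def)
  qed
qed

text \<open>At most three quantities, each bounded by \<open>estimate_bound\<close>, are combined;
  the worst case is the temporal difference, where the plain reward is also below that
  bound.\<close>

lemma R_hat_law_bounded:
  assumes w: "\<omega> \<in> space paths"
  shows "bounded_law (3 * estimate_bound) (mean_reward_estimate k i \<theta> T \<omega>) (R_hat_law G k i \<theta> T \<omega>)"
proof (cases k)
  case Q_Function
  have "bounded_law (3 * estimate_bound) (\<Sum>j. \<gamma> ^ j * reward i (\<omega> (T + j))) (Q_hat_law G i T \<omega>)"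
    using Q_hat_law_bounded[OF w, of i T] estimate_bound_nonneg unfolding bounded_law_def by (auto elim: eventually_mono)
  then show ?thesis by (simp add: Q_Function mean_reward_estimate_def R_hat_law_def)
next
  case Advantage
  let ?v = "Vval \<theta> i (fst (\<omega> T))" and ?Q = "Q_hat_law G i T \<omega>" and ?V = "V_hat_law G i \<theta> (fst (\<omega> T))"
  note Q = Q_hat_law_bounded[OF w, of i T] and V = V_hat_law_bounded[OF fst_path_space[OF w], of \<theta> i T]
  have Qs: "?Q \<in> space (prob_algebra borel)" and Vs: "?V \<in> space (prob_algebra borel)"
    using Q V by (auto simp: bounded_law_def)
  interpret prob_space ?Q using Qs by (simp add: space_prob_algebra)
  have "bounded_law (3 * estimate_bound) (\<integral>q. q - ?v \<partial>?Q) (?Q \<bind> (\<lambda>q. ?V \<bind> (\<lambda>v. return borel (q - v))))"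
  proof (rule bounded_law_bind[OF Qs])
    show "(\<lambda>q. ?V \<bind> (\<lambda>v. return borel (q - v))) \<in> borel \<rightarrow>\<^sub>M prob_algebra borel"
      by (rule measurable_bind_prob_space2[OF measurable_const[OF Vs]], unfold case_prod_unfold,
          rule return_borel_measurable) measurable
    have "AE q in ?Q. \<bar>q\<bar> \<le> estimate_bound" using Q by (simp add: bounded_law_def)
    then show "AE q in ?Q. bounded_law (3 * estimate_bound) (q - ?v) (?V \<bind> (\<lambda>v. return borel (q - v)))"
    proof eventually_elim
      case (elim q)
      have "bounded_law (3 * estimate_bound) (q + (- 1) * ?v) (?V \<bind> (\<lambda>v. return borel (q + (- 1) * v)))"
        by (rule bounded_law_affine[OF V]) (use elim estimate_bound_nonneg in simp)
      then show ?case by simp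
    qed
  qed measurable
  moreover have "(\<integral>q. q - ?v \<partial>?Q) = mean_reward_estimate k i \<theta> T \<omega>"
    using bounded_law_integrable[OF Q] Q prob_space by (simp add: bounded_law_def mean_reward_estimate_def Advantage)
  ultimately show ?thesis by (simp add: R_hat_law_def Advantage)
next
  case Temporal_Difference
  let ?v = "Vval \<theta> i (fst (\<omega> T))" and ?v' = "Vval \<theta> i (fst (\<omega> (Suc T)))" and ?r = "reward i (\<omega> T)"
  let ?W = "V_hat_law G i \<theta> (fst (\<omega> (Suc T)))" and ?V = "V_hat_law G i \<theta> (fst (\<omega> T))"
  note W = V_hat_law_bounded[OF fst_path_space[OF w], of \<theta> i "Suc T"] and V = V_hat_law_bounded[OF fst_path_space[OF w], of \<theta> i T]
  have Ws: "?W \<in> space (prob_algebra borel)" and Vs: "?V \<in> space (prob_algebra borel)"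
    using W V by (auto simp: bounded_law_def)
  interpret prob_space ?W using Ws by (simp add: space_prob_algebra)
  have "bounded_law (3 * estimate_bound) (\<integral>x. ?r + \<gamma> * x - ?v \<partial>?W) (?W \<bind> (\<lambda>x. ?V \<bind> (\<lambda>v. return borel (?r + \<gamma> * x - v))))"
  proof (rule bounded_law_bind[OF Ws])
    show "(\<lambda>x. ?V \<bind> (\<lambda>v. return borel (?r + \<gamma> * x - v))) \<in> borel \<rightarrow>\<^sub>M prob_algebra borel"
      by (rule measurable_bind_prob_space2[OF measurable_const[OF Vs]], unfold case_prod_unfold,
          rule return_borel_measurable) measurable
    have "AE x in ?W. \<bar>x\<bar> \<le> estimate_bound" using W unfolding bounded_law_def by blast
    then show "AE x in ?W. bounded_law (3 * estimate_bound) (?r + \<gamma> * x - ?v) (?V \<bind> (\<lambda>v. return borel (?r + \<gamma> * x - v)))"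
    proof eventually_elim
      case (elim x)
      have gx: "\<bar>\<gamma> * x\<bar> \<le> \<bar>x\<bar>" unfolding abs_mult abs_of_pos[OF disc_pos]
        by (rule mult_left_le_one_le) (auto simp: less_imp_le)
      have "\<bar>?r + \<gamma> * x\<bar> \<le> estimate_bound + estimate_bound"
        using gx elim reward_bound[OF w, of i T] R_le_estimate_bound by linarith
      then have "bounded_law (3 * estimate_bound) ((?r + \<gamma> * x) + (- 1) * ?v) (?V \<bind> (\<lambda>v. return borel ((?r + \<gamma> * x) + (- 1) * v)))"
        by (intro bounded_law_affine[OF V]) simp
      then show ?case by simp
    qed
  qed measurable
  moreover have "(\<integral>x. ?r + \<gamma> * x - ?v \<partial>?W) = mean_reward_estimate k i \<theta> T \<omega>"
    using bounded_law_integrable[OF W] W prob_space by (simp add: bounded_law_def mean_reward_estimate_def Temporal_Difference)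
  ultimately show ?thesis by (simp add: R_hat_law_def Temporal_Difference reward_at_def reward_def)
qed

text \<open>All three variants agree after weighting with the score. A baseline that depends on the
  state only is multiplied by a score of conditional mean zero, and for the temporal difference the
  Bellman equation restores the Q-function.\<close>

lemma traj_score_mean_reward:
  fixes d :: "real ^ 'm"
  shows "(\<integral>\<omega>. (d \<bullet> jscore \<theta> (\<omega> T)) * mean_reward_estimate k i \<theta> T \<omega> \<partial>traj G \<theta> (init G)) = score_Q i \<theta> T d"
proof -
  let ?tr = "traj G \<theta> (init G)" and ?\<psi> = "\<lambda>x. d \<bullet> jscore \<theta> x"
  note tin = traj_in_space[OF init_space, of \<theta>]
  have pm: "?\<psi> \<in> borel_measurable SA" by measurable
  have pi: "integrable ?tr (\<lambda>\<omega>. ?\<psi> (\<omega> T))" by (rule integrable_traj_score(2)[OF init_space])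
  have bs: "bounded_fun paths (R / (1 - \<gamma>)) (\<lambda>\<omega>. \<Sum>j. \<gamma> ^ j * reward i (\<omega> (T + j)))"
    by (rule bounded_fun_discounted_sum(1)[OF bounded_fun_path_reward disc_pos disc_less_1])
  have bv: "bounded_fun paths (R / (1 - \<gamma>)) (\<lambda>\<omega>. Vval \<theta> i (fst (\<omega> t)))" for t
    by (rule bounded_fun_compose[OF bounded_fun_Vval fst_path_measurable])
  note ii = integrable_traj_score(3)[OF init_space, where \<theta>=\<theta> and d=d and t=T]
  have Q: "(\<integral>\<omega>. ?\<psi> (\<omega> T) * (\<Sum>j. \<gamma> ^ j * reward i (\<omega> (T + j))) \<partial>?tr) = score_Q i \<theta> T d"
  proof -
    have b: "bounded_fun SA R ((trans_avg \<theta> ^^ j) (reward i))" for j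
      by (rule bounded_fun_trans_avg_power[OF bounded_fun_reward])
    have "(\<integral>\<omega>. ?\<psi> (\<omega> T) * (\<Sum>j. \<gamma> ^ j * reward i (\<omega> (T + j))) \<partial>?tr) =
        (\<Sum>j. \<gamma> ^ j * (\<integral>\<omega>. ?\<psi> (\<omega> T) * reward i (\<omega> (T + j)) \<partial>?tr))"
      by (rule integral_weighted_discounted_sum[OF bounded_fun_path_reward disc_pos disc_less_1 tin pi])
    also have "\<dots> = (\<Sum>j. \<gamma> ^ j * (\<integral>\<omega>. ?\<psi> (\<omega> T) * (trans_avg \<theta> ^^ j) (reward i) (\<omega> T) \<partial>?tr))"
      by (simp only: traj_integral_add[OF init_space pm pi bounded_fun_reward])
    also have "\<dots> = score_Q i \<theta> T d"
      unfolding score_Q_def Qval_def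
      by (rule integral_weighted_discounted_sum[OF bounded_fun_compose[OF b path_component_measurable] disc_pos disc_less_1 tin pi, symmetric])
    finally show ?thesis .
  qed
  \<comment> \<open>Given the state the baseline is constant and factors out of the action average,
    which leaves the vanishing mean of the score.\<close>
  have V0: "(\<integral>\<omega>. ?\<psi> (\<omega> T) * Vval \<theta> i (fst (\<omega> T)) \<partial>?tr) = 0"
  proof -
    have m: "(\<lambda>x. ?\<psi> x * Vval \<theta> i (fst x)) \<in> borel_measurable SA" by measurable
    have "(\<integral>\<omega>. ?\<psi> (\<omega> T) * Vval \<theta> i (fst (\<omega> T)) \<partial>?tr) = (\<integral>\<omega>. act_avg \<theta> (\<lambda>x. ?\<psi> x * Vval \<theta> i (fst x)) (fst (\<omega> T)) \<partial>?tr)"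
      by (rule traj_integral_act_avg[OF init_space m ii[OF bv]])
    also have "\<dots> = (\<integral>\<omega>. 0 \<partial>?tr)"
    proof (rule Bochner_Integration.integral_cong[OF refl])
      fix \<omega> assume "\<omega> \<in> space ?tr"
      then have "\<omega> \<in> space paths" using sets_eq_imp_space_eq[OF sets_traj[OF init_space]] by blast
      then have w: "fst (\<omega> T) \<in> space (states G)" by (rule fst_path_space)
      have "act_avg \<theta> (\<lambda>x. ?\<psi> x * Vval \<theta> i (fst x)) (fst (\<omega> T)) =
          (\<integral>a. joint_pol \<theta> (fst (\<omega> T)) a * (?\<psi> (fst (\<omega> T), a)) * Vval \<theta> i (fst (\<omega> T)) \<partial>joint_ref G)"
        unfolding act_avg_density[OF w m] by (simp add: mult.assoc)
      also have "\<dots> = act_avg \<theta> ?\<psi> (fst (\<omega> T)) * Vval \<theta> i (fst (\<omega> T))"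
        unfolding act_avg_density[OF w pm] by (rule integral_mult_left_zero)
      finally show "act_avg \<theta> (\<lambda>x. ?\<psi> x * Vval \<theta> i (fst x)) (fst (\<omega> T)) = 0"
        by (simp add: act_avg_score_zero[OF w])
    qed
    finally show ?thesis by simp
  qed
  show ?thesis
  proof (cases k)
    case Q_Function
    then show ?thesis using Q by (simp add: mean_reward_estimate_def)
  next
    case Advantage
    then show ?thesis
      using Q V0 Bochner_Integration.integral_diff[OF ii[OF bs] ii[OF bv[of T]]]
      by (simp add: mean_reward_estimate_def right_diff_distrib)
  next
    case Temporal_Difference
    have br: "bounded_fun paths R (\<lambda>\<omega>. reward i (\<omega> T))" by (rule bounded_fun_path_reward)
    \<comment> \<open>The value at the next state is replaced by its conditional mean given the
      current pair, the form in which it occurs in the Bellman equation.\<close>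
    have n: "(\<integral>\<omega>. ?\<psi> (\<omega> T) * Vval \<theta> i (fst (\<omega> (Suc T))) \<partial>?tr) = (\<integral>\<omega>. ?\<psi> (\<omega> T) * next_avg (Vval \<theta> i) (\<omega> T) \<partial>?tr)"
      by (rule traj_integral_next_state[OF init_space pm pi bounded_fun_Vval])
    have bn: "bounded_fun paths (R / (1 - \<gamma>)) (\<lambda>\<omega>. next_avg (Vval \<theta> i) (\<omega> T))"
      by (rule bounded_fun_compose[OF bounded_fun_next_avg[OF bounded_fun_Vval] path_component_measurable])
    have "score_Q i \<theta> T d = (\<integral>\<omega>. ?\<psi> (\<omega> T) * reward i (\<omega> T) + \<gamma> * (?\<psi> (\<omega> T) * next_avg (Vval \<theta> i) (\<omega> T)) \<partial>?tr)"
      unfolding score_Q_def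
    proof (rule Bochner_Integration.integral_cong[OF refl])
      fix \<omega> assume "\<omega> \<in> space ?tr"
      then have "\<omega> T \<in> space SA" by (rule measurable_space[OF path_component_traj_measurable[OF init_space]])
      then show "?\<psi> (\<omega> T) * Qval \<theta> i (\<omega> T) = ?\<psi> (\<omega> T) * reward i (\<omega> T) + \<gamma> * (?\<psi> (\<omega> T) * next_avg (Vval \<theta> i) (\<omega> T))"
        by (simp add: Qval_Bellman distrib_left mult_ac)
    qed
    also have "\<dots> = (\<integral>\<omega>. ?\<psi> (\<omega> T) * reward i (\<omega> T) \<partial>?tr) + \<gamma> * (\<integral>\<omega>. ?\<psi> (\<omega> T) * next_avg (Vval \<theta> i) (\<omega> T) \<partial>?tr)"
      by (simp only: Bochner_Integration.integral_add[OF ii[OF br] integrable_mult_right[OF ii[OF bn]]] integral_mult_right_zero)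
    finally have S: "score_Q i \<theta> T d = (\<integral>\<omega>. ?\<psi> (\<omega> T) * reward i (\<omega> T) \<partial>?tr) + \<gamma> * (\<integral>\<omega>. ?\<psi> (\<omega> T) * Vval \<theta> i (fst (\<omega> (Suc T))) \<partial>?tr)"
      unfolding n .
    have "(\<integral>\<omega>. ?\<psi> (\<omega> T) * mean_reward_estimate k i \<theta> T \<omega> \<partial>?tr) =
      (\<integral>\<omega>. ?\<psi> (\<omega> T) * reward i (\<omega> T) + \<gamma> * (?\<psi> (\<omega> T) * Vval \<theta> i (fst (\<omega> (Suc T)))) - ?\<psi> (\<omega> T) * Vval \<theta> i (fst (\<omega> T)) \<partial>?tr)"
      by (simp add: mean_reward_estimate_def Temporal_Difference algebra_simps)
    also have "\<dots> = (\<integral>\<omega>. ?\<psi> (\<omega> T) * reward i (\<omega> T) \<partial>?tr) + \<gamma> * (\<integral>\<omega>. ?\<psi> (\<omega> T) * Vval \<theta> i (fst (\<omega> (Suc T))) \<partial>?tr)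
         - (\<integral>\<omega>. ?\<psi> (\<omega> T) * Vval \<theta> i (fst (\<omega> T)) \<partial>?tr)"
      by (simp only: Bochner_Integration.integral_diff[OF Bochner_Integration.integrable_add[OF ii[OF br] integrable_mult_right[OF ii[OF bv]]] ii[OF bv]]
        Bochner_Integration.integral_add[OF ii[OF br] integrable_mult_right[OF ii[OF bv]]] integral_mult_right_zero)
    finally show ?thesis using S V0 by simp
  qed
qed

definition block_score_at where
  "block_score_at i \<theta> x = (\<Sum>n\<in>UNIV. score G i n \<theta> (fst x) (snd x n))"

lemma block_score_at_eq: "x \<in> space SA \<Longrightarrow> block_score_at i \<theta> x = block (own G) i (jscore \<theta> x)"
  unfolding block_score_at_def jscore_def joint_score_def linear_sum[OF linear_block]
  by (intro sum.cong refl block_score(2)[symmetric]) (auto simp: space_pair_measure)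

lemma block_score_at_measurable [measurable]: "block_score_at i \<theta> \<in> borel_measurable SA"
proof -
  have "(\<lambda>x. block (own G) i (jscore \<theta> x)) \<in> borel_measurable SA"
    by (rule measurable_compose[OF jscore_measurable borel_measurable_continuous_onI])
       (rule linear_continuous_on[OF bounded_linear_block])
  then show ?thesis by (rule measurable_cong[THEN iffD1, rotated]) (simp add: block_score_at_eq)
qed

definition scaled_score where "scaled_score i \<theta> r x = (1 / (1 - \<gamma>) * r) *\<^sub>R block_score_at i \<theta> x"

text \<open>Sampling is unfolded in the order time, path, reward estimate. Once time and path are
  given, the score is fixed and only the reward estimate is random.\<close>

definition estimator_given_path where
  "estimator_given_path k i \<theta> T \<omega> = R_hat_law G k i \<theta> T \<omega> \<bind> (\<lambda>r. return borel (scaled_score i \<theta> r (\<omega> T)))"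

definition estimator_given_time where
  "estimator_given_time k i \<theta> T = traj G \<theta> (init G) \<bind> estimator_given_path k i \<theta> T"

lemma grad_estimator_law_eq:
  "grad_estimator_law G k i \<theta> = measure_pmf (geometric_pmf (1 - \<gamma>)) \<bind> estimator_given_time k i \<theta>"
  by (simp add: grad_estimator_law_def estimator_given_time_def[abs_def] estimator_given_path_def[abs_def] scaled_score_def block_score_at_def)

lemma scaled_score_kernel: "(\<lambda>(\<omega>, r). return borel (scaled_score i \<theta> r (\<omega> T))) \<in> paths \<Otimes>\<^sub>M borel \<rightarrow>\<^sub>M prob_algebra borel"
  unfolding case_prod_unfold scaled_score_def by (rule return_borel_measurable) measurable

lemma estimator_given_path_measurable [measurable]: "estimator_given_path k i \<theta> T \<in> paths \<rightarrow>\<^sub>M prob_algebra borel"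
  unfolding estimator_given_path_def[abs_def]
  by (rule measurable_bind_prob_space2[OF R_hat_law_measurable scaled_score_kernel])

lemma estimator_given_time_in_space: "estimator_given_time k i \<theta> T \<in> space (prob_algebra borel)"
  unfolding estimator_given_time_def
  using prob_space_bind'[OF traj_in_space[OF init_space] estimator_given_path_measurable]
    sets_bind'[OF traj_in_space[OF init_space] estimator_given_path_measurable]
  by (simp add: space_prob_algebra)

lemma grad_estimator_law_in_space: "grad_estimator_law G k i \<theta> \<in> space (prob_algebra borel)"
proof -
  have "estimator_given_time k i \<theta> \<in> count_space UNIV \<rightarrow>\<^sub>M prob_algebra borel"
    by (simp add: estimator_given_time_in_space)
  from prob_space_bind'[OF measure_pmf_in_prob_algebra this] sets_bind'[OF measure_pmf_in_prob_algebra this]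
  show ?thesis unfolding grad_estimator_law_eq by (simp add: space_prob_algebra)
qed

definition estimator_second_moment :: real where "estimator_second_moment = (1 / (1 - \<gamma>) * (3 * estimate_bound))\<^sup>2 * score_bound"

lemma estimator_second_moment_nonneg: "0 \<le> estimator_second_moment" by (simp add: estimator_second_moment_def score_bound_nonneg)

text \<open>The reward estimate is almost surely bounded, so it contributes a constant factor and
  the second moment of the score does the rest, at each recording time with the same bound.\<close>

lemma estimator_given_time_second_moment:
  "(\<integral>\<^sup>+x. ennreal ((norm x)\<^sup>2) \<partial>estimator_given_time k i \<theta> T) \<le> ennreal estimator_second_moment"
proof -
  let ?c = "(1 / (1 - \<gamma>) * (3 * estimate_bound))\<^sup>2" and ?tr = "traj G \<theta> (init G)"
  have nm: "(\<lambda>x :: real ^ 'm. ennreal ((norm x)\<^sup>2)) \<in> borel_measurable borel" by measurable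
  have trs: "sets ?tr = sets paths" by (rule sets_traj[OF init_space])
  have K: "estimator_given_path k i \<theta> T \<in> ?tr \<rightarrow>\<^sub>M subprob_algebra borel"
    using measurable_prob_algebraD[OF estimator_given_path_measurable] measurable_cong_sets[OF trs refl] by blast
  have jm: "(\<lambda>\<omega>. ennreal ((norm (jscore \<theta> (\<omega> T)))\<^sup>2)) \<in> borel_measurable ?tr"
    by (rule measurable_compose[OF path_component_traj_measurable[OF init_space]]) measurable
  have c0: "0 \<le> 1 / (1 - \<gamma>)" using one_minus_disc_pos by (intro divide_nonneg_pos) simp_all
  have inner: "(\<integral>\<^sup>+x. ennreal ((norm x)\<^sup>2) \<partial>estimator_given_path k i \<theta> T \<omega>) \<le> ennreal ?c * ennreal ((norm (jscore \<theta> (\<omega> T)))\<^sup>2)"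
    if w: "\<omega> \<in> space paths" for \<omega>
  proof -
    have bl: "R_hat_law G k i \<theta> T \<omega> \<in> space (prob_algebra borel)" "AE r in R_hat_law G k i \<theta> T \<omega>. \<bar>r\<bar> \<le> 3 * estimate_bound"
      using R_hat_law_bounded[OF w, of k i \<theta> T] by (auto simp: bounded_law_def)
    have sR: "sets (R_hat_law G k i \<theta> T \<omega>) = sets borel" using bl(1) by (simp add: space_prob_algebra)
    interpret prob_space "R_hat_law G k i \<theta> T \<omega>" using bl(1) by (simp add: space_prob_algebra)
    have K2: "(\<lambda>r. return borel (scaled_score i \<theta> r (\<omega> T))) \<in> R_hat_law G k i \<theta> T \<omega> \<rightarrow>\<^sub>M subprob_algebra borel"
      using measurable_prob_algebraD[OF measurable_Pair2[OF scaled_score_kernel w, of i \<theta> T]] measurable_cong_sets[OF sR refl] by auto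
    have nb: "norm (block_score_at i \<theta> (\<omega> T)) \<le> norm (jscore \<theta> (\<omega> T))"
      unfolding block_score_at_eq[OF paths_space[OF w]] by (rule norm_block_le)
    have "(\<integral>\<^sup>+x. ennreal ((norm x)\<^sup>2) \<partial>estimator_given_path k i \<theta> T \<omega>) =
        (\<integral>\<^sup>+r. ennreal ((norm (scaled_score i \<theta> r (\<omega> T)))\<^sup>2) \<partial>R_hat_law G k i \<theta> T \<omega>)"
      unfolding estimator_given_path_def
      by (subst nn_integral_bind[OF nm K2]) (simp add: nn_integral_return)
    also have "\<dots> \<le> (\<integral>\<^sup>+r. ennreal ?c * ennreal ((norm (jscore \<theta> (\<omega> T)))\<^sup>2) \<partial>R_hat_law G k i \<theta> T \<omega>)"
      using bl(2)
    proof (intro nn_integral_mono_AE, eventually_elim)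
      case (elim r)
      have "norm (scaled_score i \<theta> r (\<omega> T)) \<le> (1 / (1 - \<gamma>) * (3 * estimate_bound)) * norm (jscore \<theta> (\<omega> T))"
        unfolding scaled_score_def norm_scaleR abs_mult abs_of_nonneg[OF c0]
        by (rule mult_mono[OF mult_left_mono[OF elim(2) c0] nb]) (rule mult_nonneg_nonneg[OF c0], use estimate_bound_nonneg in simp_all)
      then have "(norm (scaled_score i \<theta> r (\<omega> T)))\<^sup>2 \<le> ((1 / (1 - \<gamma>) * (3 * estimate_bound)) * norm (jscore \<theta> (\<omega> T)))\<^sup>2"
        by (rule power_mono) simp
      then have "ennreal ((norm (scaled_score i \<theta> r (\<omega> T)))\<^sup>2) \<le> ennreal (?c * (norm (jscore \<theta> (\<omega> T)))\<^sup>2)"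
        by (intro ennreal_leI) (simp only: power_mult_distrib)
      then show ?case by (simp only: ennreal_mult zero_le_power2)
    qed
    also have "\<dots> = ennreal ?c * ennreal ((norm (jscore \<theta> (\<omega> T)))\<^sup>2)"
      by (simp only: nn_integral_const emeasure_space_1 mult_1_right)
    finally show ?thesis .
  qed
  have "(\<integral>\<^sup>+x. ennreal ((norm x)\<^sup>2) \<partial>estimator_given_time k i \<theta> T) =
      (\<integral>\<^sup>+\<omega>. (\<integral>\<^sup>+x. ennreal ((norm x)\<^sup>2) \<partial>estimator_given_path k i \<theta> T \<omega>) \<partial>?tr)"
    unfolding estimator_given_time_def by (rule nn_integral_bind[OF nm K])
  also have "\<dots> \<le> (\<integral>\<^sup>+\<omega>. ennreal ?c * ennreal ((norm (jscore \<theta> (\<omega> T)))\<^sup>2) \<partial>?tr)"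
    by (rule nn_integral_mono, rule inner) (use sets_eq_imp_space_eq[OF trs] in blast)
  also have "\<dots> = ennreal ?c * (\<integral>\<^sup>+\<omega>. ennreal ((norm (jscore \<theta> (\<omega> T)))\<^sup>2) \<partial>?tr)"
    by (rule nn_integral_cmult[OF jm])
  also have "\<dots> \<le> ennreal ?c * ennreal score_bound"
    by (rule mult_left_mono[OF traj_score_second_moment[OF init_space]]) simp
  also have "\<dots> = ennreal estimator_second_moment" unfolding estimator_second_moment_def by (rule ennreal_mult[symmetric]) (simp_all add: score_bound_nonneg)
  finally show ?thesis .
qed

lemma grad_estimator_law_second_moment:
  "(\<integral>\<^sup>+x. ennreal ((norm x)\<^sup>2) \<partial>grad_estimator_law G k i \<theta>) \<le> ennreal estimator_second_moment"
proof -
  have "(\<integral>\<^sup>+x. ennreal ((norm x)\<^sup>2) \<partial>grad_estimator_law G k i \<theta>) =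
     (\<integral>\<^sup>+T. (\<integral>\<^sup>+x. ennreal ((norm x)\<^sup>2) \<partial>estimator_given_time k i \<theta> T) \<partial>measure_pmf (geometric_pmf (1 - \<gamma>)))"
    unfolding grad_estimator_law_eq
  proof (rule nn_integral_bind)
    show "estimator_given_time k i \<theta> \<in> measure_pmf (geometric_pmf (1 - \<gamma>)) \<rightarrow>\<^sub>M subprob_algebra borel"
      using estimator_given_time_in_space
      by (auto simp: space_prob_algebra space_subprob_algebra intro: prob_space_imp_subprob_space)
  qed measurable
  also have "\<dots> \<le> (\<integral>\<^sup>+T. ennreal estimator_second_moment \<partial>measure_pmf (geometric_pmf (1 - \<gamma>)))"
    by (rule nn_integral_mono) (rule estimator_given_time_second_moment)
  also have "\<dots> = ennreal estimator_second_moment" by (simp add: measure_pmf.emeasure_space_1)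
  finally show ?thesis .
qed

lemma integrable_nth_of_second_moment:
  fixes N :: "(real ^ 'm) measure"
  assumes N: "N \<in> space (prob_algebra borel)" and b: "(\<integral>\<^sup>+x. ennreal ((norm x)\<^sup>2) \<partial>N) \<le> ennreal c"
  shows "integrable N (\<lambda>x. x $ m)"
proof -
  interpret prob_space N using N by (simp add: space_prob_algebra)
  have sN: "sets N = sets borel" using N by (simp add: space_prob_algebra)
  have [measurable]: "(\<lambda>x. x) \<in> borel_measurable N" by (rule measurable_ident_sets[OF sN])
  have i: "integrable N (\<lambda>x. (norm x)\<^sup>2)"
    by (rule integrableI_nonneg) (use le_less_trans[OF b] in auto)
  show ?thesis
  proof (rule Bochner_Integration.integrable_bound[of N "\<lambda>x. 1 + (norm x)\<^sup>2"])
    show "integrable N (\<lambda>x. 1 + (norm x)\<^sup>2)" using i by simp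
    show "(\<lambda>x. x $ m) \<in> borel_measurable N" by (simp add: cart_eq_inner_axis)
    have "\<bar>x $ m\<bar> \<le> 1 + (norm x)\<^sup>2" for x :: "real ^ 'm"
      using component_le_norm_cart[of x m] le_one_plus_square[of "norm x"] by linarith
    then show "AE x in N. norm (x $ m) \<le> norm (1 + (norm x)\<^sup>2)" by simp
  qed
qed

text \<open>The geometric recording time produces the discounted sum over times in the policy
  gradient formula, and the prefactor of the estimator removes the normalisation of the geometric
  law.\<close>

lemma grad_estimator_law_mean:
  shows "integrable (grad_estimator_law G k i \<theta>) (\<lambda>x. x $ m)"
    and "(\<integral>x. x $ m \<partial>grad_estimator_law G k i \<theta>) = block (own G) i (value_grad i \<theta>) $ m"
proof -
  let ?tr = "traj G \<theta> (init G)" and ?g = "geometric_pmf (1 - \<gamma>)" and ?c = "1 / (1 - \<gamma>)"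
  \<comment> \<open>The direction is zero for coordinates outside the block, so that both cases run
    through one computation.\<close>
  let ?d = "if own G m = i then axis m 1 else 0 :: real ^ 'm"
  note tin = traj_in_space[OF init_space, of \<theta>]
  have trs: "space ?tr = space paths" using sets_eq_imp_space_eq[OF sets_traj[OF init_space]] .
  have eK: "estimator_given_time k i \<theta> \<in> count_space UNIV \<rightarrow>\<^sub>M prob_algebra borel"
    by (simp add: estimator_given_time_in_space)
  show i: "integrable (grad_estimator_law G k i \<theta>) (\<lambda>x. x $ m)"
    by (rule integrable_nth_of_second_moment[OF grad_estimator_law_in_space grad_estimator_law_second_moment])
  have iT: "integrable (estimator_given_time k i \<theta> T) (\<lambda>x. x $ m)" for T
    by (rule integrable_nth_of_second_moment[OF estimator_given_time_in_space estimator_given_time_second_moment])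
  have path: "(\<integral>x. x $ m \<partial>estimator_given_path k i \<theta> T \<omega>) = ?c * ((?d \<bullet> jscore \<theta> (\<omega> T)) * mean_reward_estimate k i \<theta> T \<omega>)"
    if w: "\<omega> \<in> space ?tr" for T \<omega>
  proof -
    have w: "\<omega> \<in> space paths" using w trs by simp
    note bl = R_hat_law_bounded[OF w, of k i \<theta> T]
    have Rs: "R_hat_law G k i \<theta> T \<omega> \<in> space (prob_algebra borel)"
      and Rm: "(\<integral>r. r \<partial>R_hat_law G k i \<theta> T \<omega>) = mean_reward_estimate k i \<theta> T \<omega>" using bl by (auto simp: bounded_law_def)
    have sR: "sets (R_hat_law G k i \<theta> T \<omega>) = sets borel" using Rs by (simp add: space_prob_algebra)
    have sm: "(\<lambda>r. scaled_score i \<theta> r (\<omega> T)) \<in> borel_measurable (R_hat_law G k i \<theta> T \<omega>)"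
      unfolding scaled_score_def measurable_cong_sets[OF sR refl] by measurable
    have e: "estimator_given_path k i \<theta> T \<omega> = distr (R_hat_law G k i \<theta> T \<omega>) borel (\<lambda>r. scaled_score i \<theta> r (\<omega> T))"
      unfolding estimator_given_path_def
      by (rule bind_return_distr'[OF _ sm]) (simp add: sets_eq_imp_space_eq[OF sR])
    have cm: "(\<lambda>x :: real ^ 'm. x $ m) \<in> borel_measurable borel" by (simp add: cart_eq_inner_axis)
    have dj: "block_score_at i \<theta> (\<omega> T) $ m = ?d \<bullet> jscore \<theta> (\<omega> T)"
      unfolding block_score_at_eq[OF paths_space[OF w]] by (simp add: block_nth inner_axis')
    have "(\<integral>x. x $ m \<partial>estimator_given_path k i \<theta> T \<omega>) = (\<integral>r. r * (?c * (?d \<bullet> jscore \<theta> (\<omega> T))) \<partial>R_hat_law G k i \<theta> T \<omega>)"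
      unfolding e integral_distr[OF sm cm]
      by (rule Bochner_Integration.integral_cong[OF refl]) (simp only: scaled_score_def vector_scaleR_component dj real_scaleR_def mult_ac)
    also have "\<dots> = mean_reward_estimate k i \<theta> T \<omega> * (?c * (?d \<bullet> jscore \<theta> (\<omega> T)))"
      by (simp only: integral_mult_left_zero Rm)
    finally show ?thesis by (simp only: mult_ac)
  qed
  have time: "(\<integral>x. x $ m \<partial>estimator_given_time k i \<theta> T) = ?c * score_Q i \<theta> T ?d" for T
  proof -
    have "(\<integral>x. x $ m \<partial>estimator_given_time k i \<theta> T) = (\<integral>\<omega>. (\<integral>x. x $ m \<partial>estimator_given_path k i \<theta> T \<omega>) \<partial>?tr)"
      unfolding estimator_given_time_def
      by (rule integrable_integral_bind(2)[OF tin estimator_given_path_measurable iT[unfolded estimator_given_time_def]])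
    also have "\<dots> = (\<integral>\<omega>. ?c * ((?d \<bullet> jscore \<theta> (\<omega> T)) * mean_reward_estimate k i \<theta> T \<omega>) \<partial>?tr)"
      by (rule Bochner_Integration.integral_cong[OF refl path])
    also have "\<dots> = ?c * score_Q i \<theta> T ?d"
      by (simp only: integral_mult_right_zero traj_score_mean_reward)
    finally show ?thesis .
  qed
  have cb: "\<bar>?c * score_Q i \<theta> T ?d\<bar> \<le> ?c * (norm ?d * value_bound * score_weight_mass)" for T
    unfolding abs_mult abs_of_pos[OF divide_pos_pos[OF zero_less_one one_minus_disc_pos]]
    by (rule mult_left_mono[OF score_Q_bound less_imp_le[OF divide_pos_pos[OF zero_less_one one_minus_disc_pos]]])
  have "(\<integral>x. x $ m \<partial>grad_estimator_law G k i \<theta>) = (\<integral>T. ?c * score_Q i \<theta> T ?d \<partial>measure_pmf ?g)"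
    unfolding grad_estimator_law_eq
    unfolding integrable_integral_bind(2)[OF measure_pmf_in_prob_algebra eK i[unfolded grad_estimator_law_eq]] time ..
  moreover have "(\<lambda>T. \<gamma> ^ T * (1 - \<gamma>) * (?c * score_Q i \<theta> T ?d)) sums (\<integral>T. ?c * score_Q i \<theta> T ?d \<partial>measure_pmf ?g)"
    by (rule geometric_expectation[OF disc_pos disc_less_1 cb])
  \<comment> \<open>The weight \<open>1 - \<gamma>\<close> of the geometric law cancels against the
    prefactor \<open>?c\<close>.\<close>
  moreover have "\<gamma> ^ T * (1 - \<gamma>) * (?c * score_Q i \<theta> T ?d) = \<gamma> ^ T * score_Q i \<theta> T ?d" for T
    using one_minus_disc_pos by (simp add: less_imp_neq[symmetric])
  moreover have "?d \<bullet> value_grad i \<theta> = block (own G) i (value_grad i \<theta>) $ m"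
    by (simp add: block_nth inner_axis')
  ultimately show "(\<integral>x. x $ m \<partial>grad_estimator_law G k i \<theta>) = block (own G) i (value_grad i \<theta>) $ m"
    using value_grad_sums[of i \<theta> ?d] by (simp only: sums_unique2)
qed

end

section \<open>The potential\<close>

lemma GDERIV_of_quadratic_expansion:
  fixes f :: "'a::real_inner \<Rightarrow> real"
  assumes "\<And>y. \<bar>f y - f x - (y - x) \<bullet> D\<bar> \<le> K * (norm (y - x))\<^sup>2"
  shows "GDERIV f x :> D"
  unfolding gderiv_def has_derivative_iff_norm
proof
  show "bounded_linear (\<lambda>h. h \<bullet> D)" by (rule bounded_linear_inner_left)
  show "(\<lambda>y. norm (f y - f x - (y - x) \<bullet> D) / norm (y - x)) \<midarrow>x\<rightarrow> 0"
  proof (rule Lim_null_comparison)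
    show "\<forall>\<^sub>F y in at x. norm (norm (f y - f x - (y - x) \<bullet> D) / norm (y - x)) \<le> K * norm (y - x)"
      using assms by (intro always_eventually allI) (simp add: divide_simps power2_eq_square mult_ac)
    have "((\<lambda>y. K * norm (y - x)) \<longlongrightarrow> K * norm (x - x)) (at x)" by (intro tendsto_intros)
    then show "((\<lambda>y. K * norm (y - x)) \<longlongrightarrow> 0) (at x)" by simp
  qed
qed

text \<open>The expansions based at \<open>x\<close> and at \<open>y\<close> are compared at a third
  point \<open>y + w\<close>. All values of \<open>f\<close> cancel, and what remains is the inner
  product of the gradient difference with \<open>w\<close>.\<close>

lemma Lipschitz_of_quadratic_expansion:
  fixes f :: "'a::real_inner \<Rightarrow> real"
  assumes q: "\<And>x y. \<bar>f y - f x - (y - x) \<bullet> D x\<bar> \<le> K * (norm (y - x))\<^sup>2" and K: "0 \<le> K"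
  shows "norm (D y - D x) \<le> 6 * K * norm (y - x)"
proof (cases "D y = D x \<or> y = x")
  case False
  define h where "h = y - x"
  \<comment> \<open>The direction of the gradient difference extracts its norm; the length
    \<open>norm h\<close> keeps all three remainders comparable. They cost 4, 1 and 1 times
    \<open>K * (norm h)\<^sup>2\<close>, which gives the constant 6.\<close>
  define w where "w = (norm h / norm (D y - D x)) *\<^sub>R (D y - D x)"
  have n: "norm w = norm h" using False by (simp add: w_def)
  have "norm (h + w) \<le> 2 * norm h" using norm_triangle_ineq[of h w] n by simp
  then have "(norm (h + w))\<^sup>2 \<le> (2 * norm h)\<^sup>2" by (rule power_mono) simp
  then have hw: "K * (norm (h + w))\<^sup>2 \<le> K * (4 * (norm h)\<^sup>2)" using K by (intro mult_left_mono) auto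
  have "(D y - D x) \<bullet> w = (f (y + w) - f x - ((y + w) - x) \<bullet> D x) - (f (y + w) - f y - ((y + w) - y) \<bullet> D y) - (f y - f x - (y - x) \<bullet> D x)"
    by (simp add: inner_diff_left inner_add_left inner_diff_right inner_commute algebra_simps)
  moreover have "\<bar>f (y + w) - f x - ((y + w) - x) \<bullet> D x\<bar> \<le> K * (norm (h + w))\<^sup>2"
    using q[of "y + w" x] by (simp add: h_def algebra_simps)
  moreover have "\<bar>f (y + w) - f y - ((y + w) - y) \<bullet> D y\<bar> \<le> K * (norm h)\<^sup>2" using q[of "y + w" y] n by simp
  moreover have "\<bar>f y - f x - (y - x) \<bullet> D x\<bar> \<le> K * (norm h)\<^sup>2" using q[of y x] by (simp add: h_def)
  ultimately have "(D y - D x) \<bullet> w \<le> 6 * K * (norm h)\<^sup>2" using hw by linarith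
  moreover have "(D y - D x) \<bullet> w = norm h * norm (D y - D x)"
    using False by (simp add: w_def power2_norm_eq_inner[symmetric] power2_eq_square)
  ultimately have "norm h * norm (D y - D x) \<le> norm h * (6 * K * norm h)" by (simp add: power2_eq_square mult_ac)
  then show ?thesis using False by (simp add: h_def mult_le_cancel_left)
qed (use K in auto)

text \<open>Along a line inside one block the difference of the two functions has derivative zero.
  Infinitesimal information is thereby turned into equality of increments over any distance.\<close>

lemma block_difference_eq:
  fixes f g :: "real ^ 'm::finite \<Rightarrow> real"
  assumes "\<And>\<theta>. block_differentiable b i f \<theta>" "\<And>\<theta>. block_differentiable b i g \<theta>"
    and eq: "\<And>\<theta>. block_grad b i f \<theta> = block_grad b i g \<theta>"
  shows "f (\<theta> + block b i h) - f \<theta> = g (\<theta> + block b i h) - g \<theta>"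
proof -
  let ?F = "\<lambda>\<tau>. f (\<theta> + \<tau> *\<^sub>R block b i h) - g (\<theta> + \<tau> *\<^sub>R block b i h)"
  have "\<forall>\<tau>. DERIV ?F \<tau> :> 0"
    using DERIV_diff[OF has_real_derivative_block_line[OF assms(1), of \<theta> h] has_real_derivative_block_line[OF assms(2), of \<theta> h]]
    by (simp add: eq)
  from DERIV_isconst_all[OF this, of 1 0] show ?thesis by simp
qed

text \<open>Separates the passage from utilities to potential from the game. About \<open>u\<close>
  itself only increments within single blocks are known; its regularity has to come from the
  \<open>f i\<close>.\<close>

locale block_potential =
  fixes b :: "'m::finite \<Rightarrow> 'n::finite" and u :: "real ^ 'm \<Rightarrow> real"
    and f :: "'n \<Rightarrow> real ^ 'm \<Rightarrow> real" and v :: "'n \<Rightarrow> real ^ 'm \<Rightarrow> real ^ 'm" and K C :: real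
  assumes K: "0 \<le> K" and C: "0 \<le> C"
    and expansion: "\<And>i x y. \<bar>f i y - f i x - (y - x) \<bullet> v i x\<bar> \<le> K * (norm (y - x))\<^sup>2"
    and bounded: "\<And>i x. \<bar>f i x\<bar> \<le> C"
    and difference: "\<And>i x h. u (x + block b i h) - u x = f i (x + block b i h) - f i x"
begin

definition pgrad :: "real ^ 'm \<Rightarrow> real ^ 'm" where
  "pgrad x = (\<Sum>i\<in>UNIV. block b i (v i x))"

lemma pgrad_nth: "pgrad x $ m = v (b m) x $ m"
  by (simp add: pgrad_def block_nth)

lemma v_Lipschitz: "norm (v i y - v i x) \<le> 6 * K * norm (y - x)"
  by (rule Lipschitz_of_quadratic_expansion[OF expansion K])

lemma norm_sum_block_le: "norm (\<Sum>i\<in>I. block b i d) \<le> norm d"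
  by (rule norm_le_componentwise_cart) (simp add: block_nth sum.delta')

text \<open>Blocks are changed one after the other. Each change costs \<open>K\<close> for the
  expansion at the intermediate point and \<open>6 * K\<close> for moving the gradient from there
  back to \<open>x\<close>, together \<open>7 * K\<close>. The bound on the oscillation of
  \<open>u\<close> comes from the same pass.\<close>

lemma potential_partial_expansion:
  assumes "finite I"
  shows "\<bar>u (x + (\<Sum>i\<in>I. block b i d)) - u x - (\<Sum>i\<in>I. block b i d \<bullet> v i x)\<bar> \<le> real (card I) * (7 * K) * (norm d)\<^sup>2
    \<and> \<bar>u (x + (\<Sum>i\<in>I. block b i d)) - u x\<bar> \<le> real (card I) * (2 * C)"
  using assms
proof (induction I)
  case (insert j I)
  let ?z = "x + (\<Sum>i\<in>I. block b i d)" and ?d = "block b j d"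
  have z: "x + (\<Sum>i\<in>insert j I. block b i d) = ?z + ?d" using insert by (simp add: algebra_simps)
  have nd: "norm ?d \<le> norm d" by (rule norm_block_le)
  have "\<bar>f j (?z + ?d) - f j ?z - ?d \<bullet> v j ?z\<bar> \<le> K * (norm ?d)\<^sup>2" using expansion[of j "?z + ?d" ?z] by simp
  also have "\<dots> \<le> K * (norm d)\<^sup>2" using K nd by (intro mult_left_mono power_mono) auto
  finally have 1: "\<bar>u (?z + ?d) - u ?z - ?d \<bullet> v j ?z\<bar> \<le> K * (norm d)\<^sup>2" by (simp add: difference)
  have "norm (v j ?z - v j x) \<le> 6 * K * norm (\<Sum>i\<in>I. block b i d)" using v_Lipschitz[of j ?z x] by simp
  also have "\<dots> \<le> 6 * K * norm d" using K norm_sum_block_le[of d I] by (intro mult_left_mono) auto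
  finally have "\<bar>?d \<bullet> (v j ?z - v j x)\<bar> \<le> norm d * (6 * K * norm d)"
    using nd by (intro order_trans[OF Cauchy_Schwarz_ineq2 mult_mono]) auto
  then have 2: "\<bar>?d \<bullet> v j ?z - ?d \<bullet> v j x\<bar> \<le> 6 * K * (norm d)\<^sup>2"
    by (simp add: inner_diff_right power2_eq_square mult_ac)
  have "u (?z + ?d) - u ?z = f j (?z + ?d) - f j ?z" by (rule difference)
  then have 3: "\<bar>u (?z + ?d) - u ?z\<bar> \<le> 2 * C" using bounded[of j "?z + ?d"] bounded[of j ?z] by linarith
  have s: "(\<Sum>i\<in>insert j I. block b i d \<bullet> v i x) = ?d \<bullet> v j x + (\<Sum>i\<in>I. block b i d \<bullet> v i x)" using insert by simp
  have c: "real (card (insert j I)) = real (card I) + 1" using insert by simp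
  have "real (card (insert j I)) * (7 * K) * (norm d)\<^sup>2 = real (card I) * (7 * K) * (norm d)\<^sup>2 + K * (norm d)\<^sup>2 + 6 * K * (norm d)\<^sup>2"
    by (simp add: c algebra_simps)
  moreover have "real (card (insert j I)) * (2 * C) = real (card I) * (2 * C) + 2 * C" by (simp add: c algebra_simps)
  ultimately show ?case unfolding z s using 1 2 3 insert.IH by linarith
qed simp

lemma potential_expansion: "\<bar>u y - u x - (y - x) \<bullet> pgrad x\<bar> \<le> real CARD('n) * (7 * K) * (norm (y - x))\<^sup>2"
proof -
  have "(\<Sum>i\<in>UNIV. block b i (y - x) \<bullet> v i x) = (y - x) \<bullet> pgrad x"
    by (simp add: inner_block pgrad_def inner_sum_right)
  then show ?thesis
    using potential_partial_expansion[of UNIV x "y - x"] by (simp add: sum_block)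
qed

lemma potential_bounded: "\<bar>u y - u x\<bar> \<le> real CARD('n) * (2 * C)"
  using potential_partial_expansion[of UNIV x "y - x"] by (simp add: sum_block)

lemma grad_potential: "grad u x = pgrad x"
  by (rule grad_eqI[OF GDERIV_of_quadratic_expansion[OF potential_expansion]])

lemma pgrad_Lipschitz: "norm (pgrad y - pgrad x) \<le> 6 * (real CARD('n) * (7 * K)) * norm (y - x)"
  by (rule Lipschitz_of_quadratic_expansion[OF potential_expansion]) (use K in simp)

end

section \<open>Consensus\<close>

text \<open>Summing the recursion bounds the partial sums by the first \<open>W\<close> terms plus
  \<open>\<rho>\<close> times themselves, and \<open>\<rho> < 1\<close> solves this for
  them.\<close>

lemma summable_of_lagged_contraction:
  fixes z c :: "nat \<Rightarrow> real"
  assumes z: "\<And>t. 0 \<le> z t" and c: "summable c" "\<And>t. 0 \<le> c t" and \<rho>: "\<rho> < 1"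
    and lag: "\<And>t. z (t + W) \<le> \<rho> * z t + c t"
  shows "summable z"
proof (rule summableI_nonneg_bounded[OF z])
  fix n
  have s: "(\<Sum>t<n. z (t + W)) \<le> (\<Sum>t<n. \<rho> * z t + c t)" by (rule sum_mono) (rule lag)
  have cs: "(\<Sum>t<n. c t) \<le> suminf c" by (rule sum_le_suminf[OF c(1)]) (use c in auto)
  \<comment> \<open>The range is enlarged by \<open>W\<close> terms so that, after removing the
    first \<open>W\<close>, the shifted sum of the recursion appears.\<close>
  have "(\<Sum>t<n. z t) \<le> (\<Sum>t<n + W. z t)" by (rule sum_mono2) (use z in auto)
  also have "\<dots> = (\<Sum>t<W. z t) + (\<Sum>t<n. z (t + W))"
    using sum.nat_group[of z 1] sum.atLeastLessThan_concat[of 0 W "n + W" z] sum.shift_bounds_nat_ivl[of z 0 W n]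
    by (simp add: atLeast0LessThan add.commute)
  also have "\<dots> \<le> (\<Sum>t<W. z t) + (\<rho> * (\<Sum>t<n. z t) + suminf c)"
    using s cs by (simp add: sum.distrib sum_distrib_left)
  finally have "(1 - \<rho>) * (\<Sum>t<n. z t) \<le> (\<Sum>t<W. z t) + suminf c" by (simp add: algebra_simps)
  then show "(\<Sum>t<n. z t) \<le> ((\<Sum>t<W. z t) + suminf c) / (1 - \<rho>)"
    using \<rho> by (simp add: pos_le_divide_eq mult.commute)
qed

lemma summable_shifted_squares:
  fixes d :: "nat \<Rightarrow> real"
  assumes "summable (\<lambda>t. (d t)\<^sup>2)"
  shows "summable (\<lambda>t. (\<Sum>s<W. d (t + s))\<^sup>2)"
proof (rule summable_comparison_test'[of "\<lambda>t. (\<Sum>s<W. (d (t + s))\<^sup>2) * real (card {..<W})" 0])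
  show "summable (\<lambda>t. (\<Sum>s<W. (d (t + s))\<^sup>2) * real (card {..<W}))"
    by (intro summable_mult2 summable_sum) (use assms summable_iff_shift[of "\<lambda>t. (d t)\<^sup>2"] in simp)
  show "norm ((\<Sum>s<W. d (t + s))\<^sup>2) \<le> (\<Sum>s<W. (d (t + s))\<^sup>2) * real (card {..<W})" for t
    using sum_squared_le_sum_of_squares[of "\<lambda>s. d (t + s)" "{..<W}"] by simp
qed

text \<open>\<open>y t i\<close> is the distance of the estimate of agent \<open>i\<close> from the moving target held by agent \<open>j\<close>,
  which moves by at most \<open>d t\<close> in round \<open>t\<close>.\<close>

locale tracking =
  fixes w :: "nat \<Rightarrow> 'n::finite \<Rightarrow> 'n \<Rightarrow> real" and E :: "nat \<Rightarrow> ('n \<times> 'n) set" and Rec :: "('n \<times> 'n) set"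
    and y :: "nat \<Rightarrow> 'n \<Rightarrow> real" and d :: "nat \<Rightarrow> real" and j :: 'n and h :: real and T :: nat
  assumes h: "0 < h" "h < 1"
    and w_nonneg: "\<And>t i l. 0 \<le> w t i l" and w_sum: "\<And>t i. (\<Sum>l\<in>UNIV. w t i l) = 1"
    and w_lower: "\<And>t i l. i \<noteq> j \<Longrightarrow> (i, l) \<in> E t \<or> l = i \<Longrightarrow> h \<le> w t i l"
    and window: "\<And>i l t. (i, l) \<in> Rec \<Longrightarrow> \<exists>\<tau><T. (i, l) \<in> E (t + \<tau>)"
    and connected: "\<And>i. (i, j) \<in> Rec\<^sup>*"
    and y_own: "\<And>t. y t j = 0" and d_nonneg: "\<And>t. 0 \<le> d t"
    and step: "\<And>t i. y (Suc t) i \<le> (\<Sum>l\<in>UNIV. w t i l * y t l) + d t"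
begin

definition Y :: "nat \<Rightarrow> real" where "Y t = Max (range (y t))"

lemma y_le_Y: "y t i \<le> Y t" by (simp add: Y_def)

lemma Y_nonneg: "0 \<le> Y t" using y_le_Y[of t j] by (simp add: y_own)

text \<open>The agents to which information held by \<open>j\<close> at time \<open>t\<close> can
  have travelled within \<open>k\<close> rounds.\<close>

primrec reached :: "nat \<Rightarrow> nat \<Rightarrow> 'n set" where
  "reached t 0 = {j}"
| "reached t (Suc k) = reached t k \<union> {i. \<exists>l\<in>reached t k. (i, l) \<in> E (t + k)}"

lemma reached_mono: "k \<le> k' \<Longrightarrow> reached t k \<subseteq> reached t k'"
  by (rule lift_Suc_mono_le[of "reached t"]) auto

lemma y_upper: "y (t + k) i \<le> Y t + (\<Sum>s<k. d (t + s))"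
proof (induction k arbitrary: i)
  case (Suc k)
  let ?B = "Y t + (\<Sum>s<k. d (t + s))"
  have "y (t + Suc k) i \<le> (\<Sum>l\<in>UNIV. w (t + k) i l * y (t + k) l) + d (t + k)" using step[of "t + k" i] by simp
  also have "(\<Sum>l\<in>UNIV. w (t + k) i l * y (t + k) l) \<le> (\<Sum>l\<in>UNIV. w (t + k) i l * ?B)"
    by (intro sum_mono mult_left_mono Suc.IH w_nonneg)
  also have "\<dots> = ?B" by (simp add: sum_distrib_right[symmetric] w_sum)
  finally show ?case by simp
qed (simp add: y_le_Y)

text \<open>The owner has error zero, and each hop passes on at least the fraction \<open>h\<close>
  of the gain already made. After \<open>k\<close> rounds a reached agent has thus lost the fraction
  \<open>h ^ k\<close> of the worst initial error, up to the drift accumulated meanwhile.\<close>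

lemma y_contracted: "i \<in> reached t k \<Longrightarrow> y (t + k) i \<le> (1 - h ^ k) * Y t + (\<Sum>s<k. d (t + s))"
proof (induction k arbitrary: i)
  case 0
  then show ?case by (simp add: y_own)
next
  case (Suc k)
  let ?S = "\<Sum>s<k. d (t + s)"
  have S: "0 \<le> ?S" by (intro sum_nonneg d_nonneg)
  show ?case
  proof (cases "i = j")
    case True
    have "0 \<le> (1 - h ^ Suc k) * Y t" using h Y_nonneg by (intro mult_nonneg_nonneg) (auto simp del: power_Suc intro: power_le_one)
    moreover have "0 \<le> (\<Sum>s<Suc k. d (t + s))" by (intro sum_nonneg d_nonneg)
    ultimately show ?thesis using True y_own[of "t + Suc k"] by simp
  next
    case False
    obtain l where l: "l \<in> reached t k" "(i, l) \<in> E (t + k) \<or> l = i" using Suc.prems by auto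
    let ?w = "w (t + k) i"
    have wl: "h \<le> ?w l" using w_lower[OF False l(2)] .
    have "(\<Sum>l'\<in>UNIV. ?w l' * y (t + k) l') = ?w l * y (t + k) l + (\<Sum>l'\<in>UNIV - {l}. ?w l' * y (t + k) l')"
      by (rule sum.remove) auto
    also have "\<dots> \<le> ?w l * ((1 - h ^ k) * Y t + ?S) + (\<Sum>l'\<in>UNIV - {l}. ?w l' * (Y t + ?S))"
      by (intro add_mono mult_left_mono sum_mono Suc.IH[OF l(1)] y_upper w_nonneg)
    \<comment> \<open>One informed neighbour \<open>l\<close> suffices: all remaining weight is
      charged with the crude bound that involves no contraction.\<close>
    also have "(\<Sum>l'\<in>UNIV - {l}. ?w l' * (Y t + ?S)) = (1 - ?w l) * (Y t + ?S)"
      using sum.remove[of UNIV l ?w] w_sum[of "t + k" i] by (simp add: sum_distrib_right[symmetric])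
    also have "?w l * ((1 - h ^ k) * Y t + ?S) + (1 - ?w l) * (Y t + ?S) = Y t + ?S - ?w l * (h ^ k * Y t)"
      by (simp add: algebra_simps)
    also have "\<dots> \<le> Y t + ?S - h * (h ^ k * Y t)"
      using wl h Y_nonneg[of t] by (intro diff_left_mono mult_right_mono) auto
    finally have "(\<Sum>l'\<in>UNIV. ?w l' * y (t + k) l') \<le> Y t + ?S - h * (h ^ k * Y t)" .
    moreover have "y (t + Suc k) i \<le> (\<Sum>l'\<in>UNIV. ?w l' * y (t + k) l') + d (t + k)" using step[of "t + k" i] by simp
    moreover have "(1 - h ^ Suc k) * Y t + (\<Sum>s<Suc k. d (t + s)) = Y t + ?S - h * (h ^ k * Y t) + d (t + k)"
      by (simp add: algebra_simps)
    ultimately show ?thesis by linarith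
  qed
qed

text \<open>Each recurrent edge on the path shows up within a window of \<open>T\<close> rounds, and
  agents stay reached while waiting for it.\<close>

lemma reached_of_relpow: "(i, j) \<in> Rec ^^ n \<Longrightarrow> i \<in> reached t (n * T)"
proof (induction n arbitrary: i)
  case (Suc n)
  obtain l where l: "(i, l) \<in> Rec" "(l, j) \<in> Rec ^^ n" using Suc.prems by (blast elim: relpow_Suc_E2)
  obtain \<tau> where \<tau>: "\<tau> < T" "(i, l) \<in> E (t + n * T + \<tau>)" using window[OF l(1)] by blast
  have "l \<in> reached t (n * T + \<tau>)" using Suc.IH[OF l(2)] reached_mono[of "n * T" "n * T + \<tau>" t] by auto
  then have "i \<in> reached t (Suc (n * T + \<tau>))" using \<tau>(2) by (auto simp: add.assoc)
  then show ?case using reached_mono[of "Suc (n * T + \<tau>)" "Suc n * T" t] \<tau>(1) by auto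
qed simp

lemma all_reached: "\<exists>W. \<forall>t i. i \<in> reached t W"
proof -
  have "\<forall>i. \<exists>n. (i, j) \<in> Rec ^^ n" using connected by (simp add: rtrancl_power)
  then obtain n where n: "\<And>i. (i, j) \<in> Rec ^^ n i" by metis
  \<comment> \<open>One window for all agents at once: the sum of the path lengths dominates each of
    them.\<close>
  define W where "W = (\<Sum>i\<in>UNIV. n i) * T"
  have "i \<in> reached t W" for t i
  proof -
    have "n i * T \<le> W" unfolding W_def by (intro mult_le_mono1 member_le_sum) auto
    then show ?thesis using reached_of_relpow[OF n] reached_mono by blast
  qed
  then show ?thesis by blast
qed

text \<open>After a full window all agents are reached, so the worst error contracts by a fixed
  factor. Squares are tracked because only the squared moves of the target are summable.\<close>

lemma summable_Y_squares:
  assumes "summable (\<lambda>t. (d t)\<^sup>2)"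
  shows "summable (\<lambda>t. (Y t)\<^sup>2)"
proof -
  obtain W where W: "\<And>t i. i \<in> reached t W" using all_reached by blast
  define \<rho> where "\<rho> = 1 - h ^ W"
  let ?c = "\<lambda>t. \<Sum>s<W. d (t + s)"
  have \<rho>: "0 \<le> \<rho>" "\<rho> < 1" using h by (auto simp: \<rho>_def power_le_one)
  have lag: "Y (t + W) \<le> \<rho> * Y t + ?c t" for t
    unfolding Y_def[of "t + W"] \<rho>_def by (rule Max.boundedI) (use y_contracted[OF W] in auto)
  show ?thesis
  proof (rule summable_of_lagged_contraction[where c="\<lambda>t. (?c t)\<^sup>2 / (1 - \<rho>)" and \<rho>=\<rho> and W=W])
    show "summable (\<lambda>t. (?c t)\<^sup>2 / (1 - \<rho>))" by (intro summable_divide summable_shifted_squares assms)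
    fix t
    have "(Y (t + W))\<^sup>2 \<le> (\<rho> * Y t + ?c t)\<^sup>2" by (rule power_mono[OF lag Y_nonneg])
    also have "\<dots> \<le> \<rho> * (Y t)\<^sup>2 + (?c t)\<^sup>2 / (1 - \<rho>)"
    proof -
      \<comment> \<open>A weighted Young inequality: the difference of its two sides, multiplied by
        \<open>1 - \<rho>\<close>, is exactly this square times \<open>\<rho>\<close>.\<close>
      have "0 \<le> \<rho> * ((1 - \<rho>) * Y t - ?c t)\<^sup>2" using \<rho> by simp
      then have "(1 - \<rho>) * (\<rho> * Y t + ?c t)\<^sup>2 \<le> (1 - \<rho>) * (\<rho> * (Y t)\<^sup>2) + (?c t)\<^sup>2"
        by (simp add: power2_eq_square algebra_simps)
      then have "(1 - \<rho>) * (\<rho> * Y t + ?c t)\<^sup>2 \<le> (1 - \<rho>) * (\<rho> * (Y t)\<^sup>2 + (?c t)\<^sup>2 / (1 - \<rho>))"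
        using \<rho> by (simp add: distrib_left)
      then show ?thesis using \<rho> by (simp add: mult_le_cancel_left)
    qed
    finally show "(Y (t + W))\<^sup>2 \<le> \<rho> * (Y t)\<^sup>2 + (?c t)\<^sup>2 / (1 - \<rho>)" .
  qed (use \<rho> in auto)
qed

end

section \<open>Martingale noise\<close>

locale L2_martingale_differences = prob_space P
  for P :: "'w measure" +
  fixes F :: "nat \<Rightarrow> 'w measure" and X :: "nat \<Rightarrow> 'w \<Rightarrow> real"
  assumes subalgebra_F: "\<And>t. subalgebra P (F t)"
    and sets_F_mono: "\<And>s t. s \<le> t \<Longrightarrow> sets (F s) \<subseteq> sets (F t)"
    and adapted: "\<And>t. X t \<in> borel_measurable (F (Suc t))"
    and square_integrable: "\<And>t. integrable P (\<lambda>\<omega>. (X t \<omega>)\<^sup>2)"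
    and centered: "\<And>t. AE \<omega> in P. real_cond_exp P (F t) (X t) \<omega> = 0"
begin

lemma F_measurable_mono: "s \<le> t \<Longrightarrow> f \<in> borel_measurable (F s) \<Longrightarrow> f \<in> borel_measurable (F t)"
  using subalgebra_F sets_F_mono measurable_mono[OF order_refl refl, of "F s" "F t"]
  unfolding subalgebra_def by (metis (no_types, lifting) measurable_from_subalg subalgebra_def)

lemma F_measurable_P: "f \<in> borel_measurable (F s) \<Longrightarrow> f \<in> borel_measurable P"
  using measurable_from_subalg[OF subalgebra_F] .

lemma X_measurable: "X t \<in> borel_measurable P"
  using adapted by (rule F_measurable_P)

lemma integrable_product:
  fixes f g :: "'w \<Rightarrow> real"
  assumes [measurable]: "f \<in> borel_measurable P" "g \<in> borel_measurable P"
    and "integrable P (\<lambda>\<omega>. (f \<omega>)\<^sup>2)" "integrable P (\<lambda>\<omega>. (g \<omega>)\<^sup>2)"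
  shows "integrable P (\<lambda>\<omega>. f \<omega> * g \<omega>)"
proof (rule Bochner_Integration.integrable_bound[of P "\<lambda>\<omega>. (f \<omega>)\<^sup>2 + (g \<omega>)\<^sup>2"])
  show "integrable P (\<lambda>\<omega>. (f \<omega>)\<^sup>2 + (g \<omega>)\<^sup>2)" using assms by simp
  have "\<bar>x * y\<bar> \<le> x\<^sup>2 + y\<^sup>2" for x y :: real
  proof -
    have "2 * (\<bar>x\<bar> * \<bar>y\<bar>) \<le> \<bar>x\<bar>\<^sup>2 + \<bar>y\<bar>\<^sup>2" using sum_squares_bound[of "\<bar>x\<bar>" "\<bar>y\<bar>"] by simp
    moreover have "0 \<le> \<bar>x\<bar> * \<bar>y\<bar>" by simp
    ultimately show ?thesis unfolding abs_mult power2_abs by linarith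
  qed
  then show "AE \<omega> in P. norm (f \<omega> * g \<omega>) \<le> norm ((f \<omega>)\<^sup>2 + (g \<omega>)\<^sup>2)" by simp
qed measurable

lemma orthogonal:
  assumes A: "A \<in> borel_measurable (F t)" and A2: "integrable P (\<lambda>\<omega>. (A \<omega>)\<^sup>2)"
  shows "(\<integral>\<omega>. A \<omega> * X t \<omega> \<partial>P) = 0"
proof -
  interpret sub: finite_measure_subalgebra P "F t"
    by unfold_locales (rule subalgebra_F)
  have i: "integrable P (\<lambda>\<omega>. A \<omega> * X t \<omega>)"
    by (rule integrable_product[OF F_measurable_P[OF A] X_measurable A2 square_integrable])
  have "(\<integral>\<omega>. A \<omega> * X t \<omega> \<partial>P) = (\<integral>\<omega>. A \<omega> * real_cond_exp P (F t) (X t) \<omega> \<partial>P)"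
    by (rule sub.real_cond_exp_intg(2)[OF i A X_measurable, symmetric])
  also have "\<dots> = (\<integral>\<omega>. 0 \<partial>P)"
    by (rule integral_cong_AE) (use centered[of t] F_measurable_P[OF A] in \<open>auto\<close>)
  finally show ?thesis by simp
qed

text \<open>Each new increment is orthogonal to the past sum times the predictable factor, so the
  cross terms vanish and second moments add; \<open>\<bar>H t \<omega>\<bar> \<le> 1\<close> removes
  the multipliers.\<close>

lemma predictable_transform_second_moment:
  assumes H: "\<And>t. H t \<in> borel_measurable (F t)" and H1: "\<And>t \<omega>. \<bar>H t \<omega>\<bar> \<le> (1::real)"
  shows "integrable P (\<lambda>\<omega>. (\<Sum>t=m..<n. H t \<omega> * X t \<omega>)\<^sup>2) \<and>
    (\<integral>\<omega>. (\<Sum>t=m..<n. H t \<omega> * X t \<omega>)\<^sup>2 \<partial>P) \<le> (\<Sum>t=m..<n. \<integral>\<omega>. (X t \<omega>)\<^sup>2 \<partial>P)"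
proof (induction n)
  case (Suc n)
  show ?case
  proof (cases "m \<le> n")
    case True
    let ?A = "\<lambda>\<omega>. \<Sum>t=m..<n. H t \<omega> * X t \<omega>"
    have Am: "?A \<in> borel_measurable (F n)"
    proof (rule borel_measurable_sum, rule borel_measurable_times)
      fix t assume t: "t \<in> {m..<n}"
      show "H t \<in> borel_measurable (F n)" "X t \<in> borel_measurable (F n)"
        using t F_measurable_mono[OF _ H, of t n] F_measurable_mono[OF _ adapted, of t n] by auto
    qed
    have h2: "(H n \<omega> * X n \<omega>)\<^sup>2 \<le> (X n \<omega>)\<^sup>2" for \<omega>
    proof -
      have "(H n \<omega>)\<^sup>2 \<le> 1" using power_mono[OF H1[of n \<omega>], of 2] by simp
      then have "(H n \<omega>)\<^sup>2 * (X n \<omega>)\<^sup>2 \<le> 1 * (X n \<omega>)\<^sup>2" by (rule mult_right_mono) simp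
      then show ?thesis by (simp add: power_mult_distrib)
    qed
    have HXm: "(\<lambda>\<omega>. H n \<omega> * X n \<omega>) \<in> borel_measurable P"
      using F_measurable_P[OF H] X_measurable by (rule borel_measurable_times)
    have iHX: "integrable P (\<lambda>\<omega>. (H n \<omega> * X n \<omega>)\<^sup>2)"
      by (rule Bochner_Integration.integrable_bound[OF square_integrable[of n]]) (use h2 HXm in auto)
    have iA: "integrable P (\<lambda>\<omega>. (?A \<omega>)\<^sup>2)" using Suc.IH by simp
    have AHm: "(\<lambda>\<omega>. ?A \<omega> * H n \<omega>) \<in> borel_measurable (F n)" using Am H by (rule borel_measurable_times)
    have iAH: "integrable P (\<lambda>\<omega>. (?A \<omega> * H n \<omega>)\<^sup>2)"
    proof (rule Bochner_Integration.integrable_bound[OF iA])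
      have "(a * H n \<omega>)\<^sup>2 \<le> a\<^sup>2" for a \<omega>
      proof -
        have "(H n \<omega>)\<^sup>2 \<le> 1" using power_mono[OF H1[of n \<omega>], of 2] by simp
        then have "a\<^sup>2 * (H n \<omega>)\<^sup>2 \<le> a\<^sup>2 * 1" by (rule mult_left_mono) simp
        then show ?thesis by (simp add: power_mult_distrib)
      qed
      then show "AE \<omega> in P. norm ((?A \<omega> * H n \<omega>)\<^sup>2) \<le> norm ((?A \<omega>)\<^sup>2)" by simp
    qed (use F_measurable_P[OF AHm] in measurable)
    have icr: "integrable P (\<lambda>\<omega>. (?A \<omega> * H n \<omega>) * X n \<omega>)"
      by (rule integrable_product[OF F_measurable_P[OF AHm] X_measurable iAH square_integrable])
    have e: "(\<Sum>t=m..<Suc n. H t \<omega> * X t \<omega>)\<^sup>2 = (?A \<omega>)\<^sup>2 + 2 * ((?A \<omega> * H n \<omega>) * X n \<omega>) + (H n \<omega> * X n \<omega>)\<^sup>2" for \<omega>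
      using True by (simp add: power2_eq_square algebra_simps)
    have i: "integrable P (\<lambda>\<omega>. (\<Sum>t=m..<Suc n. H t \<omega> * X t \<omega>)\<^sup>2)"
      unfolding e by (intro Bochner_Integration.integrable_add integrable_mult_right iA icr iHX)
    have "(\<integral>\<omega>. (\<Sum>t=m..<Suc n. H t \<omega> * X t \<omega>)\<^sup>2 \<partial>P) = (\<integral>\<omega>. (?A \<omega>)\<^sup>2 \<partial>P) + 2 * (\<integral>\<omega>. (?A \<omega> * H n \<omega>) * X n \<omega> \<partial>P) + (\<integral>\<omega>. (H n \<omega> * X n \<omega>)\<^sup>2 \<partial>P)"
      unfolding e
      by (simp only: Bochner_Integration.integral_add[OF Bochner_Integration.integrable_add[OF iA integrable_mult_right[OF icr]] iHX]
          Bochner_Integration.integral_add[OF iA integrable_mult_right[OF icr]] integral_mult_right_zero)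
    also have "(\<integral>\<omega>. (?A \<omega> * H n \<omega>) * X n \<omega> \<partial>P) = 0" by (rule orthogonal[OF AHm iAH])
    also have "(\<integral>\<omega>. (H n \<omega> * X n \<omega>)\<^sup>2 \<partial>P) \<le> (\<integral>\<omega>. (X n \<omega>)\<^sup>2 \<partial>P)"
      by (rule integral_mono[OF iHX square_integrable h2])
    finally show ?thesis using i Suc.IH True by simp
  next
    case False
    then show ?thesis by simp
  qed
qed simp

definition exceeds :: "nat \<Rightarrow> real \<Rightarrow> nat \<Rightarrow> 'w set" where
  "exceeds m \<epsilon> n = {\<omega>\<in>space P. \<exists>k\<le>n. \<epsilon> \<le> \<bar>\<Sum>t=m..<k. X t \<omega>\<bar>}"

lemma exceeds_measurable: "exceeds m \<epsilon> n \<in> sets P"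
proof -
  have [measurable]: "X t \<in> borel_measurable P" for t by (rule X_measurable)
  have "exceeds m \<epsilon> n = (\<Union>k\<in>{..n}. {\<omega>\<in>space P. \<epsilon> \<le> \<bar>\<Sum>t=m..<k. X t \<omega>\<bar>})" by (auto simp: exceeds_def)
  also have "\<dots> \<in> sets P" by measurable
  finally show ?thesis .
qed

text \<open>Kolmogorov's inequality: freeze the sum at the first time it exceeds \<open>\<epsilon>\<close>, which is a predictable transform.\<close>

lemma Kolmogorov_maximal:
  assumes \<epsilon>: "0 < \<epsilon>"
  shows "prob (exceeds m \<epsilon> n) \<le> (\<Sum>t=m..<n. \<integral>\<omega>. (X t \<omega>)\<^sup>2 \<partial>P) / \<epsilon>\<^sup>2"
proof -
  define H :: "nat \<Rightarrow> 'w \<Rightarrow> real" where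
    "H t \<omega> = indicator {\<omega>\<in>space P. \<forall>k\<le>t. \<bar>\<Sum>s=m..<k. X s \<omega>\<bar> < \<epsilon>} \<omega>" for t \<omega>
  \<comment> \<open>The sums involved contain \<open>X s\<close> with \<open>s < t\<close> only,
    each measurable at time \<open>s + 1\<close>, so the freezing decision is made before
    \<open>X t\<close> is revealed.\<close>
  have Hm: "H t \<in> borel_measurable (F t)" for t
  proof -
    have sp: "space (F t) = space P" using subalgebra_F[of t] by (simp add: subalgebra_def)
    have [measurable]: "(\<lambda>\<omega>. \<Sum>s=m..<k. X s \<omega>) \<in> borel_measurable (F t)" if "k \<le> t" for k
      by (rule borel_measurable_sum) (use that F_measurable_mono[OF _ adapted] in auto)
    have "{\<omega>\<in>space P. \<forall>k\<le>t. \<bar>\<Sum>s=m..<k. X s \<omega>\<bar> < \<epsilon>} = space (F t) \<inter> (\<Inter>k\<in>{..t}. {\<omega>\<in>space (F t). \<bar>\<Sum>s=m..<k. X s \<omega>\<bar> < \<epsilon>})"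
      by (auto simp: sp)
    also have "\<dots> \<in> sets (F t)"
      by (intro sets.Int sets.top sets.finite_INT) auto
    finally show ?thesis unfolding H_def by (intro borel_measurable_indicator)
  qed
  have H1: "\<bar>H t \<omega>\<bar> \<le> 1" for t \<omega> by (simp add: H_def indicator_def)
  let ?Z = "\<lambda>\<omega>. \<Sum>t=m..<n. H t \<omega> * X t \<omega>"
  note Z = predictable_transform_second_moment[of H m n, OF Hm H1]
  have big: "\<epsilon>\<^sup>2 \<le> (?Z \<omega>)\<^sup>2" if w: "\<omega> \<in> exceeds m \<epsilon> n" for \<omega>
  proof -
    let ?S = "\<lambda>k. \<Sum>t=m..<k. X t \<omega>"
    define k where "k = (LEAST k. \<epsilon> \<le> \<bar>?S k\<bar>)"
    obtain k' where k': "k' \<le> n" "\<epsilon> \<le> \<bar>?S k'\<bar>" and sp: "\<omega> \<in> space P" using w by (auto simp: exceeds_def)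
    have k: "\<epsilon> \<le> \<bar>?S k\<bar>" unfolding k_def by (rule LeastI[of _ k']) (rule k'(2))
    have kn: "k \<le> n" using Least_le[of "\<lambda>k. \<epsilon> \<le> \<bar>?S k\<bar>" k'] k' by (simp add: k_def)
    have less: "\<bar>?S l\<bar> < \<epsilon>" if "l < k" for l using not_less_Least[of l "\<lambda>k. \<epsilon> \<le> \<bar>?S k\<bar>"] that by (simp add: k_def not_le)
    have mk: "m < k"
    proof (rule ccontr)
      assume "\<not> m < k"
      then have "?S k = 0" by simp
      with k \<epsilon> show False by simp
    qed
    have H_low: "H t \<omega> = 1" if "t < k" for t using that less sp by (auto simp: H_def)
    have H_high: "H t \<omega> = 0" if "k \<le> t" for t using that k by (auto simp: H_def indicator_def not_less)
    \<comment> \<open>The multipliers are one before the first crossing and zero from then on, so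
      the transformed sum stays at the crossing value.\<close>
    have "?Z \<omega> = (\<Sum>t=m..<k. H t \<omega> * X t \<omega>) + (\<Sum>t=k..<n. H t \<omega> * X t \<omega>)"
      using mk kn by (simp add: sum.atLeastLessThan_concat)
    also have "\<dots> = ?S k" using H_low H_high by simp
    finally have "\<epsilon> \<le> \<bar>?Z \<omega>\<bar>" using k by simp
    then have "\<epsilon>\<^sup>2 \<le> \<bar>?Z \<omega>\<bar>\<^sup>2" using \<epsilon> by (intro power_mono) auto
    then show ?thesis by simp
  qed
  have "\<epsilon>\<^sup>2 * prob (exceeds m \<epsilon> n) = (\<integral>\<omega>. \<epsilon>\<^sup>2 * indicator (exceeds m \<epsilon> n) \<omega> \<partial>P)"
    using exceeds_measurable[of m \<epsilon> n] by simp
  also have "\<dots> \<le> (\<integral>\<omega>. (?Z \<omega>)\<^sup>2 \<partial>P)"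
  proof (rule integral_mono)
    show "integrable P (\<lambda>\<omega>. \<epsilon>\<^sup>2 * indicator (exceeds m \<epsilon> n) \<omega>)"
      using exceeds_measurable[of m \<epsilon> n] by (intro integrable_mult_right integrable_real_indicator) (auto simp: emeasure_eq_measure)
    show "\<epsilon>\<^sup>2 * indicator (exceeds m \<epsilon> n) \<omega> \<le> (?Z \<omega>)\<^sup>2" for \<omega>
      using big[of \<omega>] by (auto simp: indicator_def)
  qed (use Z in simp)
  also have "\<dots> \<le> (\<Sum>t=m..<n. \<integral>\<omega>. (X t \<omega>)\<^sup>2 \<partial>P)" using Z by simp
  finally show ?thesis using \<epsilon> by (simp add: pos_le_divide_eq mult.commute)
qed

text \<open>The maximal inequality on tails: a deviation of size \<open>\<epsilon>\<close> after
  time \<open>m\<close> has probability at most the tail of the variances divided by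
  \<open>\<epsilon>\<^sup>2\<close>. As this tends to zero, almost every path has Cauchy partial
  sums.\<close>

theorem AE_convergent:
  assumes v: "summable (\<lambda>t. \<integral>\<omega>. (X t \<omega>)\<^sup>2 \<partial>P)"
  shows "AE \<omega> in P. convergent (\<lambda>n. \<Sum>t<n. X t \<omega>)"
proof -
  let ?v = "\<lambda>t. \<integral>\<omega>. (X t \<omega>)\<^sup>2 \<partial>P"
  define far where "far m \<epsilon> = (\<Union>n. exceeds m \<epsilon> n)" for m \<epsilon>
  have far_sets: "far m \<epsilon> \<in> sets P" for m \<epsilon> unfolding far_def using exceeds_measurable by blast
  have far: "prob (far m \<epsilon>) \<le> (\<Sum>t. ?v (t + m)) / \<epsilon>\<^sup>2" if \<epsilon>: "0 < \<epsilon>" for m \<epsilon>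
  proof -
    have inc: "incseq (exceeds m \<epsilon>)" unfolding incseq_def exceeds_def by (auto intro: order_trans)
    have lim: "(\<lambda>n. prob (exceeds m \<epsilon> n)) \<longlonglongrightarrow> prob (far m \<epsilon>)"
      unfolding far_def by (rule finite_Lim_measure_incseq[OF _ inc]) (use exceeds_measurable in auto)
    have "prob (exceeds m \<epsilon> n) \<le> (\<Sum>t. ?v (t + m)) / \<epsilon>\<^sup>2" for n
    proof -
      have "(\<Sum>t=m..<n. ?v t) = (\<Sum>t<n - m. ?v (t + m))"
        by (cases "m \<le> n") (use sum.shift_bounds_nat_ivl[of ?v 0 m "n - m"] in \<open>auto simp: atLeast0LessThan\<close>)
      also have "\<dots> \<le> (\<Sum>t. ?v (t + m))"
        by (rule sum_le_suminf[OF summable_ignore_initial_segment[OF v]]) auto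
      finally show ?thesis using order_trans[OF Kolmogorov_maximal[OF \<epsilon>, of m n]] by (simp add: divide_right_mono)
    qed
    then show ?thesis by (intro LIMSEQ_le_const2[OF lim]) auto
  qed
  \<comment> \<open>The paths that deviate by \<open>\<epsilon>\<close> after every time
    \<open>m\<close>; countably many thresholds \<open>1 / real (Suc j)\<close> then suffice for the
    Cauchy property.\<close>
  have null: "(\<Inter>m. far m \<epsilon>) \<in> null_sets P" if \<epsilon>: "0 < \<epsilon>" for \<epsilon>
  proof -
    have s: "(\<Inter>m. far m \<epsilon>) \<in> sets P" using far_sets by blast
    have "prob (\<Inter>m. far m \<epsilon>) \<le> 0"
    proof (rule LIMSEQ_le_const)
      have "(\<lambda>m. (\<Sum>t. ?v (t + m)) / \<epsilon>\<^sup>2) \<longlonglongrightarrow> 0 / \<epsilon>\<^sup>2"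
        by (intro tendsto_divide tendsto_const suminf_exist_split2[OF v]) (use \<epsilon> in simp)
      then show "(\<lambda>m. (\<Sum>t. ?v (t + m)) / \<epsilon>\<^sup>2) \<longlonglongrightarrow> 0" by simp
      have "prob (\<Inter>m. far m \<epsilon>) \<le> (\<Sum>t. ?v (t + m)) / \<epsilon>\<^sup>2" for m
        by (rule order_trans[OF finite_measure_mono[OF _ far_sets] far[OF \<epsilon>]]) blast
      then show "\<exists>N. \<forall>n\<ge>N. prob (\<Inter>m. far m \<epsilon>) \<le> (\<Sum>t. ?v (t + n)) / \<epsilon>\<^sup>2" by blast
    qed
    then have "prob (\<Inter>m. far m \<epsilon>) = 0" by (simp add: measure_nonneg order_antisym)
    then show ?thesis using s by (intro null_setsI) (simp add: emeasure_eq_measure)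
  qed
  have "AE \<omega> in P. \<forall>j::nat. \<omega> \<notin> (\<Inter>m. far m (1 / real (Suc j)))"
    unfolding AE_all_countable by (intro allI AE_not_in null) simp
  then show ?thesis
  proof (rule AE_mp[OF _ AE_I2], intro impI)
    fix \<omega> assume w: "\<omega> \<in> space P" and *: "\<forall>j::nat. \<omega> \<notin> (\<Inter>m. far m (1 / real (Suc j)))"
    have "Cauchy (\<lambda>n. \<Sum>t<n. X t \<omega>)"
    proof (rule CauchyI)
      fix e :: real assume e: "0 < e"
      obtain j where j: "1 / real (Suc j) < e / 2" using e by (metis half_gt_zero nat_approx_posE)
      obtain m where m: "\<omega> \<notin> far m (1 / real (Suc j))" using * by blast
      then have b: "\<bar>\<Sum>t=m..<k. X t \<omega>\<bar> < 1 / real (Suc j)" for k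
        using w unfolding far_def exceeds_def by (auto simp: not_le)
      have d: "\<bar>(\<Sum>t<k. X t \<omega>) - (\<Sum>t<m. X t \<omega>)\<bar> < e / 2" if "m \<le> k" for k
      proof -
        have "(\<Sum>t<k. X t \<omega>) - (\<Sum>t<m. X t \<omega>) = (\<Sum>t=m..<k. X t \<omega>)"
          using sum.atLeastLessThan_concat[of 0 m k "\<lambda>t. X t \<omega>"] that by (simp add: atLeast0LessThan)
        then show ?thesis using b[of k] j by linarith
      qed
      have "norm ((\<Sum>t<k. X t \<omega>) - (\<Sum>t<n. X t \<omega>)) < e" if "m \<le> k" "m \<le> n" for k n
        using d[OF that(1)] d[OF that(2)] unfolding real_norm_def by linarith
      then show "\<exists>M. \<forall>k\<ge>M. \<forall>n\<ge>M. norm ((\<Sum>t<k. X t \<omega>) - (\<Sum>t<n. X t \<omega>)) < e" by blast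
    qed
    then show "convergent (\<lambda>n. \<Sum>t<n. X t \<omega>)" by (rule Cauchy_convergent)
  qed
qed

end

text \<open>The conditional law is given set by set, with an exceptional null set that may depend on
  the set. The extension to nonnegative Borel functions by induction keeps to one function at a
  time, where countably many null sets are enough.\<close>

lemma nn_cond_exp_conditional_law:
  fixes g :: "'w \<Rightarrow> 'b::topological_space" and f :: "'b \<Rightarrow> ennreal"
  assumes P: "prob_space P" and sub: "subalgebra P F" and g: "g \<in> borel_measurable P"
    and \<kappa>: "\<And>\<omega>. \<kappa> \<omega> \<in> space (prob_algebra borel)"
    and law: "\<And>B. B \<in> sets borel \<Longrightarrow>
      AE \<omega> in P. real_cond_exp P F (indicator (g -` B \<inter> space P)) \<omega> = measure (\<kappa> \<omega>) B"
    and f: "f \<in> borel_measurable borel"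
  shows "AE \<omega> in P. nn_cond_exp P F (\<lambda>\<omega>. f (g \<omega>)) \<omega> = (\<integral>\<^sup>+x. f x \<partial>\<kappa> \<omega>)"
proof -
  interpret prob_space P by fact
  interpret sigma_finite_subalgebra P F
    by (rule finite_measure_subalgebra_is_sigma_finite) (use sub in unfold_locales)
  note [measurable] = g
  have \<kappa>s[measurable_cong]: "sets (\<kappa> \<omega>) = sets borel" and \<kappa>p: "prob_space (\<kappa> \<omega>)" for \<omega>
    using \<kappa>[of \<omega>] by (auto simp: space_prob_algebra)
  have mb: "h \<in> borel_measurable borel \<Longrightarrow> h \<in> borel_measurable (\<kappa> \<omega>)" for h :: "'b \<Rightarrow> ennreal" and \<omega>
    using measurable_cong_sets[OF \<kappa>s refl] by blast
  from f show ?thesis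
  proof (induction f rule: borel_measurable_induct)
    case (cong h1 h2)
    then show ?case by (simp add: fun_eq_iff)
  next
    case (set B)
    let ?I = "indicator (g -` B \<inter> space P) :: 'w \<Rightarrow> real"
    have Bm: "g -` B \<inter> space P \<in> sets P" using g set by (rule measurable_sets)
    have Im[measurable]: "?I \<in> borel_measurable P" using Bm by measurable
    have c: "AE \<omega> in P. nn_cond_exp P F (\<lambda>\<omega>. indicator B (g \<omega>)) \<omega> = nn_cond_exp P F (\<lambda>\<omega>. ennreal (?I \<omega>)) \<omega>"
      by (rule nn_cond_exp_cong) (use set in \<open>auto simp: indicator_def intro!: AE_I2\<close>)
    \<comment> \<open>\<open>real_cond_exp\<close> is a difference of two conditional expectations
      of nonnegative functions; for an indicator the second is that of zero.\<close>
    have neg: "AE \<omega> in P. 0 = nn_cond_exp P F (\<lambda>\<omega>. ennreal (- ?I \<omega>)) \<omega>"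
    proof -
      have e: "(\<lambda>\<omega>. ennreal (- ?I \<omega>)) = (\<lambda>_. 0)" by (auto simp: fun_eq_iff indicator_def ennreal_neg)
      show ?thesis unfolding e by (rule nn_cond_exp_F_meas) simp
    qed
    \<comment> \<open>The comparison with the constant one makes the conditional expectation finite,
      without which \<open>enn2real\<close> could not be undone.\<close>
    have one: "AE \<omega> in P. 1 = nn_cond_exp P F (\<lambda>\<omega>. 1) \<omega>" by (rule nn_cond_exp_F_meas) simp
    have le: "AE \<omega> in P. nn_cond_exp P F (\<lambda>\<omega>. ennreal (?I \<omega>)) \<omega> \<le> nn_cond_exp P F (\<lambda>\<omega>. 1) \<omega>"
    proof (rule nn_cond_exp_mono)
      show "AE \<omega> in P. ennreal (?I \<omega>) \<le> 1" by (rule AE_I2) (simp add: indicator_def)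
    qed measurable
    show ?case using c neg one le law[OF set]
    proof eventually_elim
      case (elim \<omega>)
      have "enn2real (nn_cond_exp P F (\<lambda>\<omega>. ennreal (?I \<omega>)) \<omega>) = measure (\<kappa> \<omega>) B"
        using elim(5) elim(2)[symmetric] by (simp add: real_cond_exp_def)
      moreover have "nn_cond_exp P F (\<lambda>\<omega>. ennreal (?I \<omega>)) \<omega> < \<top>"
        using elim(3,4) by (metis ennreal_one_less_top le_less_trans)
      ultimately have "nn_cond_exp P F (\<lambda>\<omega>. ennreal (?I \<omega>)) \<omega> = ennreal (measure (\<kappa> \<omega>) B)"
        by (metis ennreal_enn2real)
      also have "\<dots> = emeasure (\<kappa> \<omega>) B"
        using finite_measure.emeasure_eq_measure[OF prob_space.finite_measure[OF \<kappa>p]] by metis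
      also have "\<dots> = (\<integral>\<^sup>+x. indicator B x \<partial>\<kappa> \<omega>)" using set by (simp add: \<kappa>s)
      finally show ?case using elim(1) by simp
    qed
  next
    case (mult h c)
    note [measurable] = mult(2)
    have "AE \<omega> in P. c * nn_cond_exp P F (\<lambda>\<omega>. h (g \<omega>)) \<omega> = nn_cond_exp P F (\<lambda>\<omega>. c * h (g \<omega>)) \<omega>"
      by (rule nn_cond_exp_prod) measurable
    with mult.IH show ?case
      by eventually_elim (simp add: nn_integral_cmult mb[OF mult(2)])
  next
    case (add h1 h2)
    have m: "h1 \<in> borel_measurable borel" "h2 \<in> borel_measurable borel" using add by auto
    note [measurable] = m
    have "AE \<omega> in P. nn_cond_exp P F (\<lambda>\<omega>. h2 (g \<omega>)) \<omega> + nn_cond_exp P F (\<lambda>\<omega>. h1 (g \<omega>)) \<omega> = nn_cond_exp P F (\<lambda>\<omega>. h2 (g \<omega>) + h1 (g \<omega>)) \<omega>"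
      by (rule nn_cond_exp_sum) measurable
    with add.IH show ?case
      by eventually_elim (simp add: nn_integral_add mb[OF m(1)] mb[OF m(2)])
  next
    case (seq U)
    note Um[measurable] = seq(1)
    let ?N = "\<lambda>i. nn_cond_exp P F (\<lambda>\<omega>. U i (g \<omega>))"
    have inc: "AE \<omega> in P. \<forall>i. ?N i \<omega> \<le> ?N (Suc i) \<omega>"
      unfolding AE_all_countable
      by (intro allI nn_cond_exp_mono) (use \<open>incseq U\<close> in \<open>auto simp: incseq_Suc_iff le_fun_def intro!: AE_I2\<close>)
    \<comment> \<open>The supremum of the conditional expectations is identified by its integrals
      over sets of \<open>F\<close>, where monotone convergence applies.\<close>
    have "AE \<omega> in P. (SUP i. ?N i \<omega>) = nn_cond_exp P F (\<lambda>\<omega>. (SUP i. U i) (g \<omega>)) \<omega>"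
    proof (rule nn_cond_exp_charact)
      fix A assume A: "A \<in> sets F"
      then have [measurable]: "A \<in> sets P" using sub by (auto simp: subalgebra_def)
      have "(\<integral>\<^sup>+\<omega>\<in>A. (SUP i. U i) (g \<omega>) \<partial>P) = (\<integral>\<^sup>+\<omega>. (SUP i. U i (g \<omega>) * indicator A \<omega>) \<partial>P)"
        by (simp add: SUP_mult_right_ennreal image_comp)
      also have "\<dots> = (SUP i. \<integral>\<^sup>+\<omega>. U i (g \<omega>) * indicator A \<omega> \<partial>P)"
        by (rule nn_integral_monotone_convergence_SUP)
           (use \<open>incseq U\<close> in \<open>auto simp: incseq_def le_fun_def intro!: mult_right_mono\<close>)
      also have "\<dots> = (SUP i. \<integral>\<^sup>+\<omega>. ?N i \<omega> * indicator A \<omega> \<partial>P)"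
      proof (rule SUP_cong[OF refl])
        fix i
        show "(\<integral>\<^sup>+\<omega>. U i (g \<omega>) * indicator A \<omega> \<partial>P) = (\<integral>\<^sup>+\<omega>. ?N i \<omega> * indicator A \<omega> \<partial>P)"
          using nn_cond_exp_intg[of "indicator A" "\<lambda>\<omega>. U i (g \<omega>)"] A by (simp add: mult.commute)
      qed
      also have "\<dots> = (\<integral>\<^sup>+\<omega>. (SUP i. ?N i \<omega> * indicator A \<omega>) \<partial>P)"
        by (rule nn_integral_monotone_convergence_SUP_AE[symmetric])
           (use inc in \<open>auto intro!: mult_right_mono\<close>)
      also have "\<dots> = (\<integral>\<^sup>+\<omega>\<in>A. (SUP i. ?N i \<omega>) \<partial>P)"
        by (simp add: SUP_mult_right_ennreal)
      finally show "(\<integral>\<^sup>+\<omega>\<in>A. (SUP i. U i) (g \<omega>) \<partial>P) = (\<integral>\<^sup>+\<omega>\<in>A. (SUP i. ?N i \<omega>) \<partial>P)" .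
    next
      show "(\<lambda>\<omega>. (SUP i. U i) (g \<omega>)) \<in> borel_measurable P"
        unfolding SUP_apply by (rule borel_measurable_SUP) (simp, rule measurable_compose[OF g Um])
      show "(\<lambda>\<omega>. SUP i. ?N i \<omega>) \<in> borel_measurable F"
        by (rule borel_measurable_SUP) simp_all
    qed
    moreover have "AE \<omega> in P. \<forall>i. ?N i \<omega> = (\<integral>\<^sup>+x. U i x \<partial>\<kappa> \<omega>)"
      unfolding AE_all_countable using seq.IH by blast
    ultimately show ?case
    proof eventually_elim
      case (elim \<omega>)
      have "(\<integral>\<^sup>+x. (SUP i. U i) x \<partial>\<kappa> \<omega>) = (SUP i. \<integral>\<^sup>+x. U i x \<partial>\<kappa> \<omega>)"
        using nn_integral_monotone_convergence_SUP[OF \<open>incseq U\<close> mb[OF Um]] by (simp add: image_comp)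
      with elim show ?case by simp
    qed
  qed
qed

lemma real_cond_exp_conditional_law:
  fixes g :: "'w \<Rightarrow> 'b::topological_space" and f :: "'b \<Rightarrow> real"
  assumes P: "prob_space P" and sub: "subalgebra P F" and g: "g \<in> borel_measurable P"
    and \<kappa>: "\<And>\<omega>. \<kappa> \<omega> \<in> space (prob_algebra borel)"
    and law: "\<And>B. B \<in> sets borel \<Longrightarrow>
      AE \<omega> in P. real_cond_exp P F (indicator (g -` B \<inter> space P)) \<omega> = measure (\<kappa> \<omega>) B"
    and f[measurable]: "f \<in> borel_measurable borel" and i: "\<And>\<omega>. integrable (\<kappa> \<omega>) f"
  shows "AE \<omega> in P. real_cond_exp P F (\<lambda>\<omega>. f (g \<omega>)) \<omega> = (\<integral>x. f x \<partial>\<kappa> \<omega>)"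
proof -
  have "AE \<omega> in P. nn_cond_exp P F (\<lambda>\<omega>. ennreal (f (g \<omega>))) \<omega> = (\<integral>\<^sup>+x. ennreal (f x) \<partial>\<kappa> \<omega>)"
    "AE \<omega> in P. nn_cond_exp P F (\<lambda>\<omega>. ennreal (- f (g \<omega>))) \<omega> = (\<integral>\<^sup>+x. ennreal (- f x) \<partial>\<kappa> \<omega>)"
    by (rule nn_cond_exp_conditional_law[OF P sub g \<kappa>], erule law, measurable)+
  then show ?thesis
    by eventually_elim (simp add: real_cond_exp_def real_lebesgue_integral_def[OF i])
qed

lemma nn_integral_conditional_law_le:
  fixes g :: "'w \<Rightarrow> 'b::topological_space" and f :: "'b \<Rightarrow> ennreal"
  assumes P: "prob_space P" and sub: "subalgebra P F" and g: "g \<in> borel_measurable P"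
    and \<kappa>: "\<And>\<omega>. \<kappa> \<omega> \<in> space (prob_algebra borel)"
    and law: "\<And>B. B \<in> sets borel \<Longrightarrow>
      AE \<omega> in P. real_cond_exp P F (indicator (g -` B \<inter> space P)) \<omega> = measure (\<kappa> \<omega>) B"
    and f: "f \<in> borel_measurable borel" and b: "\<And>\<omega>. (\<integral>\<^sup>+x. f x \<partial>\<kappa> \<omega>) \<le> c"
  shows "(\<integral>\<^sup>+\<omega>. f (g \<omega>) \<partial>P) \<le> c"
proof -
  interpret prob_space P by fact
  interpret sigma_finite_subalgebra P F
    by (rule finite_measure_subalgebra_is_sigma_finite) (use sub in unfold_locales)
  have ae: "AE \<omega> in P. nn_cond_exp P F (\<lambda>\<omega>. f (g \<omega>)) \<omega> = (\<integral>\<^sup>+x. f x \<partial>\<kappa> \<omega>)"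
    by (rule nn_cond_exp_conditional_law[OF P sub g \<kappa> _ f]) (rule law)
  have fg: "(\<lambda>\<omega>. f (g \<omega>)) \<in> borel_measurable P" using g f by (rule measurable_compose)
  have "(\<integral>\<^sup>+\<omega>. f (g \<omega>) \<partial>P) = (\<integral>\<^sup>+\<omega>. 1 * nn_cond_exp P F (\<lambda>\<omega>. f (g \<omega>)) \<omega> \<partial>P)"
    by (subst nn_cond_exp_intg[of "\<lambda>_. 1", OF _ fg]) simp_all
  also have "\<dots> \<le> (\<integral>\<^sup>+\<omega>. c \<partial>P)"
    by (rule nn_integral_mono_AE)
       (use ae b in \<open>auto elim!: eventually_mono\<close>)
  also have "\<dots> = c" by (simp add: emeasure_space_1)
  finally show ?thesis .
qed

section \<open>Perturbed gradient ascent\<close>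

text \<open>The bounded function \<open>u\<close> serves as a Lyapunov function: when its increments
  are summed, the weighted squared gradients are balanced by its oscillation, the bias, the noise
  cross term and the quadratic remainder, all of which stay bounded.\<close>

lemma perturbed_gradient_ascent_summable:
  fixes \<theta> :: "nat \<Rightarrow> 'a::real_inner" and D :: "'a \<Rightarrow> 'a" and a :: "nat \<Rightarrow> real"
  assumes a: "\<And>t. 0 < a t"
    and expansion: "\<And>x y. \<bar>u y - u x - (y - x) \<bullet> D x\<bar> \<le> K * (norm (y - x))\<^sup>2"
    and bounded: "\<And>x y. \<bar>u y - u x\<bar> \<le> C"
    and D_bounded: "\<And>x. norm (D x) \<le> Db"
    and step: "\<And>t. \<theta> (Suc t) = \<theta> t + a t *\<^sub>R g t" and g: "\<And>t. g t = D (\<theta> t) + e t + M t"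
    and e: "summable (\<lambda>t. a t * norm (e t))"
    and DM: "convergent (\<lambda>n. \<Sum>t<n. a t * (D (\<theta> t) \<bullet> M t))"
    and g2: "summable (\<lambda>t. (a t)\<^sup>2 * (norm (g t))\<^sup>2)"
  shows "summable (\<lambda>t. a t * (norm (D (\<theta> t)))\<^sup>2)"
proof -
  \<comment> \<open>The noise series may converge only conditionally, so it enters through bounded
    partial sums and not through absolute values.\<close>
  obtain B where B: "\<And>n. \<bar>\<Sum>t<n. a t * (D (\<theta> t) \<bullet> M t)\<bar> \<le> B"
    using convergent_imp_Bseq[OF DM] unfolding Bseq_def by auto
  have Db: "0 \<le> Db" using norm_ge_zero D_bounded order_trans by blast
  have inc: "a t * (norm (D (\<theta> t)))\<^sup>2 \<le> u (\<theta> (Suc t)) - u (\<theta> t) + Db * (a t * norm (e t)) - a t * (D (\<theta> t) \<bullet> M t)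
      + \<bar>K\<bar> * ((a t)\<^sup>2 * (norm (g t))\<^sup>2)" for t
  proof -
    have "\<bar>u (\<theta> (Suc t)) - u (\<theta> t) - a t * (g t \<bullet> D (\<theta> t))\<bar> \<le> \<bar>K\<bar> * ((a t)\<^sup>2 * (norm (g t))\<^sup>2)"
      using order_trans[OF expansion[of "\<theta> (Suc t)" "\<theta> t"] mult_right_mono[OF abs_ge_self[of K]]]
      by (simp add: step power_mult_distrib)
    moreover have "a t * (g t \<bullet> D (\<theta> t)) = a t * (norm (D (\<theta> t)))\<^sup>2 + a t * (e t \<bullet> D (\<theta> t)) + a t * (D (\<theta> t) \<bullet> M t)"
      by (simp add: g inner_add_left inner_add_right power2_norm_eq_inner distrib_left inner_commute)
    moreover have "\<bar>a t * (e t \<bullet> D (\<theta> t))\<bar> \<le> Db * (a t * norm (e t))"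
    proof -
      have "\<bar>e t \<bullet> D (\<theta> t)\<bar> \<le> norm (e t) * Db"
        by (rule order_trans[OF Cauchy_Schwarz_ineq2 mult_left_mono[OF D_bounded]]) simp
      from mult_left_mono[OF this, of "a t"] show ?thesis using a[of t] by (simp add: abs_mult mult_ac)
    qed
    ultimately show ?thesis by linarith
  qed
  show ?thesis
  proof (rule summableI_nonneg_bounded)
    fix n
    have "(\<Sum>t<n. a t * (norm (D (\<theta> t)))\<^sup>2) \<le> (\<Sum>t<n. u (\<theta> (Suc t)) - u (\<theta> t) + Db * (a t * norm (e t)) - a t * (D (\<theta> t) \<bullet> M t)
      + \<bar>K\<bar> * ((a t)\<^sup>2 * (norm (g t))\<^sup>2))"
      by (rule sum_mono[OF inc])
    also have "\<dots> = u (\<theta> n) - u (\<theta> 0) + Db * (\<Sum>t<n. a t * norm (e t)) - (\<Sum>t<n. a t * (D (\<theta> t) \<bullet> M t))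
        + \<bar>K\<bar> * (\<Sum>t<n. (a t)\<^sup>2 * (norm (g t))\<^sup>2)"
      using sum_lessThan_telescope[of "\<lambda>t. u (\<theta> t)" n] by (simp add: sum.distrib sum_subtractf sum_distrib_left)
    also have "\<dots> \<le> C + Db * suminf (\<lambda>t. a t * norm (e t)) + B + \<bar>K\<bar> * suminf (\<lambda>t. (a t)\<^sup>2 * (norm (g t))\<^sup>2)"
    proof -
      have "(\<Sum>t<n. a t * norm (e t)) \<le> suminf (\<lambda>t. a t * norm (e t))"
        by (rule sum_le_suminf[OF e]) (use a in \<open>auto simp: less_imp_le\<close>)
      moreover have "(\<Sum>t<n. (a t)\<^sup>2 * (norm (g t))\<^sup>2) \<le> suminf (\<lambda>t. (a t)\<^sup>2 * (norm (g t))\<^sup>2)"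
        by (rule sum_le_suminf[OF g2]) auto
      ultimately have "Db * (\<Sum>t<n. a t * norm (e t)) \<le> Db * suminf (\<lambda>t. a t * norm (e t))"
        "\<bar>K\<bar> * (\<Sum>t<n. (a t)\<^sup>2 * (norm (g t))\<^sup>2) \<le> \<bar>K\<bar> * suminf (\<lambda>t. (a t)\<^sup>2 * (norm (g t))\<^sup>2)"
        using Db by (auto intro: mult_left_mono)
      then show ?thesis using bounded[of "\<theta> n" "\<theta> 0"] B[of n] by linarith
    qed
    finally show "(\<Sum>t<n. a t * (norm (D (\<theta> t)))\<^sup>2) \<le> \<dots>" .
  qed (use a in \<open>auto simp: less_imp_le\<close>)
qed

text \<open>Between a time \<open>k\<close> with \<open>norm (D (\<theta> k)) < \<epsilon>\<close> and a later excursion above \<open>2 * \<epsilon>\<close> the iterate would have to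
  travel a distance bounded below, which the summability of \<open>a t * (norm (D (\<theta> t)))\<^sup>2\<close> forbids.\<close>

lemma perturbed_gradient_ascent_tendsto:
  fixes \<theta> :: "nat \<Rightarrow> 'a::euclidean_space" and D :: "'a \<Rightarrow> 'a" and a :: "nat \<Rightarrow> real"
  assumes a: "\<And>t. 0 < a t" and a_sum: "\<not> summable a" and a_lim: "a \<longlonglongrightarrow> 0"
    and lip: "\<And>x y. norm (D y - D x) \<le> L * norm (y - x)"
    and step: "\<And>t. \<theta> (Suc t) = \<theta> t + a t *\<^sub>R D (\<theta> t) + r t"
    and r: "convergent (\<lambda>n. \<Sum>t<n. r t)"
    and D2: "summable (\<lambda>t. a t * (norm (D (\<theta> t)))\<^sup>2)"
  shows "(\<lambda>t. D (\<theta> t)) \<longlonglongrightarrow> 0"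
proof (rule LIMSEQ_I)
  fix \<epsilon>' :: real assume "0 < \<epsilon>'"
  define \<epsilon> where "\<epsilon> = \<epsilon>' / 3"
  have \<epsilon>: "0 < \<epsilon>" using \<open>0 < \<epsilon>'\<close> by (simp add: \<epsilon>_def)
  define x where "x t = norm (D (\<theta> t))" for t
  \<comment> \<open>The length budget: three displacements of size at most \<open>\<eta>\<close>,
    after the Lipschitz bound, change the gradient by at most \<open>\<epsilon>\<close>.\<close>
  define \<eta> where "\<eta> = \<epsilon> / (3 * (\<bar>L\<bar> + 1))"
  have \<eta>: "0 < \<eta>" using \<epsilon> by (simp add: \<eta>_def)
  have "Cauchy (\<lambda>n. \<Sum>t<n. r t)" using r by (rule convergent_Cauchy)
  then obtain N1 where N1: "\<And>m n. N1 \<le> m \<Longrightarrow> N1 \<le> n \<Longrightarrow> norm ((\<Sum>t<m. r t) - (\<Sum>t<n. r t)) < \<eta>"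
    using CauchyD[OF _ \<eta>] by blast
  obtain N2 where N2: "\<And>m n. N2 \<le> m \<Longrightarrow> norm (\<Sum>t=m..<n. a t * (x t)\<^sup>2) < \<epsilon> * \<eta>"
    using D2 \<epsilon> \<eta> unfolding summable_Cauchy x_def by (meson mult_pos_pos)
  obtain N3 where N3: "\<And>n. N3 \<le> n \<Longrightarrow> a n * \<epsilon> < \<eta>"
  proof -
    have "(\<lambda>n. a n * \<epsilon>) \<longlonglongrightarrow> 0 * \<epsilon>" by (intro tendsto_intros a_lim)
    then have "\<forall>\<^sub>F n in sequentially. a n * \<epsilon> < \<eta>" using \<eta> by (intro order_tendstoD) auto
    then show ?thesis using that by (auto simp: eventually_sequentially)
  qed
  define N where "N = max N1 (max N2 N3)"
  \<comment> \<open>Small gradients occur arbitrarily late, since otherwise the weighted squares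
    would dominate a multiple of the divergent step sizes.\<close>
  have "\<exists>m\<ge>N. x m < \<epsilon>"
  proof (rule ccontr)
    assume "\<not> ?thesis"
    then have ge: "\<epsilon> \<le> x m" if "N \<le> m" for m using that by (auto simp: not_less)
    have "summable a"
    proof (rule summable_comparison_test'[of "\<lambda>t. (a t * (x t)\<^sup>2) / \<epsilon>\<^sup>2" N])
      show "summable (\<lambda>t. (a t * (x t)\<^sup>2) / \<epsilon>\<^sup>2)" using D2 unfolding x_def by (rule summable_divide)
      fix n assume "N \<le> n"
      then have "\<epsilon>\<^sup>2 \<le> (x n)\<^sup>2" using ge \<epsilon> by (intro power_mono) auto
      then have "a n * \<epsilon>\<^sup>2 \<le> a n * (x n)\<^sup>2" using a[of n] by simp
      then show "norm (a n) \<le> (a n * (x n)\<^sup>2) / \<epsilon>\<^sup>2" using a[of n] \<epsilon> by (simp add: pos_le_divide_eq)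
    qed
    with a_sum show False by simp
  qed
  then obtain m where m: "N \<le> m" "x m < \<epsilon>" by blast
  have "x n \<le> 2 * \<epsilon>" if n: "m \<le> n" for n
  proof (cases "x n < \<epsilon>")
    case False
    let ?P = "\<lambda>k. m \<le> k \<and> k \<le> n \<and> x k < \<epsilon>"
    \<comment> \<open>The last time up to \<open>n\<close> with a gradient below
      \<open>\<epsilon>\<close>; from there to \<open>n\<close> the gradient stays at least
      \<open>\<epsilon>\<close>.\<close>
    define k where "k = (GREATEST k. ?P k)"
    have P: "?P k" unfolding k_def by (rule GreatestI_nat[of _ m n]) (use m n in auto)
    have after: "\<epsilon> \<le> x t" if "k < t" "t \<le> n" for t
    proof (rule ccontr)
      assume "\<not> \<epsilon> \<le> x t"
      then have "?P t" using that P by auto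
      then have "t \<le> k" unfolding k_def by (rule Greatest_le_nat[of _ _ n]) auto
      with that show False by simp
    qed
    have kn: "k < n" using P False by (metis le_neq_implies_less)
    have kN: "N1 \<le> k" "N2 \<le> Suc k" "N3 \<le> k" using P m by (auto simp: N_def)
    have dist: "\<theta> n' = \<theta> k + (\<Sum>t=k..<n'. a t *\<^sub>R D (\<theta> t)) + ((\<Sum>t<n'. r t) - (\<Sum>t<k. r t))" if "k \<le> n'" for n'
      using that by (induction rule: dec_induct) (auto simp: step algebra_simps)
    have "norm (\<theta> n - \<theta> k) \<le> norm (\<Sum>t=k..<n. a t *\<^sub>R D (\<theta> t)) + norm ((\<Sum>t<n. r t) - (\<Sum>t<k. r t))"
      using dist[of n] kn norm_triangle_ineq by simp
    also have "norm ((\<Sum>t<n. r t) - (\<Sum>t<k. r t)) \<le> \<eta>" using N1[of n k] kN kn by simp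
    also have "norm (\<Sum>t=k..<n. a t *\<^sub>R D (\<theta> t)) \<le> (\<Sum>t=k..<n. a t * x t)"
      by (rule sum_norm_le) (use a in \<open>simp add: x_def less_imp_le\<close>)
    also have "\<dots> = a k * x k + (\<Sum>t=Suc k..<n. a t * x t)" using kn by (simp add: sum.atLeast_Suc_lessThan)
    also have "a k * x k \<le> a k * \<epsilon>" using P a[of k] by simp
    also have "a k * \<epsilon> \<le> \<eta>" using N3[of k] kN by simp
    \<comment> \<open>On the excursion \<open>x t\<close> is at least \<open>\<epsilon>\<close>, so
      the path length is controlled by the summable weighted squares divided by
      \<open>\<epsilon>\<close>.\<close>
    also have "(\<Sum>t=Suc k..<n. a t * x t) \<le> (\<Sum>t=Suc k..<n. (a t * (x t)\<^sup>2) / \<epsilon>)"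
    proof (rule sum_mono)
      fix t assume "t \<in> {Suc k..<n}"
      then have "\<epsilon> * x t \<le> x t * x t" using after[of t] by (intro mult_right_mono) (auto simp: x_def)
      then have "a t * (\<epsilon> * x t) \<le> a t * (x t * x t)" using a[of t] by simp
      then show "a t * x t \<le> (a t * (x t)\<^sup>2) / \<epsilon>" using \<epsilon> by (simp add: pos_le_divide_eq power2_eq_square mult_ac)
    qed
    also have "\<dots> = (\<Sum>t=Suc k..<n. a t * (x t)\<^sup>2) / \<epsilon>" by (simp add: sum_divide_distrib)
    also have "\<dots> \<le> \<eta>" using N2[of "Suc k" n] kN \<epsilon> by (simp add: pos_divide_le_eq mult.commute)
    finally have d: "norm (\<theta> n - \<theta> k) \<le> 3 * \<eta>" by simp
    have "norm (D (\<theta> n) - D (\<theta> k)) \<le> \<bar>L\<bar> * norm (\<theta> n - \<theta> k)"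
      by (rule order_trans[OF lip mult_right_mono]) auto
    also have "\<dots> \<le> \<bar>L\<bar> * (3 * \<eta>)" using d by (intro mult_left_mono) auto
    also have "\<dots> \<le> \<epsilon>" using \<epsilon> by (simp add: \<eta>_def pos_divide_le_eq algebra_simps)
    finally have "norm (D (\<theta> n) - D (\<theta> k)) \<le> \<epsilon>" .
    moreover have "x n \<le> x k + norm (D (\<theta> n) - D (\<theta> k))" unfolding x_def by (metis norm_triangle_sub)
    ultimately show ?thesis using P by simp
  qed (use \<epsilon> in simp)
  moreover have "2 * \<epsilon> < \<epsilon>'" using \<open>0 < \<epsilon>'\<close> by (simp add: \<epsilon>_def)
  ultimately show "\<exists>no. \<forall>n\<ge>no. norm (D (\<theta> n) - 0) < \<epsilon>'"
    unfolding x_def by (intro exI[of _ m]) fastforce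
qed

section \<open>Convergence of networked play\<close>

text \<open>The bounded multiplier \<open>H\<close> is known before the estimate of the round, so
  the weighted and centred estimates remain martingale differences; their variances are dominated by
  the squared step sizes.\<close>

lemma martingale_noise_convergent:
  fixes G H :: "nat \<Rightarrow> 'w \<Rightarrow> real"
  assumes P: "prob_space P" and sub: "\<And>t. subalgebra P (F t)"
    and mono: "\<And>s t. s \<le> t \<Longrightarrow> sets (F s) \<subseteq> sets (F t)"
    and G: "\<And>t. G t \<in> borel_measurable (F (Suc t))"
    and G2: "\<And>t. (\<integral>\<^sup>+\<omega>. ennreal ((G t \<omega>)\<^sup>2) \<partial>P) \<le> ennreal C" and C: "0 \<le> C"
    and mu: "\<And>t. AE \<omega> in P. \<bar>real_cond_exp P (F t) (G t) \<omega>\<bar> \<le> B"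
    and H: "\<And>t. H t \<in> borel_measurable (F t)" and Hb: "\<And>t \<omega>. \<bar>H t \<omega>\<bar> \<le> b"
    and a: "summable (\<lambda>t. (a t)\<^sup>2)"
  shows "AE \<omega> in P. convergent (\<lambda>n. \<Sum>t<n. a t * (H t \<omega> * (G t \<omega> - real_cond_exp P (F t) (G t) \<omega>)))"
proof -
  interpret prob_space P by fact
  let ?mu = "\<lambda>t. real_cond_exp P (F t) (G t)"
  let ?X = "\<lambda>t \<omega>. a t * (H t \<omega> * (G t \<omega> - ?mu t \<omega>))"
  have FS: "f \<in> borel_measurable (F (Suc t))" if "f \<in> borel_measurable (F t)" for f :: "'w \<Rightarrow> real" and t
  proof (rule measurable_from_subalg[OF _ that])
    show "subalgebra (F (Suc t)) (F t)"
      using mono[of t "Suc t"] sub[of t] sub[of "Suc t"] by (simp add: subalgebra_def)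
  qed
  have FP: "f \<in> borel_measurable P" if "f \<in> borel_measurable (F t)" for f :: "'w \<Rightarrow> real" and t
    using measurable_from_subalg[OF sub that] .
  have muF: "?mu t \<in> borel_measurable (F t)" for t by simp
  have GP[measurable]: "G t \<in> borel_measurable P" for t using FP[OF G] .
  have muP[measurable]: "?mu t \<in> borel_measurable P" for t using FP[OF muF] .
  have HP[measurable]: "H t \<in> borel_measurable P" for t using FP[OF H] .
  have iG2: "integrable P (\<lambda>\<omega>. (G t \<omega>)\<^sup>2)" for t
    by (rule integrableI_nonneg) (use le_less_trans[OF G2[of t]] in auto)
  have eG2: "(\<integral>\<omega>. (G t \<omega>)\<^sup>2 \<partial>P) \<le> C" for t
    by (subst integral_eq_nn_integral) (use G2[of t] C in \<open>auto intro!: enn2real_leI\<close>)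
  have iG: "integrable P (G t)" for t
  proof (rule Bochner_Integration.integrable_bound[of P "\<lambda>\<omega>. 1 + (G t \<omega>)\<^sup>2"])
    show "integrable P (\<lambda>\<omega>. 1 + (G t \<omega>)\<^sup>2)" using iG2 by simp
    have "\<bar>x\<bar> \<le> 1 + x\<^sup>2" for x :: real using le_one_plus_square[of "\<bar>x\<bar>"] by simp
    then show "AE \<omega> in P. norm (G t \<omega>) \<le> norm (1 + (G t \<omega>)\<^sup>2)" by simp
  qed measurable
  have b0: "0 \<le> b" using Hb[of undefined undefined] by linarith
  have bound: "AE \<omega> in P. (?X t \<omega>)\<^sup>2 \<le> (a t)\<^sup>2 * (b\<^sup>2 * (2 * (G t \<omega>)\<^sup>2 + 2 * B\<^sup>2))" for t
    using mu[of t]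
  proof eventually_elim
    case (elim \<omega>)
    have "(H t \<omega>)\<^sup>2 \<le> b\<^sup>2" using power_mono[OF Hb[of t \<omega>], of 2] by simp
    moreover have "(G t \<omega> - ?mu t \<omega>)\<^sup>2 \<le> 2 * (G t \<omega>)\<^sup>2 + 2 * B\<^sup>2"
    proof -
      have "(G t \<omega> - ?mu t \<omega>)\<^sup>2 \<le> 2 * (G t \<omega>)\<^sup>2 + 2 * (?mu t \<omega>)\<^sup>2"
        using zero_le_power2[of "G t \<omega> + ?mu t \<omega>"] by (simp add: power2_eq_square algebra_simps)
      moreover have "(?mu t \<omega>)\<^sup>2 \<le> B\<^sup>2" using power_mono[OF elim, of 2] by simp
      ultimately show ?thesis by linarith
    qed
    ultimately have "(H t \<omega>)\<^sup>2 * (G t \<omega> - ?mu t \<omega>)\<^sup>2 \<le> b\<^sup>2 * (2 * (G t \<omega>)\<^sup>2 + 2 * B\<^sup>2)"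
      by (intro mult_mono) auto
    then show ?case by (simp add: power_mult_distrib mult_left_mono)
  qed
  have idom: "integrable P (\<lambda>\<omega>. (a t)\<^sup>2 * (b\<^sup>2 * (2 * (G t \<omega>)\<^sup>2 + 2 * B\<^sup>2)))" for t
    using iG2 by (intro integrable_mult_right Bochner_Integration.integrable_add) auto
  have iX2: "integrable P (\<lambda>\<omega>. (?X t \<omega>)\<^sup>2)" for t
  proof (rule Bochner_Integration.integrable_bound[OF idom[of t]])
    show "AE \<omega> in P. norm ((?X t \<omega>)\<^sup>2) \<le> norm ((a t)\<^sup>2 * (b\<^sup>2 * (2 * (G t \<omega>)\<^sup>2 + 2 * B\<^sup>2)))"
      using bound[of t] by eventually_elim simp
  qed measurable
  have iHX: "integrable P (\<lambda>\<omega>. (a t * H t \<omega>) * (G t \<omega> - ?mu t \<omega>))" for t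
  proof (rule Bochner_Integration.integrable_bound[of P "\<lambda>\<omega>. 1 + (?X t \<omega>)\<^sup>2"])
    show "integrable P (\<lambda>\<omega>. 1 + (?X t \<omega>)\<^sup>2)" using iX2 by simp
    have "\<bar>x\<bar> \<le> 1 + x\<^sup>2" for x :: real using le_one_plus_square[of "\<bar>x\<bar>"] by simp
    from this[of "?X t _"] show "AE \<omega> in P. norm ((a t * H t \<omega>) * (G t \<omega> - ?mu t \<omega>)) \<le> norm (1 + (?X t \<omega>)\<^sup>2)"
      by (simp add: mult.assoc)
  qed measurable
  interpret L2_martingale_differences P F ?X
  proof unfold_locales
    fix t
    show "subalgebra P (F t)" by (rule sub)
    show "sets (F s) \<subseteq> sets (F t)" if "s \<le> t" for s using mono[OF that] .
    show "?X t \<in> borel_measurable (F (Suc t))"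
      using G[of t] FS[OF H[of t]] FS[OF muF[of t]] by measurable
    show "integrable P (\<lambda>\<omega>. (?X t \<omega>)\<^sup>2)" by (rule iX2)
    interpret s: finite_measure_subalgebra P "F t" by unfold_locales (rule sub)
    have imu: "integrable P (?mu t)" by (rule s.real_cond_exp_int(1)[OF iG])
    have "AE \<omega> in P. real_cond_exp P (F t) (\<lambda>\<omega>. (a t * H t \<omega>) * (G t \<omega> - ?mu t \<omega>)) \<omega> =
        (a t * H t \<omega>) * real_cond_exp P (F t) (\<lambda>\<omega>. G t \<omega> - ?mu t \<omega>) \<omega>"
      by (rule s.real_cond_exp_mult[OF _ _ iHX]) (use H[of t] in measurable)
    moreover have "AE \<omega> in P. real_cond_exp P (F t) (\<lambda>\<omega>. G t \<omega> - ?mu t \<omega>) \<omega> = ?mu t \<omega> - real_cond_exp P (F t) (?mu t) \<omega>"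
      by (rule s.real_cond_exp_diff[OF iG imu])
    moreover have "AE \<omega> in P. real_cond_exp P (F t) (?mu t) \<omega> = ?mu t \<omega>"
      by (rule s.real_cond_exp_F_meas[OF imu muF])
    ultimately show "AE \<omega> in P. real_cond_exp P (F t) (?X t) \<omega> = 0"
      by eventually_elim (simp add: mult.assoc)
  qed
  show ?thesis
  proof (rule AE_convergent, rule summable_comparison_test'[of "\<lambda>t. (a t)\<^sup>2 * (b\<^sup>2 * (2 * C + 2 * B\<^sup>2))" 0])
    show "summable (\<lambda>t. (a t)\<^sup>2 * (b\<^sup>2 * (2 * C + 2 * B\<^sup>2)))" using a by (rule summable_mult2)
    fix t
    have "(\<integral>\<omega>. (?X t \<omega>)\<^sup>2 \<partial>P) \<le> (\<integral>\<omega>. (a t)\<^sup>2 * (b\<^sup>2 * (2 * (G t \<omega>)\<^sup>2 + 2 * B\<^sup>2)) \<partial>P)"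
      by (rule integral_mono_AE[OF iX2 idom bound])
    also have "\<dots> = (a t)\<^sup>2 * (b\<^sup>2 * (2 * (\<integral>\<omega>. (G t \<omega>)\<^sup>2 \<partial>P) + 2 * B\<^sup>2))"
      using iG2[of t] by (simp add: prob_space)
    also have "\<dots> \<le> (a t)\<^sup>2 * (b\<^sup>2 * (2 * C + 2 * B\<^sup>2))"
      using eG2[of t] by (intro mult_left_mono) auto
    finally show "norm (\<integral>\<omega>. (?X t \<omega>)\<^sup>2 \<partial>P) \<le> (a t)\<^sup>2 * (b\<^sup>2 * (2 * C + 2 * B\<^sup>2))" by simp
  qed
qed

text \<open>The expectation of the whole series is finite, hence the series is finite almost
  surely.\<close>

lemma AE_summable_squares:
  fixes G :: "nat \<Rightarrow> 'w \<Rightarrow> real"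
  assumes G[measurable]: "\<And>t. G t \<in> borel_measurable P"
    and G2: "\<And>t. (\<integral>\<^sup>+\<omega>. ennreal ((G t \<omega>)\<^sup>2) \<partial>P) \<le> ennreal C" and C: "0 \<le> C"
    and a: "summable (\<lambda>t. (a t)\<^sup>2)"
  shows "AE \<omega> in P. summable (\<lambda>t. (a t * G t \<omega>)\<^sup>2)"
proof -
  have meas: "(\<lambda>\<omega>. \<Sum>t. ennreal ((a t * G t \<omega>)\<^sup>2)) \<in> borel_measurable P" by measurable
  have "(\<integral>\<^sup>+\<omega>. (\<Sum>t. ennreal ((a t * G t \<omega>)\<^sup>2)) \<partial>P) = (\<Sum>t. \<integral>\<^sup>+\<omega>. ennreal ((a t * G t \<omega>)\<^sup>2) \<partial>P)"
    by (rule nn_integral_suminf) measurable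
  also have "\<dots> = (\<Sum>t. ennreal ((a t)\<^sup>2) * (\<integral>\<^sup>+\<omega>. ennreal ((G t \<omega>)\<^sup>2) \<partial>P))"
    by (simp add: power_mult_distrib ennreal_mult nn_integral_cmult)
  also have "\<dots> \<le> (\<Sum>t. ennreal ((a t)\<^sup>2 * C))"
    by (rule suminf_le) (use G2 C in \<open>auto simp: ennreal_mult intro!: mult_left_mono\<close>)
  also have "\<dots> < \<top>"
    using summable_mult2[OF a, of C] C by (subst suminf_ennreal2) auto
  finally have "AE \<omega> in P. (\<Sum>t. ennreal ((a t * G t \<omega>)\<^sup>2)) \<noteq> \<infinity>"
    by (intro nn_integral_PInf_AE[OF meas]) (auto simp: infinity_ennreal_def)
  then show ?thesis by eventually_elim (rule summable_suminf_not_top, auto)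
qed

text \<open>Consensus for one coordinate along one path: only the finite initial disagreement on
  that path and the square-summable moves of the owner enter.\<close>

lemma belief_deviation_bound:
  fixes bel :: "'n::finite \<Rightarrow> nat \<Rightarrow> real" and th :: "nat \<Rightarrow> real"
  assumes connected: "\<And>i j. (i, j) \<in> (recurrent_edges E)\<^sup>*"
    and T: "T > 0"
    and window: "\<And>i j t. (i, j) \<in> recurrent_edges E \<Longrightarrow> t \<ge> 1 \<Longrightarrow> (i, j) \<in> (\<Union>\<tau>\<in>{0..T - 1}. E (t + \<tau>))"
    and h: "0 < h" "h < 1"
    and w_nonneg: "\<And>t i l. t \<ge> 1 \<Longrightarrow> 0 \<le> w t i l"
    and w_lower: "\<And>t i l. t \<ge> 1 \<Longrightarrow> i \<noteq> j \<Longrightarrow> (i, l) \<in> E t \<or> l = i \<Longrightarrow> h \<le> w t i l"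
    and w_own: "\<And>t. t \<ge> 1 \<Longrightarrow> w t j j = 1" and w_sum: "\<And>t i. t \<ge> 1 \<Longrightarrow> (\<Sum>l\<in>UNIV. w t i l) = 1"
    and update: "\<And>t i. bel i (Suc t) = (\<Sum>l\<in>UNIV. w (Suc t) i l * (bel l t + (th (Suc t) - th t) * (if l = j then 1 else 0)))"
    and init: "bel j 0 = th 0"
    and moves: "summable (\<lambda>t. (th (Suc t) - th t)\<^sup>2)"
  shows "\<exists>Y. summable (\<lambda>t. (Y t)\<^sup>2) \<and> (\<forall>t i. \<bar>bel i t - th t\<bar> \<le> Y t)"
proof -
  \<comment> \<open>The owner puts weight one on itself and its nonnegative weights sum to one, so
    it ignores all others and its belief never leaves the true value.\<close>
  have w0: "w (Suc t) j l = 0" if "l \<noteq> j" for t l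
  proof -
    have "(\<Sum>l\<in>UNIV - {j}. w (Suc t) j l) = 0"
      using sum.remove[of UNIV j "w (Suc t) j"] w_sum[of "Suc t" j] w_own[of "Suc t"] by simp
    then show ?thesis using that w_nonneg[of "Suc t"] by (subst (asm) sum_nonneg_eq_0_iff) auto
  qed
  have own: "bel j t = th t" for t
  proof (induction t)
    case (Suc t)
    have "bel j (Suc t) = (\<Sum>l\<in>UNIV. if l = j then bel j t + (th (Suc t) - th t) else 0)"
      unfolding update by (intro sum.cong refl) (auto simp: w0 w_own)
    then show ?case by (simp add: Suc)
  qed (rule init)
  let ?y = "\<lambda>t i. \<bar>bel i t - th t\<bar>" and ?d = "\<lambda>t. \<bar>th (Suc t) - th t\<bar>"
  \<comment> \<open>Index \<open>t\<close> of the locale stands for round \<open>Suc t\<close>,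
    because weights and edges are constrained from round one on.\<close>
  interpret tracking "\<lambda>t. w (Suc t)" "\<lambda>t. E (Suc t)" "recurrent_edges E" ?y ?d j h T
  proof
    show "\<exists>\<tau><T. (i, l) \<in> E (Suc (t + \<tau>))" if e: "(i, l) \<in> recurrent_edges E" for i l t
    proof -
      obtain \<tau> where "\<tau> \<le> T - 1" "(i, l) \<in> E (Suc t + \<tau>)" using window[OF e, of "Suc t"] by auto
      then show ?thesis using T by (intro exI[of _ \<tau>]) auto
    qed
    show "?y (Suc t) i \<le> (\<Sum>l\<in>UNIV. w (Suc t) i l * ?y t l) + ?d t" for t i
    proof -
      let ?w = "w (Suc t) i" and ?D = "th (Suc t) - th t"
      have th1: "th (Suc t) = (\<Sum>l\<in>UNIV. ?w l * th (Suc t))" using w_sum[of "Suc t" i] by (simp add: sum_distrib_right[symmetric])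
      have "bel i (Suc t) - th (Suc t) = (\<Sum>l\<in>UNIV. ?w l * (bel l t + ?D * (if l = j then 1 else 0))) - (\<Sum>l\<in>UNIV. ?w l * th (Suc t))"
        unfolding update using th1 by simp
      \<comment> \<open>The owner's term already contains the move, so its \<open>?D\<close>
        cancels; every other belief lags by exactly the move.\<close>
      also have "\<dots> = (\<Sum>l\<in>UNIV. ?w l * ((bel l t - th t) - ?D * (if l = j then 0 else 1)))"
        unfolding sum_subtractf[symmetric] by (intro sum.cong refl) (simp add: algebra_simps)
      also have "\<bar>\<dots>\<bar> \<le> (\<Sum>l\<in>UNIV. ?w l * (?y t l + ?d t))"
      proof (rule order_trans[OF sum_abs sum_mono])
        fix l
        have "\<bar>(bel l t - th t) - ?D * (if l = j then 0 else 1)\<bar> \<le> ?y t l + ?d t"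
          by (cases "l = j"; simp; linarith?)
        from mult_left_mono[OF this w_nonneg[of "Suc t" i l]]
        show "\<bar>?w l * ((bel l t - th t) - ?D * (if l = j then 0 else 1))\<bar> \<le> ?w l * (?y t l + ?d t)"
          using w_nonneg[of "Suc t" i l] by (simp add: abs_mult)
      qed
      also have "\<dots> = (\<Sum>l\<in>UNIV. ?w l * ?y t l) + ?d t"
        using w_sum[of "Suc t" i] by (simp add: distrib_left sum.distrib sum_distrib_right[symmetric])
      finally show ?thesis .
    qed
  qed (use h w_nonneg w_sum w_lower connected own in auto)
  have "summable (\<lambda>t. (Y t)\<^sup>2)" by (rule summable_Y_squares) (use moves in simp)
  then show ?thesis using y_le_Y by blast
qed

lemma convergent_vec:
  fixes S :: "nat \<Rightarrow> real ^ 'm::finite"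
  assumes "\<And>m. convergent (\<lambda>n. S n $ m)"
  shows "convergent S"
proof -
  obtain l where "\<And>m. (\<lambda>n. S n $ m) \<longlonglongrightarrow> l m" using assms unfolding convergent_def by metis
  then have "S \<longlonglongrightarrow> (\<chi> m. l m)" by (intro vec_tendstoI) simp
  then show ?thesis by (rule convergentI)
qed

theorem theorem1:
  fixes G :: "('s, 'n::finite, 'k::finite, 'm::finite) game"
    and u :: "real ^ 'm \<Rightarrow> real"
    and est :: "'n \<Rightarrow> reward_estimator"
    and \<alpha> :: "nat \<Rightarrow> real"
    and E :: "nat \<Rightarrow> ('n \<times> 'n) set"
    and w :: "nat \<Rightarrow> 'n \<Rightarrow> 'n \<Rightarrow> 'n \<Rightarrow> real"
    and P :: "'w measure"
    and F :: "nat \<Rightarrow> 'w measure"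
    and \<theta> :: "nat \<Rightarrow> 'w \<Rightarrow> real ^ 'm"
    and bel g :: "'n \<Rightarrow> nat \<Rightarrow> 'w \<Rightarrow> real ^ 'm"
    and h \<kappa> \<beta> R B V L :: real
    and T\<^sub>G :: nat
  assumes game: "markov_game G"
    and potential: "potential G u"
    and play: "networked_play G est \<alpha> w P F \<theta> bel g"
    and graph_undirected: "\<And>t. sym (E t)"
    and A1_connected: "\<And>i j. (i, j) \<in> (recurrent_edges E)\<^sup>*"
    and A1_window: "T\<^sub>G > 0"
      "\<And>i j t. (i, j) \<in> recurrent_edges E \<Longrightarrow> t \<ge> 1 \<Longrightarrow> (i, j) \<in> (\<Union>\<tau>\<in>{0..T\<^sub>G - 1}. E (t + \<tau>))"
    and A2_h: "0 < h" "h < 1"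
    and A2_nonneg: "\<And>t i j l. t \<ge> 1 \<Longrightarrow> w t i j l \<ge> 0"
    and A2_i: "\<And>t i j l. t \<ge> 1 \<Longrightarrow> i \<noteq> j \<Longrightarrow>
        (if (i, l) \<in> E t \<or> l = i then w t i j l \<ge> h else w t i j l = 0)"
    and A2_ii: "\<And>t j. t \<ge> 1 \<Longrightarrow> w t j j j = 1"
    and A2_iii: "\<And>t i j. t \<ge> 1 \<Longrightarrow> (\<Sum>l\<in>UNIV. w t i j l) = 1"
    and A3_kappa: "\<kappa> \<ge> 0"
    and A3: "\<And>i m. i \<noteq> own G m \<Longrightarrow> (\<integral>\<^sup>+ \<omega>. ennreal \<bar>bel i 0 \<omega> $ m - \<theta> 0 \<omega> $ m\<bar> \<partial>P) \<le> ennreal \<kappa>"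
    and A3_own: "\<And>m \<omega>. \<omega> \<in> space P \<Longrightarrow> bel (own G m) 0 \<omega> $ m = \<theta> 0 \<omega> $ m"
    and A4_pos: "\<And>t. t \<ge> 1 \<Longrightarrow> \<alpha> t > 0"
    and A4_beta: "1 / 2 < \<beta>" "\<beta> < 1" "\<alpha> \<in> O(\<lambda>t. real t powr (- \<beta>))"
    and A4_sum: "filterlim (\<lambda>n. \<Sum>t=1..n. \<alpha> t) at_top sequentially"
    and A4_sum_sq: "summable (\<lambda>t. (\<alpha> t)\<^sup>2)"
    and A5: "R > 0"
      "\<And>i s a. s \<in> space (states G) \<Longrightarrow> (\<forall>n. a n \<in> actions G) \<Longrightarrow> \<bar>rew G i s a\<bar> \<le> R"
    and A6_nonneg: "B \<ge> 0" "V \<ge> 0" "L \<ge> 0"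
    and A6_first: "\<And>i n \<theta>' s. s \<in> space (states G) \<Longrightarrow>
        (\<integral>\<^sup>+ a. ennreal (norm (score G i n \<theta>' s a)) \<partial>policy G n \<theta>' s) \<le> ennreal B"
    and A6_second: "\<And>i n \<theta>' s. s \<in> space (states G) \<Longrightarrow>
        (\<integral>\<^sup>+ a. ennreal ((norm (score G i n \<theta>' s a))\<^sup>2) \<partial>policy G n \<theta>' s) \<le> ennreal (V\<^sup>2)"
    and A6_Lipschitz: "\<And>i n \<theta>1 \<theta>2 s a. s \<in> space (states G) \<Longrightarrow> a \<in> actions G \<Longrightarrow>
        norm (score G i n \<theta>1 s a - score G i n \<theta>2 s a) \<le> L * norm (\<theta>1 - \<theta>2)"
  shows "AE \<omega> in P. (\<lambda>t. grad u (\<theta> t \<omega>)) \<longlonglongrightarrow> 0"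
proof -
  have rew_b: "\<bar>rew G i s a\<bar> \<le> R" if "s \<in> space (states G)" "\<forall>n. a n \<in> actions G" for i s a
    using A5(2) that by blast
  interpret smooth_markov_game G R V L
    by unfold_locales (use game A5(1) rew_b A6_nonneg A6_second A6_Lipschitz in auto)
  obtain K where K: "0 \<le> K" "\<And>i x y. \<bar>utility G i y - utility G i x - (y - x) \<bullet> value_grad i x\<bar> \<le> K * (norm (y - x))\<^sup>2"
    using utility_expansion by blast
  \<comment> \<open>The equality of block gradients, integrated along lines within one block,
    supplies the assumption on increments.\<close>
  interpret bp: block_potential "own G" u "\<lambda>i. utility G i" value_grad K value_bound
  proof
    show "u (x + block (own G) i h) - u x = utility G i (x + block (own G) i h) - utility G i x" for i x h
      by (rule block_difference_eq) (use potential in \<open>auto simp: potential_def\<close>)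
  qed (use K value_bound_nonneg utility_bound in auto)
  let ?D = bp.pgrad
  define Lp where "Lp = 6 * (real CARD('n) * (7 * K))"
  have Lp: "0 \<le> Lp" "norm (?D y - ?D x) \<le> Lp * norm (y - x)" for x y
    using K(1) bp.pgrad_Lipschitz unfolding Lp_def by auto
  have D_nth_bound: "\<bar>?D x $ m\<bar> \<le> value_bound * score_weight_mass / (1 - disc G)" for x m
    unfolding bp.pgrad_nth by (rule order_trans[OF component_le_norm_cart value_grad_bound])

  from play have P: "prob_space P" and fil: "filtration (space P) F" and sub: "\<And>t. subalgebra P (F t)"
    and \<theta>0: "\<theta> 0 \<in> borel_measurable (F 0)"
    and gm: "\<And>i t. g i (Suc t) \<in> borel_measurable (F (Suc t))"
    and law: "\<And>i t B. B \<in> sets borel \<Longrightarrow> AE \<omega> in P.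
        real_cond_exp P (F t) (indicator (g i (Suc t) -` B \<inter> space P)) \<omega> =
        measure (grad_estimator_law G (est i) i (merge_block (own G) i (\<theta> t \<omega>) (bel i t \<omega>))) B"
    and \<theta>_update: "\<And>t \<omega> m. \<omega> \<in> space P \<Longrightarrow> \<theta> (Suc t) \<omega> $ m = \<theta> t \<omega> $ m + \<alpha> (Suc t) * g (own G m) (Suc t) \<omega> $ m"
    and bel_update: "\<And>t \<omega> m. \<omega> \<in> space P \<Longrightarrow> (\<chi> i. bel i (Suc t) \<omega> $ m) =
        (\<chi> i l. w (Suc t) i (own G m) l) *v
          ((\<chi> l. bel l t \<omega> $ m) + (\<theta> (Suc t) \<omega> $ m - \<theta> t \<omega> $ m) *\<^sub>R axis (own G m) 1)"
    unfolding networked_play_def by blast+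
  interpret prob_space P by fact
  interpret filtration "space P" F by fact
  have mono: "sets (F s) \<subseteq> sets (F t)" if "s \<le> t" for s t using sets_F_mono[OF that] .
  have FS: "f \<in> borel_measurable (F (Suc t))" if "f \<in> borel_measurable (F t)" for f :: "'w \<Rightarrow> real ^ 'm" and t
    by (rule measurable_from_subalg[OF _ that]) (simp add: subalgebra_def space_F mono)

  \<comment> \<open>Shifted by one: \<open>a t\<close> is the step size of the move from
    \<open>\<theta> t\<close> to \<open>\<theta> (Suc t)\<close>, and it is positive for every
    \<open>t\<close>.\<close>
  define a where "a t = \<alpha> (Suc t)" for t
  define Gm where "Gm m t \<omega> = g (own G m) (Suc t) \<omega> $ m" for m t \<omega>
  define mu where "mu m t = real_cond_exp P (F t) (Gm m t)" for m t
  define z where "z i t \<omega> = merge_block (own G) i (\<theta> t \<omega>) (bel i t \<omega>)" for i t \<omega>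
  have a_pos: "0 < a t" for t using A4_pos by (simp add: a_def)
  have a2: "summable (\<lambda>t. (a t)\<^sup>2)" unfolding a_def using A4_sum_sq by (subst summable_Suc_iff)
  have GmF: "Gm m t \<in> borel_measurable (F (Suc t))" for m t
    unfolding Gm_def using gm[of "own G m" t] by (simp add: cart_eq_inner_axis)
  have \<theta>F: "\<theta> t \<in> borel_measurable (F t)" for t
  proof (induction t)
    case (Suc t)
    have "(\<lambda>\<omega>. \<theta> (Suc t) \<omega> $ m) \<in> borel_measurable (F (Suc t))" for m
    proof -
      have "(\<lambda>\<omega>. \<theta> t \<omega> $ m) \<in> borel_measurable (F (Suc t))" using FS[OF Suc] by (simp add: cart_eq_inner_axis)
      then have "(\<lambda>\<omega>. \<theta> t \<omega> $ m + \<alpha> (Suc t) * Gm m t \<omega>) \<in> borel_measurable (F (Suc t))"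
        using GmF by (intro borel_measurable_add borel_measurable_times borel_measurable_const)
      then show ?thesis
        by (rule measurable_cong[THEN iffD1, rotated]) (simp add: \<theta>_update space_F Gm_def)
    qed
    then show ?case by (rule borel_measurable_vecI)
  qed (rule \<theta>0)
  have gP: "g i (Suc t) \<in> borel_measurable P" for i t using measurable_from_subalg[OF sub gm] .

  have Gm2: "(\<integral>\<^sup>+\<omega>. ennreal ((Gm m t \<omega>)\<^sup>2) \<partial>P) \<le> ennreal estimator_second_moment" for m t
  proof -
    have "(\<integral>\<^sup>+\<omega>. ennreal ((Gm m t \<omega>)\<^sup>2) \<partial>P) \<le> (\<integral>\<^sup>+\<omega>. ennreal ((norm (g (own G m) (Suc t) \<omega>))\<^sup>2) \<partial>P)"
    proof (intro nn_integral_mono ennreal_leI)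
      show "(Gm m t \<omega>)\<^sup>2 \<le> (norm (g (own G m) (Suc t) \<omega>))\<^sup>2" for \<omega>
        unfolding Gm_def using power_mono[OF component_le_norm_cart[of "g (own G m) (Suc t) \<omega>" m], of 2] by simp
    qed
    also have "\<dots> \<le> ennreal estimator_second_moment"
    proof (rule nn_integral_conditional_law_le[OF P sub[of t] gP[of "own G m" t], where f="\<lambda>x. ennreal ((norm x)\<^sup>2)"])
      show "AE \<omega> in P. real_cond_exp P (F t) (indicator (g (own G m) (Suc t) -` B \<inter> space P)) \<omega> =
          measure (grad_estimator_law G (est (own G m)) (own G m) (z (own G m) t \<omega>)) B"
        if "B \<in> sets borel" for B using law[OF that] by (simp add: z_def)
    qed (rule grad_estimator_law_in_space, measurable, rule grad_estimator_law_second_moment)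
    finally show ?thesis .
  qed
  \<comment> \<open>By unbiasedness the conditional mean is the coordinate of the policy gradient at
    the believed parameter. For a coordinate of that agent's own block this is a coordinate of the
    gradient of the potential, evaluated at the wrong point.\<close>
  have mu_eq: "AE \<omega> in P. mu m t \<omega> = ?D (z (own G m) t \<omega>) $ m" for m t
  proof -
    have "AE \<omega> in P. real_cond_exp P (F t) (\<lambda>\<omega>. g (own G m) (Suc t) \<omega> $ m) \<omega> =
        (\<integral>x. x $ m \<partial>grad_estimator_law G (est (own G m)) (own G m) (z (own G m) t \<omega>))"
    proof (rule real_cond_exp_conditional_law[OF P sub gP grad_estimator_law_in_space])
      show "(\<lambda>x :: real ^ 'm. x $ m) \<in> borel_measurable borel" by (simp add: cart_eq_inner_axis)
      show "integrable (grad_estimator_law G (est (own G m)) (own G m) (z (own G m) t \<omega>)) (\<lambda>x. x $ m)" for \<omega>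
        by (rule grad_estimator_law_mean(1))
    qed (unfold z_def, rule law)
    then show ?thesis
      by eventually_elim (simp add: mu_def Gm_def[abs_def] grad_estimator_law_mean(2) block_nth bp.pgrad_nth)
  qed
  have mu_bound: "AE \<omega> in P. \<bar>real_cond_exp P (F t) (Gm m t) \<omega>\<bar> \<le> value_bound * score_weight_mass / (1 - disc G)" for m t
    using mu_eq[of m t] unfolding mu_def by eventually_elim (simp only: D_nth_bound)
  have D_cont: "continuous_on UNIV ?D"
    by (rule lipschitz_on_continuous_on[of Lp], rule lipschitz_onI) (use Lp in \<open>auto simp: dist_norm\<close>)
  have DF: "(\<lambda>\<omega>. ?D (\<theta> t \<omega>) $ m) \<in> borel_measurable (F t)" for m t
    using measurable_compose[OF \<theta>F borel_measurable_continuous_onI[OF D_cont]] by (simp add: cart_eq_inner_axis)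

  have noise: "AE \<omega> in P. convergent (\<lambda>n. \<Sum>t<n. a t * (H t \<omega> * (Gm m t \<omega> - mu m t \<omega>)))"
    if "\<And>t. H t \<in> borel_measurable (F t)" "\<And>t \<omega>. \<bar>H t \<omega>\<bar> \<le> b" for H b m
    unfolding mu_def
  proof (rule martingale_noise_convergent[OF P sub])
    show "sets (F s) \<subseteq> sets (F t)" if "s \<le> t" for s t using that by (rule mono)
  qed (rule GmF Gm2 estimator_second_moment_nonneg mu_bound that a2)+
  \<comment> \<open>The noise lemma is used twice: with multiplier one for the displacement caused
    by noise, and below with the gradient coordinates for the cross term of the ascent
    inequality.\<close>
  have ae_noise: "AE \<omega> in P. \<forall>m. convergent (\<lambda>n. \<Sum>t<n. a t * (Gm m t \<omega> - mu m t \<omega>))"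
    unfolding AE_all_countable using noise[of "\<lambda>_ _. 1" 1] by simp
  have ae_cross: "AE \<omega> in P. \<forall>m. convergent (\<lambda>n. \<Sum>t<n. a t * (?D (\<theta> t \<omega>) $ m * (Gm m t \<omega> - mu m t \<omega>)))"
    unfolding AE_all_countable by (rule allI, rule noise[OF DF D_nth_bound])
  \<comment> \<open>These are the squared moves of the iterate, coordinate by coordinate. They drive
    the consensus bound and also control the quadratic remainder of the ascent.\<close>
  have ae_moves: "AE \<omega> in P. \<forall>m. summable (\<lambda>t. (a t * Gm m t \<omega>)\<^sup>2)"
    unfolding AE_all_countable
    by (intro allI AE_summable_squares[OF measurable_from_subalg[OF sub GmF] Gm2 estimator_second_moment_nonneg a2])
  have ae_mu: "AE \<omega> in P. \<forall>m t. mu m t \<omega> = ?D (z (own G m) t \<omega>) $ m"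
    unfolding AE_all_countable using mu_eq by blast

  have a_lim: "a \<longlonglongrightarrow> 0"
  proof -
    have "(\<lambda>t. sqrt ((a t)\<^sup>2)) \<longlonglongrightarrow> sqrt 0" by (intro tendsto_real_sqrt summable_LIMSEQ_zero a2)
    then show ?thesis using a_pos by (simp add: less_imp_le)
  qed
  have a_sum: "\<not> summable a"
  proof
    assume "summable a"
    then have b: "(\<Sum>t<n. a t) \<le> suminf a" for n using a_pos by (intro sum_le_suminf) (auto simp: less_imp_le)
    have e: "(\<Sum>t=1..n. \<alpha> t) = (\<Sum>t<n. a t)" for n
      unfolding a_def using sum.shift_bounds_Suc_ivl[of \<alpha> 0 n] by (simp add: atLeast0LessThan atLeastLessThanSuc_atLeastAtMost)
    have "\<forall>\<^sub>F n in sequentially. suminf a + 1 \<le> (\<Sum>t=1..n. \<alpha> t)"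
      using A4_sum by (simp add: filterlim_at_top)
    then obtain n where "suminf a + 1 \<le> (\<Sum>t=1..n. \<alpha> t)" by (auto simp: eventually_sequentially)
    then show False unfolding e using b[of n] by linarith
  qed

  show ?thesis
    using ae_noise ae_cross ae_moves ae_mu AE_space
  proof eventually_elim
    case (elim \<omega>)
    note w = elim(5)
    let ?th = "\<lambda>t. \<theta> t \<omega>"
    \<comment> \<open>The estimate is split into the true gradient, the bias \<open>e\<close> caused
      by inaccurate beliefs and the martingale noise \<open>M\<close>.\<close>
    define e where "e t = (\<chi> m. mu m t \<omega>) - ?D (?th t)" for t
    define M where "M t = (\<chi> m. Gm m t \<omega> - mu m t \<omega>)" for t
    define gg where "gg t = (\<chi> m. Gm m t \<omega>)" for t
    have step: "?th (Suc t) = ?th t + a t *\<^sub>R gg t" for t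
      by (simp add: vec_eq_iff \<theta>_update[OF w] gg_def Gm_def a_def)
    have gg: "gg t = ?D (?th t) + e t + M t" for t
      by (simp add: vec_eq_iff gg_def e_def M_def)
    have "\<forall>m. \<exists>Y. summable (\<lambda>t. (Y t)\<^sup>2) \<and> (\<forall>t i. \<bar>bel i t \<omega> $ m - ?th t $ m\<bar> \<le> Y t)"
    proof
      fix m
      show "\<exists>Y. summable (\<lambda>t. (Y t)\<^sup>2) \<and> (\<forall>t i. \<bar>bel i t \<omega> $ m - ?th t $ m\<bar> \<le> Y t)"
      proof (rule belief_deviation_bound[OF A1_connected A1_window A2_h, where w="\<lambda>t i l. w t i (own G m) l" and j="own G m"])
        show "bel i (Suc t) \<omega> $ m = (\<Sum>l\<in>UNIV. w (Suc t) i (own G m) l *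
            (bel l t \<omega> $ m + (?th (Suc t) $ m - ?th t $ m) * (if l = own G m then 1 else 0)))" for t i
          using arg_cong[OF bel_update[OF w, of t m], of "\<lambda>v. v $ i"]
          by (simp add: matrix_vector_mult_def axis_def)
        show "summable (\<lambda>t. (?th (Suc t) $ m - ?th t $ m)\<^sup>2)"
          using elim(3) by (simp add: step gg_def)
        show "h \<le> w t i (own G m) l" if "t \<ge> 1" "i \<noteq> own G m" "(i, l) \<in> E t \<or> l = i" for t i l
          using A2_i[OF that(1,2), of l] that(3) by (simp split: if_splits)
      qed (use A2_nonneg A2_ii A2_iii A3_own w in auto)
    qed
    then obtain Y where Y: "\<And>m. summable (\<lambda>t. (Y m t)\<^sup>2)" "\<And>m t i. \<bar>bel i t \<omega> $ m - ?th t $ m\<bar> \<le> Y m t"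
      by metis
    have Y0: "0 \<le> Y m t" for m t using Y(2)[of undefined t m] by linarith
    define Z where "Z t = (\<Sum>m\<in>UNIV. Y m t)" for t
    have z_dist: "norm (z i t \<omega> - ?th t) \<le> Z t" for i t
    proof -
      have "norm (z i t \<omega> - ?th t) \<le> (\<Sum>m\<in>UNIV. \<bar>(z i t \<omega> - ?th t) $ m\<bar>)" by (rule norm_le_l1_cart)
      also have "\<dots> \<le> Z t" unfolding Z_def
        by (rule sum_mono) (use Y(2) Y0 in \<open>simp add: z_def merge_block_nth\<close>)
      finally show ?thesis .
    qed
    have e_bound: "norm (e t) \<le> real CARD('m) * (Lp * Z t)" for t
    proof -
      have "norm (e t) \<le> (\<Sum>m\<in>UNIV. \<bar>e t $ m\<bar>)" by (rule norm_le_l1_cart)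
      also have "\<dots> \<le> (\<Sum>m\<in>(UNIV :: 'm set). Lp * Z t)"
      proof (rule sum_mono)
        fix m
        have "\<bar>e t $ m\<bar> = \<bar>(?D (z (own G m) t \<omega>) - ?D (?th t)) $ m\<bar>" using elim(4) by (simp add: e_def)
        also have "\<dots> \<le> norm (?D (z (own G m) t \<omega>) - ?D (?th t))" by (rule component_le_norm_cart)
        also have "\<dots> \<le> Lp * norm (z (own G m) t \<omega> - ?th t)" by (rule Lp(2))
        also have "\<dots> \<le> Lp * Z t" by (rule mult_left_mono[OF z_dist Lp(1)])
        finally show "\<bar>e t $ m\<bar> \<le> Lp * Z t" .
      qed
      also have "\<dots> = real CARD('m) * (Lp * Z t)" by simp
      finally show ?thesis .
    qed
    have aY: "summable (\<lambda>t. a t * Y m t)" for m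
    \<comment> \<open>Step size and disagreement are each square-summable, so their product is
      summable by the inequality between arithmetic and geometric mean.\<close>
    proof (rule summable_comparison_test'[of "\<lambda>t. (a t)\<^sup>2 + (Y m t)\<^sup>2" 0])
      show "summable (\<lambda>t. (a t)\<^sup>2 + (Y m t)\<^sup>2)" by (intro summable_add a2 Y)
      fix t
      have "2 * (a t * Y m t) \<le> (a t)\<^sup>2 + (Y m t)\<^sup>2" using sum_squares_bound[of "a t" "Y m t"] by simp
      moreover have "0 \<le> a t * Y m t" using a_pos[of t] Y0[of m t] by simp
      ultimately show "norm (a t * Y m t) \<le> (a t)\<^sup>2 + (Y m t)\<^sup>2" by simp
    qed
    have aZ: "summable (\<lambda>t. a t * Z t)" unfolding Z_def sum_distrib_left by (intro summable_sum aY)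
    have ae: "summable (\<lambda>t. a t * norm (e t))"
    proof (rule summable_comparison_test'[of "\<lambda>t. (real CARD('m) * Lp) * (a t * Z t)" 0])
      show "summable (\<lambda>t. (real CARD('m) * Lp) * (a t * Z t))" by (rule summable_mult[OF aZ])
      show "norm (a t * norm (e t)) \<le> (real CARD('m) * Lp) * (a t * Z t)" for t
        using mult_left_mono[OF e_bound[of t], of "a t"] a_pos[of t] by (simp add: abs_mult mult_ac)
    qed
    have DM: "convergent (\<lambda>n. \<Sum>t<n. a t * (?D (?th t) \<bullet> M t))"
    proof -
      have "convergent (\<lambda>n. \<Sum>m\<in>UNIV. \<Sum>t<n. a t * (?D (?th t) $ m * (Gm m t \<omega> - mu m t \<omega>)))"
        by (rule convergent_sum) (use elim(2) in blast)
      then show ?thesis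
        by (subst (asm) sum.swap) (simp add: M_def inner_vec_def sum_distrib_left)
    qed
    have g2: "summable (\<lambda>t. (a t)\<^sup>2 * (norm (gg t))\<^sup>2)"
    proof -
      have "summable (\<lambda>t. \<Sum>m\<in>UNIV. (a t * Gm m t \<omega>)\<^sup>2)" by (intro summable_sum) (use elim(3) in blast)
      moreover have "(a t)\<^sup>2 * (norm (gg t))\<^sup>2 = (\<Sum>m\<in>UNIV. (a t * Gm m t \<omega>)\<^sup>2)" for t
        unfolding power2_norm_eq_inner
        by (simp add: gg_def inner_vec_def power2_eq_square sum_distrib_left mult_ac)
      ultimately show ?thesis by simp
    qed
    \<comment> \<open>The bias part converges absolutely; the noise part is only known to converge,
      which is enough because the perturbation enters through its partial sums.\<close>
    have aM: "convergent (\<lambda>n. \<Sum>t<n. a t *\<^sub>R e t + a t *\<^sub>R M t)"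
    proof -
      have "summable (\<lambda>t. a t *\<^sub>R e t)"
        by (rule summable_norm_cancel) (use ae a_pos in \<open>simp add: less_imp_le\<close>)
      then have "convergent (\<lambda>n. \<Sum>t<n. a t *\<^sub>R e t)" by (simp add: summable_iff_convergent)
      moreover have "convergent (\<lambda>n. \<Sum>t<n. a t *\<^sub>R M t)"
        by (rule convergent_vec) (use elim(1) in \<open>simp add: M_def\<close>)
      ultimately show ?thesis unfolding sum.distrib by (rule convergent_add)
    qed
    have Db: "norm (?D x) \<le> (\<Sum>m\<in>(UNIV :: 'm set). value_bound * score_weight_mass / (1 - disc G))" for x
      by (rule order_trans[OF norm_le_l1_cart sum_mono]) (rule D_nth_bound)
    have D2: "summable (\<lambda>t. a t * (norm (?D (?th t)))\<^sup>2)"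
      by (rule perturbed_gradient_ascent_summable[OF a_pos bp.potential_expansion bp.potential_bounded Db step gg ae DM g2])
    have step': "?th (Suc t) = ?th t + a t *\<^sub>R ?D (?th t) + (a t *\<^sub>R e t + a t *\<^sub>R M t)" for t
      by (simp add: step gg scaleR_add_right)
    have "(\<lambda>t. ?D (?th t)) \<longlonglongrightarrow> 0"
      by (rule perturbed_gradient_ascent_tendsto[OF a_pos a_sum a_lim Lp(2) step' aM D2])
    then show ?case by (simp add: bp.grad_potential)
  qed
qed

end
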